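(* Let $\mathcal{A}$ be a line arrangement in $\mathbb{P}^2$ of $d=7$ lines whose maximal point multiplicity is $m=3$, and let $r=e_1$ be the minimal degree of a Jacobian relation. Then one of the following cases holds. (1) $\tau(\mathcal{A})=27$, $n_3=6$, and $\mathcal{A}$ is free with exponents $(3,3)$. (2) $\tau(\mathcal{A})=26$, $n_3=5$, and $\mathcal{A}$ is nearly free with exponents $(3,4,4)$. (3) $\tau(\mathcal{A})=25$, $n_3=4$, and one of the following two cases occurs. (a) There is a line $L_0\in\mathcal{A}$ containing no triple point; if this is so, then $\mathcal{A}$ is a plus-one generated curve with exponents $(3,4,5)$. (b) There is a line $L_1\in\mathcal{A}$ containing exactly one triple point; if this is so, then $r=4$ and $\mathcal{A}$ is a maximal Tjurina curve of type $(7,4)$. (4) $\tau(\mathcal{A})=24$, $n_3=3$, and then $e_1=e_2=e_3=4$ and the following holds. (a) If there is a line $L_0\in\mathcal{A}$ containing no triple point, then $\mathcal{A}$ has type $2$ with exponents $(4,4,4,5)$. (b) If there is no line in $\mathcal{A}$ containing no triple point, then $\mathcal{A}$ has type $2$ with exponents $(4,4,4)$. (5) $\tau(\mathcal{A})=23$, $n_3=2$, and $\mathcal{A}$ has type $2$ with exponents $(4,4,5,5)$. (6) $\tau(\mathcal{A})=22$, $n_3=1$, and $\mathcal{A}$ has type $3$ with exponents $(4,5,5,5,5)$.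
   Context: Let $S=\mathbb{C}[x,y,z]$ with the standard grading. A line arrangement $\mathcal{A}: f=0$ in $\mathbb{P}^2=\mathbb{P}^2_{\mathbb{C}}$ is given by $f=\ell_1\cdots\ell_d$ with $\ell_i\in S_1$ pairwise non-proportional. The multiplicity of a point is the number of lines of $\mathcal{A}$ through it; $n_k$ is the number of points of multiplicity exactly $k$; a triple point is a point of multiplicity $3$; the total Tjurina number is $\tau(\mathcal{A})=\sum_{k\geq 2}n_k(k-1)^2$. Let $AR(f)=\{(a,b,c)\in S^3: af_x+bf_y+cf_z=0\}$, graded by the common degree of $a,b,c$. The exponents $(e_1,\ldots,e_s)$, $e_1\leq\cdots\leq e_s$, of $\mathcal{A}$ are the degrees of a minimal homogeneous generating set of $AR(f)$; $r=\mathrm{mdr}(f)=e_1$. $\mathcal{A}$ is free if $AR(f)$ is a free $S$-module (equivalently $s=2$). $\mathcal{A}$ is plus-one generated if $s=3$ and $e_1+e_2=d$; it is nearly free if moreover $e_3=e_2$. The type of $\mathcal{A}$ is $t(\mathcal{A})=e_1+e_2-d+1$. A reduced plane curve of degree $d$ with $r=\mathrm{mdr}(f)$ and $2r\geq d$ is a maximal Tjurina curve of type $(d,r)$ if its total Tjurina number equals $(d-1)^2-r(d-r-1)-\binom{2r+2-d}{2}$. *)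

theory Defs
  imports "HOL-Analysis.Analysis" "HOL-Computational_Algebra.Polynomial"
begin

text \<open>We realise \<open>\<complex>[x,y,z]\<close> as \<open>\<complex>[z][y][x]\<close>, with \<open>x\<close> as the outermost variable:
  the coefficient of the monomial \<open>x\<^sup>i y\<^sup>j z\<^sup>k\<close> in \<open>p\<close> is \<open>coeff (coeff (coeff p i) j) k\<close>.\<close>

type_synonym S = "complex poly poly poly"

definition homogeneous :: "S \<Rightarrow> nat \<Rightarrow> bool" where
  "homogeneous p n \<longleftrightarrow> (\<forall>i j k. coeff (coeff (coeff p i) j) k \<noteq> 0 \<longrightarrow> i + j + k = n)"

definition eval_at :: "S \<Rightarrow> complex ^ 3 \<Rightarrow> complex" where
  "eval_at p v = poly (poly (poly p [:[:v $ 1:]:]) [:v $ 2:]) (v $ 3)"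

definition d_x :: "S \<Rightarrow> S" where "d_x = pderiv"
definition d_y :: "S \<Rightarrow> S" where "d_y = map_poly pderiv"
definition d_z :: "S \<Rightarrow> S" where "d_z = map_poly (map_poly pderiv)"

text \<open>An arrangement is given by the finite set of its linear forms, one for each line, and a
  line of the arrangement is identified with its linear form.\<close>

definition line_arrangement :: "S set \<Rightarrow> bool" where
  "line_arrangement A \<longleftrightarrow> finite A \<and> (\<forall>l\<in>A. l \<noteq> 0 \<and> homogeneous l 1) \<and>
     pairwise (\<lambda>l l'. \<not> (\<exists>c::complex. l = smult [:[:c:]:] l')) A"

definition defining_poly :: "S set \<Rightarrow> S" where
  "defining_poly A = (\<Prod>l\<in>A. l)"

text \<open>Points of the projective plane are the one-dimensional subspaces of \<open>\<complex>\<^sup>3\<close>.\<close>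

definition proj_plane :: "(complex ^ 3) set set" where
  "proj_plane = {P. vec.subspace P \<and> vec.dim P = 1}"

definition on_line :: "(complex ^ 3) set \<Rightarrow> S \<Rightarrow> bool" where
  "on_line P l \<longleftrightarrow> (\<forall>v\<in>P. eval_at l v = 0)"

definition pt_mult :: "S set \<Rightarrow> (complex ^ 3) set \<Rightarrow> nat" where
  "pt_mult A P = card {l \<in> A. on_line P l}"

definition max_pt_mult :: "S set \<Rightarrow> nat" where
  "max_pt_mult A = Max (pt_mult A ` proj_plane)"

definition points_of_mult :: "S set \<Rightarrow> nat \<Rightarrow> (complex ^ 3) set set" where
  "points_of_mult A k = {P \<in> proj_plane. pt_mult A P = k}"

definition n_pts :: "S set \<Rightarrow> nat \<Rightarrow> nat" where
  "n_pts A k = card (points_of_mult A k)"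

definition triple_points_on :: "S set \<Rightarrow> S \<Rightarrow> (complex ^ 3) set set" where
  "triple_points_on A l = {P \<in> points_of_mult A 3. on_line P l}"

text \<open>No point has multiplicity larger than the number \<open>card A\<close> of lines, hence the upper bound
  of the sum.\<close>

definition total_tjurina :: "S set \<Rightarrow> nat" where
  "total_tjurina A = (\<Sum>k = 2..card A. n_pts A k * (k - 1)\<^sup>2)"

definition AR :: "S \<Rightarrow> (S ^ 3) set" where
  "AR f = {\<rho>. \<rho> $ 1 * d_x f + \<rho> $ 2 * d_y f + \<rho> $ 3 * d_z f = 0}"

definition homogeneous_rel :: "S ^ 3 \<Rightarrow> nat \<Rightarrow> bool" where
  "homogeneous_rel \<rho> n \<longleftrightarrow> (\<forall>i. homogeneous (\<rho> $ i) n)"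

text \<open>The lemma licenses the span and dependence of \<^locale>\<open>module\<close> used below.\<close>

lemma module_S3: "module ((*s) :: S \<Rightarrow> S ^ 3 \<Rightarrow> S ^ 3)"
  by unfold_locales (simp_all add: vec_eq_iff algebra_simps)

definition S_span :: "(S ^ 3) set \<Rightarrow> (S ^ 3) set" where
  "S_span = module.span (*s)"

definition S_dependent :: "(S ^ 3) set \<Rightarrow> bool" where
  "S_dependent = module.dependent (*s)"

definition mdr :: "S \<Rightarrow> nat" where
  "mdr f = (LEAST k. \<exists>\<rho>\<in>AR f. \<rho> \<noteq> 0 \<and> homogeneous_rel \<rho> k)"

text \<open>The members of \<open>gs\<close> form a minimal homogeneous generating set of \<open>AR f\<close>; the list \<open>es\<close>
  gives their degrees in increasing order.  Minimality excludes zero generators, whose degree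
  would not be determined.\<close>

definition has_exponents :: "S set \<Rightarrow> nat list \<Rightarrow> bool" where
  "has_exponents A es \<longleftrightarrow> sorted es \<and>
     (\<exists>gs. distinct gs \<and> list_all2 homogeneous_rel gs es \<and>
        S_span (set gs) = AR (defining_poly A) \<and>
        (\<forall>H. H \<subset> set gs \<longrightarrow> S_span H \<noteq> AR (defining_poly A)))"

definition free_arrangement :: "S set \<Rightarrow> bool" where
  "free_arrangement A \<longleftrightarrow>
     (\<exists>B. \<not> S_dependent B \<and> S_span B = AR (defining_poly A))"

definition plus_one_generated :: "S set \<Rightarrow> bool" where
  "plus_one_generated A \<longleftrightarrow>
     (\<exists>e1 e2 e3. has_exponents A [e1, e2, e3] \<and> e1 + e2 = card A)"

definition nearly_free :: "S set \<Rightarrow> bool" where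
  "nearly_free A \<longleftrightarrow>
     (\<exists>e1 e2 e3. has_exponents A [e1, e2, e3] \<and> e1 + e2 = card A \<and> e3 = e2)"

definition has_type :: "S set \<Rightarrow> int \<Rightarrow> bool" where
  "has_type A t \<longleftrightarrow>
     (\<exists>es. has_exponents A es \<and> 2 \<le> length es \<and>
        t = int (es ! 0) + int (es ! 1) - int (card A) + 1)"

definition maximal_tjurina :: "S set \<Rightarrow> nat \<Rightarrow> nat \<Rightarrow> bool" where
  "maximal_tjurina A d r \<longleftrightarrow>
     card A = d \<and> mdr (defining_poly A) = r \<and> d \<le> 2 * r \<and>
     int (total_tjurina A) =
       (int d - 1)\<^sup>2 - int r * (int d - int r - 1) - int ((2 * r + 2 - d) choose 2)"

end

theory Submission
  imports Defs
begin

text \<open>The Jacobian relations of a product \<open>f\<close> of linear forms are, up to multiples of the Euler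
  derivation, the logarithmic derivations: the polynomial vector fields \<open>\<theta>\<close> on \<open>\<complex>\<^sup>3\<close> that are tangent to
  every line.  A generating set of the latter that is irredundant modulo the Euler derivation has the
  exponents as its degrees (\<open>has_exponents_from_logder\<close>), so the theorem asks for such sets.

  Every point \<open>P\<close> gives a logarithmic derivation \<open>pder W P\<close>: the constant field in direction
  \<open>P\<close>, multiplied by the lines that avoid \<open>P\<close>.  Its degree is \<open>4\<close> for a triple point and \<open>5\<close> for a
  double point of seven lines.  The engine is the addition of a line \<open>L\<close> (\<open>add_line\<close>).  The
  derivations tangent to \<open>L\<close> restrict to vector fields on \<open>L\<close> that are tangent to the points of
  intersection with the other lines; modulo the Euler field these are the multiples of one field, whose
  coefficient is the product of the equations of these points.  If a single derivation \<open>\<psi>\<close> restricts to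
  that field, then \<open>\<psi>\<close>, the Euler derivation and \<open>L\<close> times the derivations of the other lines generate.
  When at most one of the points on \<open>L\<close> is a triple point, \<open>pder\<close> of this point (or of any
  double point) is such a \<open>\<psi>\<close>.

  Thus arrangements in which the lines can be ordered so that each new line completes at most one triple point
  have generators \<open>pder W P\<close> for suitable points \<open>P\<close>, and whether an order works is a finite check
  on the incidences.  This settles one, two and three triple points, and four triple points when every line
  contains one; in the last case all generators have degree \<open>4\<close>.  The remaining cases contain a complete
  quadrilateral (six lines through four triple points), where a derivation of degree two with the squares
  of three linear forms as coefficients starts the induction, or they consist of three pairs of lines meeting
  in three collinear points, where an explicit derivation of degree three does.

  A generator \<open>g\<close> is irredundant because some submodule contains the Euler derivation and the other
  generators, but not \<open>g\<close>.  Mostly this is the module of fields that are radial along a chosen line.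

  The possible incidences come from the classification of systems of triples on seven elements with
  pairwise intersections of at most one element.  The Fano plane, with seven triples, is not
  realisable over \<open>\<complex>\<close> (\<open>not_fano\<close>).  Counting pairs of lines gives \<open>\<tau> = 21 + n\<^sub>3\<close>.\<close>

section \<open>Polynomials in three variables as functions on \<open>\<complex>\<^sup>3\<close>\<close>

text \<open>Over an infinite field a polynomial is determined by its values (\<open>S_eqI\<close>), so identities between
  polynomials, and later between vectors of polynomials, are checked pointwise.\<close>

definition cst :: "complex \<Rightarrow> S" where
  "cst c = [:[:[:c:]:]:]"

definition lin :: "complex ^ 3 \<Rightarrow> S" where
  "lin w = [:[:[:0, w $ 3:], [:w $ 2:]:], [:[:w $ 1:]:]:]"

definition dot :: "complex ^ 3 \<Rightarrow> complex ^ 3 \<Rightarrow> complex" where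
  "dot w v = w $ 1 * v $ 1 + w $ 2 * v $ 2 + w $ 3 * v $ 3"

lemma eval_cst [simp]: "eval_at (cst c) v = c"
  by (simp add: eval_at_def cst_def)

lemma eval_lin [simp]: "eval_at (lin w) v = dot w v"
  by (simp add: eval_at_def lin_def dot_def algebra_simps)

lemma eval_add [simp]: "eval_at (p + q) v = eval_at p v + eval_at q v"
  by (simp add: eval_at_def)

lemma eval_diff [simp]: "eval_at (p - q) v = eval_at p v - eval_at q v"
  by (simp add: eval_at_def)

lemma eval_minus [simp]: "eval_at (- p) v = - eval_at p v"
  by (simp add: eval_at_def)

lemma eval_mult [simp]: "eval_at (p * q) v = eval_at p v * eval_at q v"
  by (simp add: eval_at_def)

lemma eval_0 [simp]: "eval_at 0 v = 0"
  by (simp add: eval_at_def)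

lemma eval_1 [simp]: "eval_at 1 v = 1"
  by (simp add: eval_at_def)

lemma eval_power [simp]: "eval_at (p ^ n) v = eval_at p v ^ n"
  by (induction n) auto

lemma eval_sum [simp]: "eval_at (sum f A) v = (\<Sum>x\<in>A. eval_at (f x) v)"
  by (induction A rule: infinite_finite_induct) auto

lemma eval_prod [simp]: "eval_at (prod f A) v = (\<Prod>x\<in>A. eval_at (f x) v)"
  by (induction A rule: infinite_finite_induct) auto

lemma poly_const_roots_imp_0:
  fixes p :: "'a::{idom,ring_char_0} poly poly"
  assumes "\<And>c. poly p [:c:] = 0"
  shows "p = 0"
proof (rule ccontr)
  assume "p \<noteq> 0"
  then have "finite {x. poly p x = 0}"
    by (rule poly_roots_finite)
  moreover have "range (\<lambda>n::nat. [:of_nat n::'a:]) \<subseteq> {x. poly p x = 0}"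
    using assms by auto
  moreover have "infinite (range (\<lambda>n::nat. [:of_nat n::'a:]))"
    by (rule range_inj_infinite) (simp add: inj_on_def)
  ultimately show False
    using finite_subset by blast
qed

lemma eval_eq_0_imp:
  assumes "\<And>v. eval_at p v = 0"
  shows "p = 0"
proof -
  have e: "poly (poly (poly p [:[:a:]:]) [:b:]) c = 0" for a b c
    using assms[of "vector [a, b, c]"] by (simp add: eval_at_def)
  have 1: "poly (poly p [:[:a:]:]) [:b:] = 0" for a b
    using e by (simp add: poly_all_0_iff_0 [symmetric])
  have 2: "poly p [:[:a:]:] = 0" for a
    by (rule poly_const_roots_imp_0) (rule 1)
  have "poly p x = 0" if "x \<in> range (\<lambda>n::nat. [:[:of_nat n::complex:]:])" for x
    using 2 that by auto
  then have "range (\<lambda>n::nat. [:[:of_nat n::complex:]:]) \<subseteq> {x. poly p x = 0}"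
    by auto
  moreover have "infinite (range (\<lambda>n::nat. [:[:of_nat n::complex:]:]))"
    by (rule range_inj_infinite) (simp add: inj_on_def)
  ultimately show ?thesis
    using finite_subset poly_roots_finite by blast
qed

lemma S_eqI:
  assumes "\<And>v. eval_at p v = eval_at q v"
  shows "p = q"
  using eval_eq_0_imp[of "p - q"] assms by simp

lemma S_induct [case_names const var add mult]:
  fixes p :: S
  assumes c: "\<And>c. P (cst c)" and l: "\<And>w. P (lin w)"
    and a: "\<And>p q. P p \<Longrightarrow> P q \<Longrightarrow> P (p + q)"
    and m: "\<And>p q. P p \<Longrightarrow> P q \<Longrightarrow> P (p * q)"
  shows "P p"
proof -
  have 0: "P 0"
    using c[of 0] by (simp add: cst_def)
  have 1: "P [:[:q:]:]" for q
  proof (induction q)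
    case 0
    then show ?case using \<open>P 0\<close> by simp
  next
    case (pCons x q)
    have "[:[:pCons x q:]:] = cst x + lin (vector [0, 0, 1]) * [:[:q:]:]"
      by (simp add: cst_def lin_def)
    then show ?case using pCons a m c l by metis
  qed
  have 2: "P [:q:]" for q
  proof (induction q)
    case 0
    then show ?case using \<open>P 0\<close> by simp
  next
    case (pCons x q)
    have "[:pCons x q:] = [:[:x:]:] + lin (vector [0, 1, 0]) * [:q:]"
      by (simp add: lin_def flip: one_pCons)
    then show ?case using pCons a m 1 l by metis
  qed
  show ?thesis
  proof (induction p)
    case 0
    then show ?case using \<open>P 0\<close> by simp
  next
    case (pCons x q)
    have "pCons x q = [:x:] + lin (vector [1, 0, 0]) * q"
      by (simp add: lin_def flip: one_pCons)
    then show ?case using pCons a m 2 l by metis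
  qed
qed

lemma lin_eq_0_iff [simp]: "lin w = 0 \<longleftrightarrow> w = 0"
  by (auto simp: lin_def vec_eq_iff forall_3)

lemma lin_inj: "lin w = lin w' \<longleftrightarrow> w = w'"
  by (auto simp: lin_def vec_eq_iff forall_3)

lemma cst_eq_0_iff [simp]: "cst c = 0 \<longleftrightarrow> c = 0"
  by (simp add: cst_def)

lemma lin_scale: "lin (c *s w) = cst c * lin w"
  by (rule S_eqI) (simp add: dot_def algebra_simps)

lemma cst_1: "cst 1 = 1"
  by (simp add: cst_def one_pCons)

subsection \<open>Homogeneity\<close>

definition coeff3 :: "S \<Rightarrow> nat \<Rightarrow> nat \<Rightarrow> nat \<Rightarrow> complex" where
  "coeff3 p i j k = coeff (coeff (coeff p i) j) k"

lemma coeff3_eqI: "(\<And>i j k. coeff3 p i j k = coeff3 q i j k) \<Longrightarrow> p = q"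
  by (simp add: coeff3_def poly_eq_iff)

lemma coeff3_add: "coeff3 (p + q) i j k = coeff3 p i j k + coeff3 q i j k"
  by (simp add: coeff3_def)

lemma coeff3_mult:
  "coeff3 (p * q) i j k =
     (\<Sum>i'\<le>i. \<Sum>j'\<le>j. \<Sum>k'\<le>k. coeff3 p i' j' k' * coeff3 q (i - i') (j - j') (k - k'))"
  by (simp add: coeff3_def coeff_mult coeff_sum)

lemma coeff3_cst: "coeff3 (cst c) i j k = (if i = 0 \<and> j = 0 \<and> k = 0 then c else 0)"
  by (auto simp: coeff3_def cst_def coeff_pCons split: nat.splits)

lemma coeff3_lin: "coeff3 (lin w) i j k = (if i + j + k = 1 then
    (if i = 1 then w $ 1 else if j = 1 then w $ 2 else w $ 3) else 0)"
  by (auto simp: coeff3_def lin_def coeff_pCons split: nat.splits)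

text \<open>Scaling the variables by \<open>t\<close> multiplies the part of degree \<open>n\<close> by \<open>t\<^sup>n\<close>.  For \<open>t = 2\<close> these factors are
  distinct, so this single dilation already detects homogeneity (\<open>homogeneous_iff\<close>).\<close>

lemma dilation:
  "\<exists>q. (\<forall>v. eval_at q v = eval_at p (t *s v)) \<and>
       (\<forall>i j k. coeff3 q i j k = t ^ (i + j + k) * coeff3 p i j k)"
proof (induction p rule: S_induct)
  case (const c)
  show ?case by (rule exI[of _ "cst c"]) (auto simp: coeff3_cst)
next
  case (var w)
  show ?case
    by (rule exI[of _ "lin (t *s w)"]) (auto simp: coeff3_lin dot_def algebra_simps)
next
  case (add p q)
  then obtain p' q' where "\<forall>v. eval_at p' v = eval_at p (t *s v)"
    "\<forall>i j k. coeff3 p' i j k = t ^ (i + j + k) * coeff3 p i j k"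
    "\<forall>v. eval_at q' v = eval_at q (t *s v)"
    "\<forall>i j k. coeff3 q' i j k = t ^ (i + j + k) * coeff3 q i j k" by blast
  then show ?case
    by (intro exI[of _ "p' + q'"]) (simp add: coeff3_add algebra_simps)
next
  case (mult p q)
  then obtain p' q' where h: "\<forall>v. eval_at p' v = eval_at p (t *s v)"
    "\<forall>i j k. coeff3 p' i j k = t ^ (i + j + k) * coeff3 p i j k"
    "\<forall>v. eval_at q' v = eval_at q (t *s v)"
    "\<forall>i j k. coeff3 q' i j k = t ^ (i + j + k) * coeff3 q i j k" by blast
  have "coeff3 (p' * q') i j k = t ^ (i + j + k) * coeff3 (p * q) i j k" for i j k
  proof -
    have "t ^ (i' + j' + k') * coeff3 p i' j' k' *
           (t ^ ((i - i') + (j - j') + (k - k')) * coeff3 q (i - i') (j - j') (k - k')) =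
          t ^ (i + j + k) * (coeff3 p i' j' k' * coeff3 q (i - i') (j - j') (k - k'))"
      if "i' \<le> i" "j' \<le> j" "k' \<le> k" for i' j' k'
    proof -
      have "(i' + j' + k') + ((i - i') + (j - j') + (k - k')) = i + j + k"
        using that by simp
      then have "t ^ (i + j + k) = t ^ (i' + j' + k') * t ^ ((i - i') + (j - j') + (k - k'))"
        by (metis power_add)
      then show ?thesis by (simp add: ac_simps)
    qed
    then show ?thesis
      unfolding coeff3_mult h(2)[rule_format] h(4)[rule_format] sum_distrib_left
      by (intro sum.cong refl) (simp only: atMost_iff)
  qed
  then show ?case
    using h(1,3) by (intro exI[of _ "p' * q'"]) simp
qed

lemma homogeneous_iff:
  "homogeneous p n \<longleftrightarrow> (\<forall>v. eval_at p (2 *s v) = 2 ^ n * eval_at p v)"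
proof -
  obtain q where q: "\<forall>v. eval_at q v = eval_at p (2 *s v)"
    "\<forall>i j k. coeff3 q i j k = 2 ^ (i + j + k) * coeff3 p i j k"
    using dilation by blast
  have c: "coeff3 (cst (2 ^ n) * p) i j k = 2 ^ n * coeff3 p i j k" for i j k
    by (simp add: coeff3_def cst_def)
  have "(\<forall>v. eval_at p (2 *s v) = 2 ^ n * eval_at p v) \<longleftrightarrow> q = cst (2 ^ n) * p"
    using q(1) S_eqI[of q "cst (2 ^ n) * p"] by auto
  also have "\<dots> \<longleftrightarrow> (\<forall>i j k. 2 ^ (i + j + k) * coeff3 p i j k = 2 ^ n * coeff3 p i j k)"
    using c q(2) coeff3_eqI[of q "cst (2 ^ n) * p"] by metis
  also have "\<dots> \<longleftrightarrow> (\<forall>i j k. coeff3 p i j k \<noteq> 0 \<longrightarrow> (2::complex) ^ (i + j + k) = 2 ^ n)"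
    by auto
  also have "\<dots> \<longleftrightarrow> homogeneous p n"
  proof -
    have "(2::complex) ^ a = 2 ^ n \<longleftrightarrow> a = n" for a
    proof
      assume "(2::complex) ^ a = 2 ^ n"
      then have "norm ((2::complex) ^ a) = norm ((2::complex) ^ n)" by simp
      then have "(2::real) ^ a = 2 ^ n" by (simp add: norm_power)
      then show "a = n" by simp
    qed auto
    then show ?thesis by (simp add: homogeneous_def coeff3_def)
  qed
  finally show ?thesis by simp
qed

lemma homogeneous_scale:
  assumes "homogeneous p n"
  shows "eval_at p (t *s v) = t ^ n * eval_at p v"
proof -
  obtain q where q: "\<forall>v. eval_at q v = eval_at p (t *s v)"
    "\<forall>i j k. coeff3 q i j k = t ^ (i + j + k) * coeff3 p i j k"
    using dilation by blast
  have "coeff3 q i j k = coeff3 (cst (t ^ n) * p) i j k" for i j k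
  proof -
    have "coeff3 (cst (t ^ n) * p) i j k = t ^ n * coeff3 p i j k"
      by (simp add: coeff3_def cst_def)
    then show ?thesis
      using assms q(2) by (cases "coeff3 p i j k = 0") (auto simp: homogeneous_def coeff3_def)
  qed
  then have "q = cst (t ^ n) * p" by (rule coeff3_eqI)
  then show ?thesis using q(1) by (metis eval_mult eval_cst)
qed

lemma homogeneous_quotient:
  assumes "homogeneous (a * b) (n + m)" "homogeneous b m" "b \<noteq> 0"
  shows "homogeneous a n"
proof -
  obtain q where q: "\<forall>v. eval_at q v = eval_at a (2 *s v)"
    using dilation by blast
  have "(q - cst (2 ^ n) * a) * b = 0"
  proof (rule S_eqI)
    fix v
    have "eval_at a (2 *s v) * (2 ^ m * eval_at b v) = 2 ^ (n + m) * (eval_at a v * eval_at b v)"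
      using assms(1,2) by (simp add: homogeneous_iff)
    then have "2 ^ m * (eval_at a (2 *s v) * eval_at b v)
       = 2 ^ m * (2 ^ n * eval_at a v * eval_at b v)"
      by (simp add: power_add ac_simps)
    then have "eval_at a (2 *s v) * eval_at b v = 2 ^ n * eval_at a v * eval_at b v"
      by simp
    then show "eval_at ((q - cst (2 ^ n) * a) * b) v = eval_at 0 v"
      using q by (simp add: algebra_simps)
  qed
  then have "q = cst (2 ^ n) * a" using assms(3) by auto
  then show ?thesis using q by (auto simp: homogeneous_iff)
qed

lemma homogeneous_lin: "homogeneous (lin w) 1"
  by (simp add: homogeneous_iff dot_def algebra_simps)

lemma homogeneous_prod_lin: "homogeneous (\<Prod>w\<in>W. lin w) (card W)"
proof (induction W rule: infinite_finite_induct)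
  case (insert w W)
  then show ?case
    by (auto simp: homogeneous_iff dot_def algebra_simps)
qed (auto simp: homogeneous_iff)

lemma homogeneous_1_imp_lin:
  assumes "homogeneous l 1"
  obtains w where "l = lin w"
proof
  have "coeff3 l i j k = coeff3 (lin (vector [coeff3 l 1 0 0, coeff3 l 0 1 0, coeff3 l 0 0 1])) i j k" for i j k
  proof (cases "i + j + k = 1")
    case True
    then consider "i = 1" "j = 0" "k = 0" | "i = 0" "j = 1" "k = 0" | "i = 0" "j = 0" "k = 1"
      by linarith
    then show ?thesis by cases (simp_all add: coeff3_lin)
  next
    case False
    then have "coeff3 l i j k = 0" using assms by (auto simp: homogeneous_def coeff3_def)
    then show ?thesis using False by (simp add: coeff3_lin)
  qed
  then show "l = lin (vector [coeff3 l 1 0 0, coeff3 l 0 1 0, coeff3 l 0 0 1])"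
    by (rule coeff3_eqI)
qed

lemma eval_along_ray: "\<exists>q::complex poly. \<forall>t. eval_at p (t *s v) = poly q t"
proof (induction p rule: S_induct)
  case (const c)
  show ?case by (rule exI[of _ "[:c:]"]) simp
next
  case (var w)
  show ?case by (rule exI[of _ "[:0, dot w v:]"]) (simp add: dot_def algebra_simps)
next
  case (add p q)
  then show ?case by (metis eval_add poly_add)
next
  case (mult p q)
  then show ?case by (metis eval_mult poly_mult)
qed

section \<open>Vectors, lines and divisibility by linear forms\<close>

definition vcross :: "complex ^ 3 \<Rightarrow> complex ^ 3 \<Rightarrow> complex ^ 3" where
  "vcross a b = vector [a $ 2 * b $ 3 - a $ 3 * b $ 2,
                        a $ 3 * b $ 1 - a $ 1 * b $ 3,
                        a $ 1 * b $ 2 - a $ 2 * b $ 1]"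

definition det3 :: "complex ^ 3 \<Rightarrow> complex ^ 3 \<Rightarrow> complex ^ 3 \<Rightarrow> complex" where
  "det3 a b c = dot a (vcross b c)"

lemma vcross_nth [simp]:
  "vcross a b $ 1 = a $ 2 * b $ 3 - a $ 3 * b $ 2"
  "vcross a b $ 2 = a $ 3 * b $ 1 - a $ 1 * b $ 3"
  "vcross a b $ 3 = a $ 1 * b $ 2 - a $ 2 * b $ 1"
  by (simp_all add: vcross_def)

lemma vec3_eq_iff: "(a::'a ^ 3) = b \<longleftrightarrow> a $ 1 = b $ 1 \<and> a $ 2 = b $ 2 \<and> a $ 3 = b $ 3"
  by (simp add: vec_eq_iff forall_3)

lemma dot_linear [simp]:
  "dot (a + b) v = dot a v + dot b v" "dot (a - b) v = dot a v - dot b v"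
  "dot (c *s a) v = c * dot a v" "dot 0 v = 0" "dot (- a) v = - dot a v"
  "dot w (a + b) = dot w a + dot w b" "dot w (a - b) = dot w a - dot w b"
  "dot w (c *s a) = c * dot w a" "dot w 0 = 0" "dot w (- a) = - dot w a"
  by (simp_all add: dot_def algebra_simps)

lemma dot_commute: "dot a b = dot b a"
  by (simp add: dot_def)

lemma det3_perm: "det3 a b c = det3 b c a" "det3 a b c = - det3 b a c"
  by (simp_all add: det3_def dot_def algebra_simps)

lemma det3_same [simp]: "det3 a a b = 0" "det3 a b b = 0" "det3 a b a = 0"
  by (simp_all add: det3_def dot_def algebra_simps)

lemma dot_vcross_same [simp]: "dot a (vcross a b) = 0" "dot b (vcross a b) = 0"
  by (simp_all add: dot_def algebra_simps)

lemma vcross_self [simp]: "vcross a a = 0" "vcross 0 a = 0" "vcross a 0 = 0"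
  by (simp_all add: vec3_eq_iff)

lemma vcross_commute: "vcross a b = - vcross b a"
  by (simp add: vec3_eq_iff)

lemma vcross_scale [simp]: "vcross (c *s a) b = c *s vcross a b" "vcross a (c *s b) = c *s vcross a b"
  by (simp_all add: vec3_eq_iff algebra_simps)

lemma vcross_eq_0_iff:
  assumes "b \<noteq> 0"
  shows "vcross a b = 0 \<longleftrightarrow> (\<exists>c. a = c *s b)"
proof
  assume h: "vcross a b = 0"
  then have e: "a $ 2 * b $ 3 = a $ 3 * b $ 2" "a $ 3 * b $ 1 = a $ 1 * b $ 3"
    "a $ 1 * b $ 2 = a $ 2 * b $ 1"
    by (simp_all add: vec3_eq_iff)
  consider "b $ 1 \<noteq> 0" | "b $ 2 \<noteq> 0" | "b $ 3 \<noteq> 0"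
    using assms by (auto simp: vec3_eq_iff)
  then show "\<exists>c. a = c *s b"
  proof cases
    case 1
    then show ?thesis
      by (intro exI[of _ "a $ 1 / b $ 1"]) (use e in \<open>simp add: vec3_eq_iff field_simps\<close>)
  next
    case 2
    then show ?thesis
      by (intro exI[of _ "a $ 2 / b $ 2"]) (use e in \<open>simp add: vec3_eq_iff field_simps\<close>)
  next
    case 3
    then show ?thesis
      by (intro exI[of _ "a $ 3 / b $ 3"]) (use e in \<open>simp add: vec3_eq_iff field_simps\<close>)
  qed
qed auto

lemma on_two_lines:
  assumes "vcross w u \<noteq> 0" "dot w v = 0" "dot u v = 0"
  obtains c where "v = c *s vcross w u"
proof -
  have "vcross v (vcross w u) = dot v u *s w - dot v w *s u"
    by (simp add: vec3_eq_iff dot_def algebra_simps)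
  then have "vcross v (vcross w u) = 0"
    using assms by (simp add: dot_commute)
  then show ?thesis
    using vcross_eq_0_iff[OF assms(1)] that by blast
qed

lemma exists_dot_1:
  assumes "w \<noteq> 0"
  shows "\<exists>n. dot w n = 1"
proof -
  consider "w $ 1 \<noteq> 0" | "w $ 2 \<noteq> 0" | "w $ 3 \<noteq> 0"
    using assms by (auto simp: vec3_eq_iff)
  then show ?thesis
  proof cases
    case 1 then show ?thesis by (intro exI[of _ "vector [1 / w $ 1, 0, 0]"]) (simp add: dot_def)
  next
    case 2 then show ?thesis by (intro exI[of _ "vector [0, 1 / w $ 2, 0]"]) (simp add: dot_def)
  next
    case 3 then show ?thesis by (intro exI[of _ "vector [0, 0, 1 / w $ 3]"]) (simp add: dot_def)
  qed
qed

lemma exists_dual_pair: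
  assumes "vcross w u \<noteq> 0"
  shows "\<exists>n n'. dot w n = 1 \<and> dot u n = 0 \<and> dot w n' = 0 \<and> dot u n' = 1"
proof -
  obtain m where m: "dot (vcross w u) m = 1"
    using exists_dot_1[OF assms] by blast
  have "dot w (vcross u m) = dot (vcross w u) m" "dot u (vcross m w) = dot (vcross w u) m"
    by (simp_all add: dot_def algebra_simps)
  then show ?thesis
    using m by (intro exI[of _ "vcross u m"] exI[of _ "vcross m w"]) simp
qed

text \<open>Replacing the argument of a polynomial by its projection along \<open>n\<close> and \<open>n'\<close> changes the
  polynomial only by an element of the ideal of the two linear forms.  This is how vanishing on a
  line or on a point of the plane becomes an ideal membership, without any quotient ring.\<close>

lemma projection_ideal:
  "\<exists>q a b. (\<forall>v. eval_at q v = eval_at p (v - dot w v *s n - dot u v *s n')) \<and>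
           p = q + lin w * a + lin u * b"
proof (induction p rule: S_induct)
  case (const c)
  show ?case by (intro exI[of _ "cst c"] exI[of _ 0]) simp
next
  case (var x)
  show ?case
    by (intro exI[of _ "lin (x - dot x n *s w - dot x n' *s u)"]
        exI[of _ "cst (dot x n)"] exI[of _ "cst (dot x n')"] conjI allI S_eqI)
       simp_all
next
  case (add p p')
  then obtain q a b q' a' b' where
    h: "\<forall>v. eval_at q v = eval_at p (v - dot w v *s n - dot u v *s n')"
       "p = q + lin w * a + lin u * b"
       "\<forall>v. eval_at q' v = eval_at p' (v - dot w v *s n - dot u v *s n')"
       "p' = q' + lin w * a' + lin u * b'" by blast
  show ?case
    by (intro exI[of _ "q + q'"] exI[of _ "a + a'"] exI[of _ "b + b'"] conjI)
       (use h(1,3) in simp, simp add: h(2,4) algebra_simps)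
next
  case (mult p p')
  then obtain q a b q' a' b' where
    h: "\<forall>v. eval_at q v = eval_at p (v - dot w v *s n - dot u v *s n')"
       "p = q + lin w * a + lin u * b"
       "\<forall>v. eval_at q' v = eval_at p' (v - dot w v *s n - dot u v *s n')"
       "p' = q' + lin w * a' + lin u * b'" by blast
  show ?case
    by (intro exI[of _ "q * q'"] exI[of _ "a * p' + q * a'"] exI[of _ "b * p' + q * b'"] conjI)
       (use h(1,3) in simp, simp add: h(2,4) algebra_simps)
qed

lemma vanish_on_point_imp:
  assumes "vcross w u \<noteq> 0"
    and "\<And>v. dot w v = 0 \<Longrightarrow> dot u v = 0 \<Longrightarrow> eval_at p v = 0"
  shows "\<exists>a b. p = lin w * a + lin u * b"
proof -
  obtain n n' where n: "dot w n = 1" "dot u n = 0" "dot w n' = 0" "dot u n' = 1"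
    using exists_dual_pair[OF assms(1)] by blast
  obtain q a b where q: "\<forall>v. eval_at q v = eval_at p (v - dot w v *s n - dot u v *s n')"
    "p = q + lin w * a + lin u * b"
    using projection_ideal by blast
  have "q = 0"
    by (rule S_eqI) (use n in \<open>simp add: q(1) assms(2)\<close>)
  then show ?thesis using q(2) by auto
qed

lemma line_projection:
  assumes "dot w n = 1"
  obtains q a where "\<And>v. eval_at q v = eval_at p (v - dot w v *s n)" "p = q + lin w * a"
proof -
  obtain q a b where "\<forall>v. eval_at q v = eval_at p (v - dot w v *s n - dot 0 v *s 0)"
    "p = q + lin w * a + lin 0 * b"
    using projection_ideal by blast
  then show ?thesis
    using that[of q a] by (metis add_0_right diff_zero lin_eq_0_iff mult_zero_left vector_smult_rzero)
qed

lemma lin_dvd_iff: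
  assumes "w \<noteq> 0"
  shows "lin w dvd p \<longleftrightarrow> (\<forall>v. dot w v = 0 \<longrightarrow> eval_at p v = 0)"
proof
  assume h: "\<forall>v. dot w v = 0 \<longrightarrow> eval_at p v = 0"
  obtain n where n: "dot w n = 1" using exists_dot_1[OF assms] by blast
  obtain q a where q: "\<And>v. eval_at q v = eval_at p (v - dot w v *s n)" "p = q + lin w * a"
    using line_projection[OF n] by blast
  have "q = 0" by (rule S_eqI) (use h n in \<open>simp add: q(1)\<close>)
  then show "lin w dvd p" using q(2) by simp
qed auto

lemma lin_prime:
  assumes "w \<noteq> 0" "lin w dvd p * p'"
  shows "lin w dvd p \<or> lin w dvd p'"
proof -
  obtain n where n: "dot w n = 1" using exists_dot_1[OF assms(1)] by blast
  obtain q a where q: "\<And>v. eval_at q v = eval_at p (v - dot w v *s n)" "p = q + lin w * a"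
    using line_projection[OF n] by blast
  obtain q' a' where q': "\<And>v. eval_at q' v = eval_at p' (v - dot w v *s n)" "p' = q' + lin w * a'"
    using line_projection[OF n] by blast
  have "\<forall>v. dot w v = 0 \<longrightarrow> eval_at p v * eval_at p' v = 0"
    using assms(2) unfolding lin_dvd_iff[OF assms(1)] eval_mult .
  then have "q * q' = 0"
    by (intro S_eqI) (use n in \<open>simp add: q(1) q'(1)\<close>)
  then show ?thesis using q(2) q'(2) by auto
qed

lemma lin_dvd_prod:
  assumes "w \<noteq> 0" "finite F" "lin w dvd (\<Prod>x\<in>F. f x)"
  shows "\<exists>x\<in>F. lin w dvd f x"
  using assms(2,3)
proof (induction F)
  case empty
  obtain n where "dot w n = 1" using exists_dot_1[OF assms(1)] by blast
  have "eval_at 1 0 = (0::complex)"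
    using empty lin_dvd_iff[OF assms(1), of 1] dot_linear(9)[of w] by (metis prod.empty)
  then show ?case by simp
next
  case (insert x F)
  then show ?case using lin_prime[OF assms(1)] by auto
qed

lemma not_lin_dvd_lin:
  assumes "vcross w u \<noteq> 0"
  shows "\<not> lin w dvd lin u"
proof
  assume "lin w dvd lin u"
  moreover have "w \<noteq> 0" using assms by auto
  ultimately have "\<forall>v. dot w v = 0 \<longrightarrow> dot u v = 0" by (simp add: lin_dvd_iff)
  then show False using exists_dual_pair[OF assms] by auto
qed

lemma generic_point_on_line:
  assumes "w \<noteq> 0" "finite F" "\<And>p. p \<in> F \<Longrightarrow> \<not> lin w dvd p"
  shows "\<exists>v. dot w v = 0 \<and> (\<forall>p\<in>F. eval_at p v \<noteq> 0)"
proof -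
  have "\<not> lin w dvd (\<Prod>p\<in>F. p)"
    using lin_dvd_prod[OF assms(1,2), of "\<lambda>p. p"] assms(3) by blast
  then obtain v where "dot w v = 0" "(\<Prod>p\<in>F. eval_at p v) \<noteq> 0"
    using lin_dvd_iff[OF assms(1)] by auto
  then show ?thesis using assms(2) by auto
qed

text \<open>A projective point is a line through the origin; what is shown on it by cancelling a factor
  that vanishes at the origin extends to the origin by this lemma.\<close>

lemma vanish_off_0_imp:
  assumes "\<And>t. t \<noteq> 0 \<Longrightarrow> eval_at p (t *s v) = 0"
  shows "eval_at p 0 = 0"
proof -
  obtain q where q: "\<forall>t. eval_at p (t *s v) = poly q t"
    using eval_along_ray by blast
  have "q = 0"
  proof (rule ccontr)
    assume "q \<noteq> 0"
    then have "finite {t. poly q t = 0}" by (rule poly_roots_finite)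
    moreover have "UNIV - {0} \<subseteq> {t. poly q t = 0}" using assms q by auto
    ultimately have "finite (UNIV - {0::complex})" by (rule finite_subset[rotated])
    then show False by (simp add: infinite_UNIV_char_0)
  qed
  then show ?thesis using q[rule_format, of 0] by simp
qed

text \<open>The points \<open>L \<inter> {m = 0}\<close> are split off one at a time: the equations of the other points do not vanish
  at the new one, so the cofactor does.\<close>

lemma vanish_on_points_imp:
  assumes "finite M" "\<And>m. m \<in> M \<Longrightarrow> vcross w m \<noteq> 0"
    and "\<And>m m'. m \<in> M \<Longrightarrow> m' \<in> M \<Longrightarrow> m \<noteq> m' \<Longrightarrow> det3 w m m' \<noteq> 0"
    and "\<And>m v. m \<in> M \<Longrightarrow> dot w v = 0 \<Longrightarrow> dot m v = 0 \<Longrightarrow> eval_at p v = 0"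
  shows "\<exists>c a. p = c * (\<Prod>m\<in>M. lin m) + lin w * a"
  using assms
proof (induction M)
  case empty
  show ?case by (intro exI[of _ p] exI[of _ 0]) simp
next
  case (insert m M)
  then obtain c a where ca: "p = c * (\<Prod>m\<in>M. lin m) + lin w * a" by blast
  let ?v = "vcross w m"
  have wm: "?v \<noteq> 0" using insert.prems by simp
  have nz: "eval_at c (t *s ?v) = 0" if "t \<noteq> 0" for t
  proof -
    have "eval_at p (t *s ?v) = 0" using insert.prems(3)[of m] by simp
    then have "eval_at c (t *s ?v) * (\<Prod>m'\<in>M. t * dot m' ?v) = 0"
      by (simp add: ca)
    moreover have "dot m' ?v \<noteq> 0" if "m' \<in> M" for m'
    proof -
      have "det3 w m m' \<noteq> 0" using insert.prems(2)[of m m'] insert.hyps that by auto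
      then show ?thesis by (simp add: det3_def dot_def algebra_simps)
    qed
    ultimately show ?thesis using that insert.hyps by auto
  qed
  have "eval_at c v = 0" if "dot w v = 0" "dot m v = 0" for v
  proof -
    obtain t where "v = t *s ?v" using on_two_lines[OF wm \<open>dot w v = 0\<close> \<open>dot m v = 0\<close>] by blast
    then show ?thesis using nz[of t] vanish_off_0_imp[OF nz] by (cases "t = 0") simp_all
  qed
  from vanish_on_point_imp[OF wm this]
  obtain b d where "c = lin w * b + lin m * d" by blast
  then have "p = d * (\<Prod>m\<in>insert m M. lin m) + lin w * (b * (\<Prod>m\<in>M. lin m) + a)"
    using insert.hyps by (simp add: ca algebra_simps)
  then show ?case by blast
qed

section \<open>Derivations and Jacobian relations\<close>

interpretation S3: module "(*s) :: S \<Rightarrow> S ^ 3 \<Rightarrow> S ^ 3"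
  by (rule module_S3)

definition ev :: "S ^ 3 \<Rightarrow> complex ^ 3 \<Rightarrow> complex ^ 3" where
  "ev \<theta> v = (\<chi> i. eval_at (\<theta> $ i) v)"

lemma ev_nth [simp]: "ev \<theta> v $ i = eval_at (\<theta> $ i) v"
  by (simp add: ev_def)

lemma ev_linear [simp]:
  "ev (\<theta> + \<phi>) v = ev \<theta> v + ev \<phi> v" "ev (\<theta> - \<phi>) v = ev \<theta> v - ev \<phi> v"
  "ev (p *s \<theta>) v = eval_at p v *s ev \<theta> v" "ev 0 v = 0" "ev (- \<theta>) v = - ev \<theta> v"
  by (simp_all add: vec_eq_iff)

lemma S3_eqI: "(\<And>v. ev \<theta> v = ev \<phi> v) \<Longrightarrow> \<theta> = \<phi>"
  by (simp add: vec_eq_iff S_eqI)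

definition euler :: "S ^ 3" where
  "euler = (\<chi> i. lin (axis i 1))"

lemma ev_euler [simp]: "ev euler v = v"
proof -
  have "dot (axis i 1) v = v $ i" for i
    using exhaust_3[of i] by (auto simp: dot_def axis_def)
  then show ?thesis by (simp add: euler_def vec_eq_iff)
qed

definition app :: "S ^ 3 \<Rightarrow> complex ^ 3 \<Rightarrow> S" where
  "app \<theta> w = \<theta> $ 1 * cst (w $ 1) + \<theta> $ 2 * cst (w $ 2) + \<theta> $ 3 * cst (w $ 3)"

lemma eval_app [simp]: "eval_at (app \<theta> w) v = dot w (ev \<theta> v)"
  by (simp add: app_def dot_def algebra_simps)

text \<open>The logarithmic derivations, described through the vectors they attach to the points of
  the lines; in this form it is obvious that only the lines matter, not their equations.\<close>

definition logder :: "(complex ^ 3) set \<Rightarrow> (S ^ 3) set" where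
  "logder W = {\<theta>. \<forall>w\<in>W. \<forall>v. dot w v = 0 \<longrightarrow> dot w (ev \<theta> v) = 0}"

lemma logder_subspace: "S3.subspace (logder W)"
  by (auto simp: S3.subspace_def logder_def)

lemma euler_logder [simp]: "euler \<in> logder W"
  by (simp add: logder_def)

definition arrangement :: "(complex ^ 3) set \<Rightarrow> bool" where
  "arrangement W \<longleftrightarrow> finite W \<and> 0 \<notin> W \<and> pairwise (\<lambda>u w. vcross u w \<noteq> 0) W"

definition form :: "(complex ^ 3) set \<Rightarrow> S" where
  "form W = (\<Prod>w\<in>W. lin w)"

definition grad_app :: "S ^ 3 \<Rightarrow> S \<Rightarrow> S" where
  "grad_app \<theta> f = \<theta> $ 1 * d_x f + \<theta> $ 2 * d_y f + \<theta> $ 3 * d_z f"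

lemma AR_iff: "\<theta> \<in> AR f \<longleftrightarrow> grad_app \<theta> f = 0"
  by (simp add: AR_def grad_app_def)

lemma map_poly_derivation:
  fixes f :: "'a::comm_ring_1 \<Rightarrow> 'a"
  assumes a: "\<And>x y. f (x + y) = f x + f y" and m: "\<And>x y. f (x * y) = f x * y + x * f y"
  shows "map_poly f (p + q) = map_poly f p + map_poly f q"
    "map_poly f (p * q) = map_poly f p * q + p * map_poly f q"
proof -
  have 0: "f 0 = 0" using a[of 0 0] by simp
  have s: "f (sum g A) = (\<Sum>x\<in>A. f (g x))" for g :: "nat \<Rightarrow> 'a" and A
    by (induction A rule: infinite_finite_induct) (auto simp: 0 a)
  show "map_poly f (p + q) = map_poly f p + map_poly f q"
    by (rule poly_eqI) (simp add: coeff_map_poly 0 a)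
  show "map_poly f (p * q) = map_poly f p * q + p * map_poly f q"
    by (rule poly_eqI) (simp add: coeff_map_poly 0 coeff_mult s m sum.distrib)
qed

lemma d_add: "d_x (p + q) = d_x p + d_x q" "d_y (p + q) = d_y p + d_y q" "d_z (p + q) = d_z p + d_z q"
proof -
  show "d_x (p + q) = d_x p + d_x q"
    by (simp add: d_x_def pderiv_add)
  show "d_y (p + q) = d_y p + d_y q"
    unfolding d_y_def by (rule map_poly_derivation) (simp_all only: pderiv_add pderiv_mult ac_simps)
  show "d_z (p + q) = d_z p + d_z q"
    unfolding d_z_def
    by (rule map_poly_derivation; rule map_poly_derivation)
       (simp_all only: pderiv_add pderiv_mult ac_simps)
qed

lemma d_mult: "d_x (p * q) = d_x p * q + p * d_x q" "d_y (p * q) = d_y p * q + p * d_y q"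
  "d_z (p * q) = d_z p * q + p * d_z q"
proof -
  show "d_x (p * q) = d_x p * q + p * d_x q"
    by (simp add: d_x_def pderiv_mult)
  show "d_y (p * q) = d_y p * q + p * d_y q"
    unfolding d_y_def by (rule map_poly_derivation) (simp_all only: pderiv_add pderiv_mult ac_simps)
  show "d_z (p * q) = d_z p * q + p * d_z q"
    unfolding d_z_def
    by (rule map_poly_derivation; rule map_poly_derivation) (simp_all only: pderiv_add pderiv_mult ac_simps)
qed

lemma grad_app_mult: "grad_app \<theta> (p * q) = grad_app \<theta> p * q + p * grad_app \<theta> q"
  by (simp add: grad_app_def d_mult algebra_simps)

lemma grad_app_lin: "grad_app \<theta> (lin w) = app \<theta> w"
  by (simp add: grad_app_def app_def d_x_def d_y_def d_z_def lin_def cst_def pderiv_pCons map_poly_pCons)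

lemma grad_app_cst: "grad_app \<theta> (cst c) = 0"
  by (simp add: grad_app_def d_x_def d_y_def d_z_def cst_def pderiv_pCons map_poly_pCons)

lemma grad_app_linear:
  "grad_app (\<theta> + \<phi>) f = grad_app \<theta> f + grad_app \<phi> f"
  "grad_app (\<theta> - \<phi>) f = grad_app \<theta> f - grad_app \<phi> f"
  "grad_app (p *s \<theta>) f = p * grad_app \<theta> f"
  "grad_app 0 f = 0"
  by (simp_all add: grad_app_def algebra_simps)

lemma AR_subspace: "S3.subspace (AR f)"
  by (simp add: S3.subspace_def AR_iff grad_app_linear)

lemma AR_cst_mult: "c \<noteq> 0 \<Longrightarrow> AR (cst c * f) = AR f"
  by (auto simp: AR_iff grad_app_mult grad_app_cst)

lemma form_nonzero: "arrangement W \<Longrightarrow> form W \<noteq> 0"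
  by (auto simp: arrangement_def form_def)

text \<open>If \<open>form W = lin w * g\<close>, then the Leibniz rule makes \<open>lin w\<close> divide \<open>\<theta>(w) * g\<close>; it is prime to \<open>g\<close>.\<close>

lemma AR_subset_logder:
  assumes "arrangement W"
  shows "AR (form W) \<subseteq> logder W"
proof
  fix \<theta> assume \<theta>: "\<theta> \<in> AR (form W)"
  have "lin w dvd app \<theta> w" if w: "w \<in> W" for w
  proof -
    have w0: "w \<noteq> 0" and fin: "finite W" using assms w by (auto simp: arrangement_def)
    let ?g = "\<Prod>u\<in>W - {w}. lin u"
    have "form W = lin w * ?g"
      using fin w by (simp add: form_def prod.remove)
    then have "app \<theta> w * ?g = lin w * (- grad_app \<theta> ?g)"
      using \<theta> by (simp add: AR_iff grad_app_mult grad_app_lin add_eq_0_iff2)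
    then have "lin w dvd app \<theta> w * ?g" by simp
    moreover have "\<not> lin w dvd ?g"
    proof
      assume "lin w dvd ?g"
      then obtain u where "u \<in> W - {w}" "lin w dvd lin u"
        using lin_dvd_prod[OF w0, of "W - {w}" lin] fin by auto
      then show False
        using not_lin_dvd_lin[of w u] assms w by (auto simp: arrangement_def pairwise_def)
    qed
    ultimately show ?thesis using lin_prime[OF w0] by blast
  qed
  moreover have "w \<noteq> 0" if "w \<in> W" for w
    using assms that by (auto simp: arrangement_def)
  ultimately show "\<theta> \<in> logder W"
    by (simp add: logder_def lin_dvd_iff)
qed

lemma logder_grad_app:
  assumes "finite W" "\<And>w. w \<in> W \<Longrightarrow> app \<theta> w = k w * lin w"
  shows "grad_app \<theta> (form W) = (\<Sum>w\<in>W. k w) * form W"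
  using assms
proof (induction W)
  case empty
  show ?case using grad_app_cst[of \<theta> 1] by (simp add: form_def cst_1)
next
  case (insert w W)
  then show ?case
    by (simp add: form_def grad_app_mult grad_app_lin algebra_simps)
qed

lemma grad_app_euler:
  assumes "finite W"
  shows "grad_app euler (form W) = cst (of_nat (card W)) * form W"
proof -
  have "app euler w = 1 * lin w" for w
    by (rule S_eqI) simp
  then have "grad_app euler (form W) = (\<Sum>w\<in>W. 1) * form W"
    by (intro logder_grad_app assms)
  also have "(\<Sum>w\<in>W. 1) = cst (of_nat (card W))"
    by (induction "card W") (simp_all add: cst_def one_pCons of_nat_poly)
  finally show ?thesis .
qed

lemma homogeneous_rel_iff:
  "homogeneous_rel \<theta> n \<longleftrightarrow> (\<forall>v. ev \<theta> (2 *s v) = 2 ^ n *s ev \<theta> v)"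
  by (auto simp: homogeneous_rel_def homogeneous_iff vec_eq_iff)

text \<open>Since the Euler derivation multiplies \<open>form W\<close> by the number of lines, it splits off:
  every logarithmic derivation becomes a Jacobian relation after subtracting a multiple of it.\<close>

lemma logder_to_AR:
  assumes W: "arrangement W" "W \<noteq> {}" and \<theta>: "\<theta> \<in> logder W" "homogeneous_rel \<theta> (Suc n)"
  shows "\<exists>e. \<theta> - e *s euler \<in> AR (form W) \<and> homogeneous_rel (\<theta> - e *s euler) (Suc n)"
proof -
  have fin: "finite W" using W by (simp add: arrangement_def)
  have "\<exists>k. app \<theta> w = k * lin w" if "w \<in> W" for w
  proof -
    have "w \<noteq> 0" using that W(1) by (auto simp: arrangement_def)
    then have "lin w dvd app \<theta> w"
      using \<theta>(1) that by (simp add: lin_dvd_iff logder_def)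
    then show ?thesis by (metis dvdE mult.commute)
  qed
  then obtain k where k: "\<And>w. w \<in> W \<Longrightarrow> app \<theta> w = k w * lin w" by metis
  have hk: "homogeneous (k w) n" if "w \<in> W" for w
  proof (rule homogeneous_quotient)
    show "homogeneous (k w * lin w) (n + 1)"
      unfolding k[OF that, symmetric]
      using \<theta>(2) by (simp add: homogeneous_iff homogeneous_rel_iff)
  qed (use that W(1) in \<open>auto simp: homogeneous_lin arrangement_def simp del: One_nat_def\<close>)
  \<comment> \<open>\<open>\<theta>\<close> multiplies \<open>form W\<close> by the sum of the \<open>k w\<close>, the Euler derivation by the number of lines\<close>
  define e where "e = cst (1 / of_nat (card W)) * (\<Sum>w\<in>W. k w)"
  have "of_nat (card W) \<noteq> (0::complex)" using fin W(2) by simp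
  then have "e * cst (of_nat (card W)) = (\<Sum>w\<in>W. k w)"
    unfolding e_def by (intro S_eqI) simp
  then have "grad_app (\<theta> - e *s euler) (form W) = 0"
    by (simp add: grad_app_linear grad_app_euler fin logder_grad_app[OF fin k] flip: mult.assoc)
  moreover have "homogeneous_rel (\<theta> - e *s euler) (Suc n)"
  proof -
    have "eval_at (k w) (2 *s v) = 2 ^ n * eval_at (k w) v" if "w \<in> W" for w v
      using hk[OF that] by (simp add: homogeneous_iff)
    then have "eval_at e (2 *s v) = 2 ^ n * eval_at e v" for v
      by (simp add: e_def sum_distrib_left sum_divide_distrib)
    then show ?thesis
      using \<theta>(2) by (simp add: homogeneous_rel_iff vec_eq_iff algebra_simps)
  qed
  ultimately show ?thesis by (auto simp: AR_iff)
qed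

lemma span_scaled:
  assumes "\<theta> \<in> S3.span G" "\<And>g. g \<in> G \<Longrightarrow> p *s g \<in> S3.span H"
  shows "p *s \<theta> \<in> S3.span H"
proof -
  have "S3.subspace {\<theta>. p *s \<theta> \<in> S3.span H}"
    unfolding S3.subspace_def
  proof (intro conjI ballI allI)
    fix q x assume "x \<in> {\<theta>. p *s \<theta> \<in> S3.span H}"
    then have "q *s (p *s x) \<in> S3.span H" by (simp only: mem_Collect_eq S3.span_scale)
    then show "q *s x \<in> {\<theta>. p *s \<theta> \<in> S3.span H}"
      unfolding mem_Collect_eq by (subst S3.scale_left_commute)
  qed (auto simp: S3.span_zero S3.scale_right_distrib S3.span_add)
  then have "S3.span G \<subseteq> {\<theta>. p *s \<theta> \<in> S3.span H}"
    using assms(2) by (intro S3.span_minimal) auto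
  then show ?thesis using assms(1) by blast
qed

text \<open>A Jacobian relation is a combination of the corrected generators plus a multiple of the Euler
  derivation.  That multiple is again a Jacobian relation, hence zero.\<close>

lemma AR_generators:
  assumes W: "arrangement W" "W \<noteq> {}" and G: "G \<subseteq> logder W"
    and gen: "logder W \<subseteq> S3.span (insert euler G)"
    and hom: "\<And>g. g \<in> G \<Longrightarrow> homogeneous_rel g (\<delta> g) \<and> \<delta> g > 0"
  shows "\<exists>\<pi>. (\<forall>g\<in>G. (\<exists>e. \<pi> g = g - e *s euler) \<and> homogeneous_rel (\<pi> g) (\<delta> g)) \<and>
              AR (form W) = S3.span (\<pi> ` G)"
proof -
  have "\<exists>e. g - e *s euler \<in> AR (form W) \<and> homogeneous_rel (g - e *s euler) (\<delta> g)"
    if "g \<in> G" for g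
  proof -
    have "\<delta> g > 0" using hom that by blast
    then obtain n where "\<delta> g = Suc n" using gr0_implies_Suc by blast
    then show ?thesis
      using logder_to_AR[OF W, of g n] hom[OF that] that G by auto
  qed
  then obtain e where e: "\<And>g. g \<in> G \<Longrightarrow> g - e g *s euler \<in> AR (form W)"
    "\<And>g. g \<in> G \<Longrightarrow> homogeneous_rel (g - e g *s euler) (\<delta> g)" by metis
  define \<pi> where "\<pi> g = g - e g *s euler" for g
  have sub: "S3.span (\<pi> ` G) \<subseteq> AR (form W)"
    by (rule S3.span_minimal) (use e(1) AR_subspace in \<open>auto simp: \<pi>_def\<close>)
  have "AR (form W) \<subseteq> S3.span (\<pi> ` G)"
  proof
    fix \<rho> assume \<rho>: "\<rho> \<in> AR (form W)"
    let ?U = "{\<theta>. \<exists>b. \<theta> - b *s euler \<in> S3.span (\<pi> ` G)}"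
    have "S3.subspace ?U"
      unfolding S3.subspace_def
    proof (intro conjI ballI allI)
      show "0 \<in> ?U" by (intro CollectI exI[of _ 0]) (simp add: S3.span_zero)
    next
      fix x y assume "x \<in> ?U" "y \<in> ?U"
      then obtain b c where "x - b *s euler \<in> S3.span (\<pi> ` G)" "y - c *s euler \<in> S3.span (\<pi> ` G)"
        by auto
      then have "(x - b *s euler) + (y - c *s euler) \<in> S3.span (\<pi> ` G)" by (rule S3.span_add)
      then show "x + y \<in> ?U"
        by (intro CollectI exI[of _ "b + c"]) (simp add: algebra_simps)
    next
      fix p x assume "x \<in> ?U"
      then obtain b where "x - b *s euler \<in> S3.span (\<pi> ` G)" by auto
      then have "p *s (x - b *s euler) \<in> S3.span (\<pi> ` G)" by (rule S3.span_scale)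
      then show "p *s x \<in> ?U"
        by (intro CollectI exI[of _ "p * b"]) (simp add: S3.scale_right_diff_distrib)
    qed
    moreover have "insert euler G \<subseteq> ?U"
    proof
      fix x assume "x \<in> insert euler G"
      then consider "x = euler" | "x \<in> G" by blast
      then show "x \<in> ?U"
      proof cases
        case 1
        then show ?thesis by (intro CollectI exI[of _ 1]) (simp add: S3.span_zero)
      next
        case 2
        then have "\<pi> x \<in> S3.span (\<pi> ` G)" by (intro S3.span_base) auto
        then show ?thesis unfolding \<pi>_def by blast
      qed
    qed
    ultimately have "S3.span (insert euler G) \<subseteq> ?U" by (intro S3.span_minimal)
    then obtain b where b: "\<rho> - b *s euler \<in> S3.span (\<pi> ` G)"
      using \<rho> AR_subset_logder[OF W(1)] gen by blast
    then have "\<rho> - b *s euler \<in> AR (form W)" using sub by blast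
    then have "b * grad_app euler (form W) = 0"
      using \<rho> by (simp add: AR_iff grad_app_linear)
    moreover have "grad_app euler (form W) \<noteq> 0"
      using W form_nonzero[OF W(1)] grad_app_euler[of W] by (auto simp: arrangement_def)
    ultimately have "b = 0" by simp
    then show "\<rho> \<in> S3.span (\<pi> ` G)" using b by simp
  qed
  then show ?thesis
    using sub e(2) by (intro exI[of _ \<pi>]) (auto simp: \<pi>_def)
qed

text \<open>Subtracting multiples of the Euler derivation turns generators of the logarithmic derivations into
  generators of the Jacobian relations, without changing degrees or irredundancy.\<close>

lemma has_exponents_from_logder:
  assumes W: "arrangement W" "W \<noteq> {}" and A: "AR (defining_poly A) = AR (form W)"
    and G: "set gs \<subseteq> logder W" "distinct gs"
    and gen: "logder W \<subseteq> S3.span (insert euler (set gs))"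
    and hom: "list_all2 homogeneous_rel gs es" "\<forall>e\<in>set es. e > 0" "sorted es"
    and mn: "\<And>g. g \<in> set gs \<Longrightarrow> g \<notin> S3.span (insert euler (set gs - {g}))"
  shows "has_exponents A es"
proof -
  define \<delta> where "\<delta> g = es ! (SOME i. i < length gs \<and> gs ! i = g)" for g
  have len: "length gs = length es" using hom(1) by (rule list_all2_lengthD)
  have \<delta>: "\<delta> (gs ! i) = es ! i" if "i < length gs" for i
  proof -
    have "(SOME j. j < length gs \<and> gs ! j = gs ! i) = i"
      using that G(2) by (intro some_equality) (auto simp: nth_eq_iff_index_eq)
    then show ?thesis by (simp add: \<delta>_def)
  qed
  have "homogeneous_rel g (\<delta> g) \<and> \<delta> g > 0" if g: "g \<in> set gs" for g
  proof -
    obtain i where i: "i < length gs" "g = gs ! i" using g by (auto simp: in_set_conv_nth)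
    have "homogeneous_rel (gs ! i) (es ! i)" using hom(1) i(1) by (rule list_all2_nthD)
    moreover have "es ! i > 0" using hom(2) i(1) len by simp
    ultimately show ?thesis using \<delta>[OF i(1)] i(2) by simp
  qed
  from AR_generators[OF W G(1) gen, of \<delta>, OF this]
  obtain \<pi> where \<pi>: "\<And>g. g \<in> set gs \<Longrightarrow> \<exists>e. \<pi> g = g - e *s euler"
    "\<And>g. g \<in> set gs \<Longrightarrow> homogeneous_rel (\<pi> g) (\<delta> g)"
    "AR (form W) = S3.span (\<pi> ` set gs)" by blast
  have key: "\<pi> g \<notin> S3.span (\<pi> ` (set gs - {g}))" if g: "g \<in> set gs" for g
  proof
    assume h: "\<pi> g \<in> S3.span (\<pi> ` (set gs - {g}))"
    have eu: "euler \<in> S3.span (insert euler (set gs - {g}))" by (simp add: S3.span_base)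
    have "\<pi> ` (set gs - {g}) \<subseteq> S3.span (insert euler (set gs - {g}))"
    proof
      fix x assume "x \<in> \<pi> ` (set gs - {g})"
      then obtain k where k: "k \<in> set gs - {g}" "x = \<pi> k" by blast
      moreover obtain e where "\<pi> k = k - e *s euler" using \<pi>(1) k(1) by blast
      ultimately have k: "k \<in> set gs - {g}" "x = k - e *s euler" by auto
      then show "x \<in> S3.span (insert euler (set gs - {g}))"
        unfolding k(2) using k(1) eu
        by (intro S3.span_diff S3.span_scale) (auto intro: S3.span_base)
    qed
    then have "\<pi> g \<in> S3.span (insert euler (set gs - {g}))"
      using h S3.span_minimal[OF _ S3.subspace_span] by blast
    moreover obtain e where "\<pi> g = g - e *s euler" using \<pi>(1)[OF g] by blast
    ultimately have "(g - e *s euler) + e *s euler \<in> S3.span (insert euler (set gs - {g}))"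
      using eu by (intro S3.span_add S3.span_scale) simp_all
    then show False using mn[OF g] by simp
  qed
  have inj: "inj_on \<pi> (set gs)"
  proof (rule inj_onI, rule ccontr)
    fix g h assume "g \<in> set gs" "h \<in> set gs" "\<pi> g = \<pi> h" "g \<noteq> h"
    then have "\<pi> g \<in> S3.span (\<pi> ` (set gs - {g}))" by (intro S3.span_base) auto
    then show False using key \<open>g \<in> set gs\<close> by simp
  qed
  have "S3.span H \<noteq> AR (form W)" if H: "H \<subset> \<pi> ` set gs" for H
  proof
    assume eq: "S3.span H = AR (form W)"
    obtain g where g: "g \<in> set gs" "\<pi> g \<notin> H" using H by blast
    then have "H \<subseteq> \<pi> ` (set gs - {g})" using H by blast
    then have "S3.span H \<subseteq> S3.span (\<pi> ` (set gs - {g}))" by (rule S3.span_mono)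
    moreover have "\<pi> g \<in> S3.span H"
      unfolding eq \<pi>(3) using g(1) by (intro S3.span_base) auto
    ultimately show False using key[OF g(1)] by blast
  qed
  moreover have "list_all2 homogeneous_rel (map \<pi> gs) es"
    unfolding list_all2_conv_all_nth using len \<pi>(2) \<delta> by (metis length_map nth_map nth_mem)
  ultimately show ?thesis
    unfolding has_exponents_def S_span_def A
    using hom(3) inj G(2) \<pi>(3)
    by (intro conjI exI[of _ "map \<pi> gs"]) (auto simp: distinct_map)
qed

text \<open>Combinations of relations of degree \<open>n\<close> vanish to order \<open>n\<close> at the origin, which excludes
  nonzero homogeneous ones of smaller degree.\<close>

lemma mdr_eqI:
  assumes W: "arrangement W" "W \<noteq> {}" and G: "G \<subseteq> logder W"
    and gen: "logder W \<subseteq> S3.span (insert euler G)"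
    and hom: "\<And>g. g \<in> G \<Longrightarrow> homogeneous_rel g n" "n > 0"
    and ne: "g \<in> G" "g \<notin> S3.span {euler}"
    and f: "AR f = AR (form W)"
  shows "mdr f = n"
  unfolding mdr_def f
proof (rule Least_equality)
  obtain \<pi> where \<pi>: "\<And>g. g \<in> G \<Longrightarrow> \<exists>e. \<pi> g = g - e *s euler"
    "\<And>g. g \<in> G \<Longrightarrow> homogeneous_rel (\<pi> g) n"
    "AR (form W) = S3.span (\<pi> ` G)"
  proof -
    have "homogeneous_rel g n \<and> n > 0" if "g \<in> G" for g
      using hom that by blast
    from AR_generators[OF W G gen, of "\<lambda>_. n", OF this] that show ?thesis by auto
  qed
  obtain e where e: "\<pi> g = g - e *s euler" using \<pi>(1)[OF ne(1)] by blast
  have "\<pi> g \<noteq> 0"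
  proof
    assume "\<pi> g = 0"
    then have "g = e *s euler" using e by simp
    moreover have "e *s euler \<in> S3.span {euler}" by (intro S3.span_scale S3.span_base) simp
    ultimately show False using ne(2) by simp
  qed
  moreover have "\<pi> g \<in> AR (form W)" unfolding \<pi>(3) using ne(1) by (intro S3.span_base) auto
  ultimately show "\<exists>\<rho>\<in>AR (form W). \<rho> \<noteq> 0 \<and> homogeneous_rel \<rho> n"
    using \<pi>(2)[OF ne(1)] by blast
  fix k assume "\<exists>\<rho>\<in>AR (form W). \<rho> \<noteq> 0 \<and> homogeneous_rel \<rho> k"
  then obtain \<rho> where \<rho>: "\<rho> \<in> AR (form W)" "\<rho> \<noteq> 0" "homogeneous_rel \<rho> k" by blast
  \<comment> \<open>elements all of whose entries vanish at the origin to order \<open>n\<close>\<close>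
  let ?U = "{\<theta>. \<forall>v i. \<exists>q::complex poly. \<forall>t. eval_at (\<theta> $ i) (t *s v) = t ^ n * poly q t} :: (S ^ 3) set"
  have "S3.subspace ?U"
    unfolding S3.subspace_def
  proof (intro conjI ballI allI)
    show "0 \<in> ?U" by (auto intro!: exI[of _ 0])
  next
    fix x y assume xy: "x \<in> ?U" "y \<in> ?U"
    have "\<exists>q. \<forall>t. eval_at ((x + y) $ i) (t *s v) = t ^ n * poly q t" for v i
    proof -
      obtain q where q: "\<forall>t. eval_at (x $ i) (t *s v) = t ^ n * poly q t" using xy by blast
      obtain r where "\<forall>t. eval_at (y $ i) (t *s v) = t ^ n * poly r t" using xy by blast
      with q show ?thesis by (intro exI[of _ "q + r"]) (simp add: algebra_simps)
    qed
    then show "x + y \<in> ?U" by blast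
  next
    fix p x assume x: "x \<in> ?U"
    have "\<exists>q. \<forall>t. eval_at ((p *s x) $ i) (t *s v) = t ^ n * poly q t" for v i
    proof -
      obtain q where q: "\<forall>t. eval_at (x $ i) (t *s v) = t ^ n * poly q t" using x by blast
      obtain r where "\<forall>t. eval_at p (t *s v) = poly r t" using eval_along_ray by blast
      with q show ?thesis by (intro exI[of _ "r * q"]) simp
    qed
    then show "p *s x \<in> ?U" by blast
  qed
  moreover have "\<pi> ` G \<subseteq> ?U"
  proof
    fix x assume "x \<in> \<pi> ` G"
    then have "homogeneous_rel x n" using \<pi>(2) by blast
    then have "eval_at (x $ i) (t *s v) = t ^ n * poly [:eval_at (x $ i) v:] t" for i t v
      using homogeneous_scale[of "x $ i" n t v] by (simp add: homogeneous_rel_def)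
    then show "x \<in> ?U" by blast
  qed
  ultimately have U: "\<rho> \<in> ?U"
    using \<rho>(1) S3.span_minimal[of "\<pi> ` G" ?U] unfolding \<pi>(3) by blast
  show "n \<le> k"
  proof (rule ccontr)
    assume "\<not> n \<le> k"
    have "eval_at (\<rho> $ i) v = 0" for i v
    proof -
      obtain q where "\<forall>t. eval_at (\<rho> $ i) (t *s v) = t ^ n * poly q t" using U by blast
      then have "t ^ k * eval_at (\<rho> $ i) v = t ^ n * poly q t" for t
        using homogeneous_scale[of "\<rho> $ i" k t v] \<rho>(3) by (simp add: homogeneous_rel_def)
      then have "poly (monom (eval_at (\<rho> $ i) v) k) = poly (monom 1 n * q)"
        by (intro ext) (simp add: poly_monom mult.commute)
      then have "monom (eval_at (\<rho> $ i) v) k = monom 1 n * q"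
        by (simp only: poly_eq_poly_eq_iff)
      then have "coeff (monom (eval_at (\<rho> $ i) v) k) k = coeff (monom 1 n * q) k" by simp
      then show ?thesis using \<open>\<not> n \<le> k\<close> by (simp add: coeff_monom_mult)
    qed
    then have "\<rho> = 0" by (intro S3_eqI) (simp add: vec_eq_iff)
    then show False using \<rho>(2) by simp
  qed
qed

section \<open>Adding a line\<close>

definition cvec :: "complex ^ 3 \<Rightarrow> S ^ 3" where
  "cvec P = (\<chi> i. cst (P $ i))"

lemma ev_cvec [simp]: "ev (cvec P) v = P"
  by (simp add: cvec_def vec_eq_iff)

definition sdet :: "S ^ 3 \<Rightarrow> S ^ 3 \<Rightarrow> S ^ 3 \<Rightarrow> S" where
  "sdet \<theta> \<phi> \<eta> = \<theta> $ 1 * (\<phi> $ 2 * \<eta> $ 3 - \<phi> $ 3 * \<eta> $ 2) + \<theta> $ 2 * (\<phi> $ 3 * \<eta> $ 1 - \<phi> $ 1 * \<eta> $ 3)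
     + \<theta> $ 3 * (\<phi> $ 1 * \<eta> $ 2 - \<phi> $ 2 * \<eta> $ 1)"

lemma eval_sdet [simp]: "eval_at (sdet \<theta> \<phi> \<eta>) v = det3 (ev \<theta> v) (ev \<phi> v) (ev \<eta> v)"
  by (simp add: sdet_def det3_def dot_def)

lemma det3_linear:
  "det3 (a + b) c d = det3 a c d + det3 b c d" "det3 (a - b) c d = det3 a c d - det3 b c d"
  "det3 (k *s a) c d = k * det3 a c d" "det3 0 c d = 0"
  "det3 c (a + b) d = det3 c a d + det3 c b d" "det3 c (a - b) d = det3 c a d - det3 c b d"
  "det3 c (k *s a) d = k * det3 c a d" "det3 c 0 d = 0"
  "det3 c d (a + b) = det3 c d a + det3 c d b" "det3 c d (a - b) = det3 c d a - det3 c d b"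
  "det3 c d (k *s a) = k * det3 c d a" "det3 c d 0 = 0"
  by (simp_all add: det3_def dot_def algebra_simps)

text \<open>The cross product of two vectors in the plane \<open>w = 0\<close> is a multiple of \<open>w\<close>, and its product with \<open>n\<close>
  is the determinant.\<close>

lemma tangent_parallel:
  assumes "dot w n = 1" "dot w a = 0" "dot w b = 0" "det3 a b n = 0"
  shows "vcross a b = 0"
proof -
  have w: "w \<noteq> 0" using assms(1) by auto
  have "vcross (vcross a b) w = dot w a *s b - dot w b *s a"
    by (simp add: vec3_eq_iff dot_def algebra_simps)
  then obtain c where c: "vcross a b = c *s w"
    using assms(2,3) vcross_eq_0_iff[OF w] by auto
  have "det3 a b n = dot (vcross a b) n"
    by (simp add: det3_def dot_def algebra_simps)
  then show ?thesis using c assms(1,4) by simp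
qed

lemma det3_eq_dot: "det3 a b c = dot (vcross a b) c"
  by (simp add: det3_def dot_def algebra_simps)

text \<open>A coordinate \<open>x\<^sub>j\<close> that is not proportional to \<open>w\<close> determines the factor: \<open>\<phi>\<^sub>j\<close> vanishes on the line wherever
  \<open>x\<^sub>j\<close> does, so \<open>\<phi>\<^sub>j = e * x\<^sub>j\<close> there, and cancelling \<open>x\<^sub>j\<close> gives the same factor \<open>e\<close> for the other
  components.\<close>

lemma radial_on_line:
  assumes w: "w \<noteq> 0" and rad: "\<And>v. dot w v = 0 \<Longrightarrow> vcross (ev \<phi> v) v = 0"
  shows "\<exists>e \<theta>. \<phi> = e *s euler + lin w *s \<theta>"
proof -
  have "\<exists>j. vcross w (axis j 1) \<noteq> 0"
  proof (rule ccontr)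
    assume "\<not> ?thesis"
    then have "vcross w (axis 1 1) = 0" "vcross w (axis 2 1) = 0" by auto
    then show False using w by (auto simp: vec3_eq_iff axis_def)
  qed
  then obtain j where j: "vcross w (axis j 1) \<noteq> 0" by blast
  have ax: "dot (axis i 1) v = v $ i" for i v
    using exhaust_3[of i] by (auto simp: dot_def axis_def)
  have sym: "eval_at (\<phi> $ i) v * v $ k = eval_at (\<phi> $ k) v * v $ i" if "dot w v = 0" for i k v
    using rad[OF that] exhaust_3[of i] exhaust_3[of k] by (auto simp: vec3_eq_iff)
  have z: "eval_at (\<phi> $ j) v = 0" if "dot w v = 0" "v $ j = 0" "v \<noteq> 0" for v
  proof -
    obtain i where "v $ i \<noteq> 0" using \<open>v \<noteq> 0\<close> by (auto simp: vec_eq_iff)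
    then show ?thesis using sym[OF that(1), of j i] that(2) by simp
  qed
  have "eval_at (\<phi> $ j) v = 0" if "dot w v = 0" "dot (axis j 1) v = 0" for v
  proof (cases "v = 0")
    case True
    have "eval_at (\<phi> $ j) (t *s vcross w (axis j 1)) = 0" if "t \<noteq> 0" for t
    proof (rule z)
      show "(t *s vcross w (axis j 1)) $ j = 0"
        by (metis ax dot_linear(8) dot_vcross_same(2) mult_zero_right)
    qed (use that j in simp_all)
    then show ?thesis using vanish_off_0_imp True by blast
  next
    case False
    then show ?thesis using z that ax by simp
  qed
  from vanish_on_point_imp[OF j this]
  obtain a e where e: "\<phi> $ j = lin w * a + lin (axis j 1) * e" by blast
  have "lin w dvd (\<phi> - e *s euler) $ i" for i
  proof -
    have "lin w dvd lin (axis j 1) * (\<phi> - e *s euler) $ i"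
      unfolding lin_dvd_iff[OF w]
    proof (intro allI impI)
      fix v assume v: "dot w v = 0"
      have "eval_at (euler $ i) v = v $ i" using ev_euler[of v] ev_nth by metis
      then show "eval_at (lin (axis j 1) * (\<phi> - e *s euler) $ i) v = 0"
        using sym[OF v, of i j] v by (simp add: ax e algebra_simps)
    qed
    then show ?thesis using lin_prime[OF w] not_lin_dvd_lin[OF j] by blast
  qed
  then have "\<forall>i. \<exists>q. (\<phi> - e *s euler) $ i = lin w * q" by (auto elim: dvdE)
  then obtain q where "\<And>i. (\<phi> - e *s euler) $ i = lin w * q i" by metis
  then have "\<phi> - e *s euler = lin w *s (\<chi> i. q i)" by (simp add: vec_eq_iff)
  then have "\<phi> = e *s euler + lin w *s (\<chi> i. q i)" by (simp add: diff_eq_eq add.commute)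
  then show ?thesis by blast
qed

text \<open>The determinant of \<open>\<theta>\<close>, the Euler field and a vector \<open>n\<close> off the line measures how far \<open>\<theta>\<close> is
  from being radial along the line.  It vanishes at every intersection with another line, because \<open>\<theta>\<close>
  is tangent to both; so on the line it is a multiple \<open>c\<close> of the determinant of \<open>\<psi>\<close>, the product over the points
  \<open>m\<close>.  Hence \<open>\<theta> - c * \<psi>\<close> is radial along the line, and what remains after subtracting a multiple
  of the Euler field is divisible by the equation of the line.\<close>

lemma add_line:
  assumes W: "\<And>u. u \<in> W \<Longrightarrow> vcross u w \<noteq> 0" and w: "dot w n = 1"
    and \<psi>: "\<psi> \<in> logder (insert w W)" and M: "finite M" "\<And>m. m \<in> M \<Longrightarrow> vcross w m \<noteq> 0"
      "\<And>m m'. m \<in> M \<Longrightarrow> m' \<in> M \<Longrightarrow> m \<noteq> m' \<Longrightarrow> det3 w m m' \<noteq> 0"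
    and pt: "\<And>m. m \<in> M \<Longrightarrow> \<exists>u\<in>W. \<forall>v. dot w v = 0 \<longrightarrow> dot m v = 0 \<longrightarrow> dot u v = 0"
    and \<gamma>: "\<gamma> \<noteq> 0" "\<And>v. dot w v = 0 \<Longrightarrow> det3 (ev \<psi> v) v n = \<gamma> * (\<Prod>m\<in>M. dot m v)"
    and \<theta>: "\<theta> \<in> logder (insert w W)"
  shows "\<exists>c e \<theta>'. \<theta>' \<in> logder W \<and> \<theta> = c *s \<psi> + e *s euler + lin w *s \<theta>'"
proof -
  have w0: "w \<noteq> 0" using w by auto
  \<comment> \<open>at the point where the line \<open>w\<close> meets a line \<open>u\<close> both \<open>\<theta>\<close> and \<open>v\<close> lie in the one-dimensional
    intersection\<close>
  have pv: "eval_at (sdet \<theta> euler (cvec n)) v = 0"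
    if m: "m \<in> M" and wv: "dot w v = 0" and mv: "dot m v = 0" for m v
  proof -
    obtain u where u: "u \<in> W" "dot u v = 0" using pt[OF m] wv mv by blast
    then have wu: "vcross w u \<noteq> 0" using W vcross_commute by (metis neg_equal_0_iff_equal)
    have "dot w (ev \<theta> v) = 0" "dot u (ev \<theta> v) = 0"
      using \<theta> u wv by (auto simp: logder_def)
    then obtain a where a: "ev \<theta> v = a *s vcross w u" using on_two_lines[OF wu] by metis
    obtain b where "v = b *s vcross w u" using on_two_lines[OF wu wv u(2)] by metis
    then show ?thesis using a by (simp add: det3_linear)
  qed
  have "\<exists>c a. sdet \<theta> euler (cvec n) = c * (\<Prod>m\<in>M. lin m) + lin w * a"
    by (rule vanish_on_points_imp) (use M pv in blast)+
  then obtain c a where c: "sdet \<theta> euler (cvec n) = c * (\<Prod>m\<in>M. lin m) + lin w * a" by blast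
  let ?c = "cst (1 / \<gamma>) * c"
  let ?\<phi> = "\<theta> - ?c *s \<psi>"
  have \<phi>: "?\<phi> \<in> logder (insert w W)"
    using \<theta> \<psi> logder_subspace by (intro S3.subspace_diff S3.subspace_scale) auto
  have "vcross (ev ?\<phi> v) v = 0" if v: "dot w v = 0" for v
  proof (rule tangent_parallel[OF w _ v])
    show "dot w (ev ?\<phi> v) = 0" using \<phi> v unfolding logder_def by blast
    have "det3 (ev \<theta> v) v n = eval_at c v * (\<Prod>m\<in>M. dot m v)"
      using arg_cong[OF c, of "\<lambda>p. eval_at p v"] v by simp
    then show "det3 (ev ?\<phi> v) v n = 0"
      using \<gamma> v by (simp add: det3_linear)
  qed
  from radial_on_line[OF w0 this]
  obtain e \<theta>' where e: "?\<phi> = e *s euler + lin w *s \<theta>'" by blast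
  have "\<theta>' \<in> logder W"
    unfolding logder_def
  proof (intro CollectI ballI)
    fix u assume u: "u \<in> W"
    then have uw: "vcross u w \<noteq> 0" by (rule W)
    then have u0: "u \<noteq> 0" by auto
    have "lin w *s \<theta>' = ?\<phi> - e *s euler" using e by simp
    then have "dot u (ev (lin w *s \<theta>') v) = 0" if "dot u v = 0" for v
      using \<phi> u that unfolding logder_def by simp
    then have "lin u dvd lin w * app \<theta>' u"
      unfolding lin_dvd_iff[OF u0] by simp
    then have "lin u dvd app \<theta>' u" using lin_prime[OF u0] not_lin_dvd_lin[OF uw] by blast
    then show "\<forall>v. dot u v = 0 \<longrightarrow> dot u (ev \<theta>' v) = 0"
      unfolding lin_dvd_iff[OF u0] by simp
  qed
  moreover have "\<theta> = ?c *s \<psi> + e *s euler + lin w *s \<theta>'"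
    using e by (simp add: algebra_simps)
  ultimately show ?thesis by blast
qed

text \<open>The constant field in direction \<open>P\<close> is tangent to the lines through \<open>P\<close>; the factors make it vanish on
  the others.\<close>

definition pder :: "(complex ^ 3) set \<Rightarrow> complex ^ 3 \<Rightarrow> S ^ 3" where
  "pder W P = (\<Prod>w\<in>{w \<in> W. dot w P \<noteq> 0}. lin w) *s cvec P"

lemma ev_pder [simp]:
  "ev (pder W P) v = (\<Prod>w\<in>{w \<in> W. dot w P \<noteq> 0}. dot w v) *s P"
  by (simp add: pder_def)

lemma pder_logder: "finite W \<Longrightarrow> pder W P \<in> logder W"
  by (auto simp: logder_def)

lemma homogeneous_pder: "homogeneous_rel (pder W P) (card {w \<in> W. dot w P \<noteq> 0})"
proof -
  have "homogeneous_rel (f *s cvec P) n" if "homogeneous f n" for f n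
    using that by (simp add: homogeneous_rel_iff homogeneous_iff)
  then show ?thesis unfolding pder_def by (simp add: homogeneous_prod_lin)
qed

lemma pder_insert:
  assumes "finite W" "w \<notin> W"
  shows "dot w P \<noteq> 0 \<Longrightarrow> pder (insert w W) P = lin w *s pder W P"
    "dot w P = 0 \<Longrightarrow> pder (insert w W) P = pder W P"
proof -
  assume "dot w P \<noteq> 0"
  then have "{x \<in> insert w W. dot x P \<noteq> 0} = insert w {x \<in> W. dot x P \<noteq> 0}" by auto
  then show "pder (insert w W) P = lin w *s pder W P"
    using assms by (simp add: pder_def)
next
  assume "dot w P = 0"
  then have "{x \<in> insert w W. dot x P \<noteq> 0} = {x \<in> W. dot x P \<noteq> 0}" by auto
  then show "pder (insert w W) P = pder W P"
    by (simp add: pder_def)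
qed

text \<open>The set \<open>PP\<close> may contain points off the arrangement \<open>W\<close>, so that it can stay fixed while lines are
  added.\<close>

definition spanned :: "(complex ^ 3) set \<Rightarrow> (complex ^ 3) set \<Rightarrow> bool" where
  "spanned W PP \<longleftrightarrow> logder W \<subseteq> S3.span (insert euler (pder W ` PP))"

lemma point_equation:
  assumes w: "dot w n = 1" and P: "P \<noteq> 0" "dot w P = 0"
  shows "vcross w (vcross n P) \<noteq> 0" "dot (vcross n P) v = det3 P v n"
    "dot w v = 0 \<Longrightarrow> dot (vcross n P) v = 0 \<Longrightarrow> \<exists>c. v = c *s P"
proof -
  have "vcross w (vcross n P) = dot w P *s n - dot w n *s P"
    by (simp add: vec3_eq_iff dot_def algebra_simps)
  then have e: "vcross w (vcross n P) = - P" using w P by simp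
  then show "vcross w (vcross n P) \<noteq> 0" using P by simp
  show "dot (vcross n P) v = det3 P v n" by (simp add: det3_def dot_def algebra_simps)
  assume "dot w v = 0" "dot (vcross n P) v = 0"
  then obtain c where "v = c *s vcross w (vcross n P)"
    using on_two_lines \<open>vcross w (vcross n P) \<noteq> 0\<close> by metis
  then have "v = (- c) *s P" using e by (simp add: vec_eq_iff)
  then show "\<exists>c. v = c *s P" by blast
qed

text \<open>If all triple points on the new line coincide with \<open>P\<close>, then the points on the line are \<open>P\<close> and its intersections
  with the lines that avoid \<open>P\<close>.  The determinant of \<open>pder\<close> at \<open>P\<close> is the product of
  their equations, so \<open>add_line\<close> applies.\<close>

lemma add_line_point:
  assumes A: "arrangement (insert w W)" "w \<notin> W"
    and P: "P \<noteq> 0" "dot w P = 0" and u0: "u0 \<in> W" "dot u0 P = 0"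
    and conc: "\<And>u u'. u \<in> W \<Longrightarrow> u' \<in> W \<Longrightarrow> u \<noteq> u' \<Longrightarrow> dot u P \<noteq> 0 \<Longrightarrow> dot u' P \<noteq> 0 \<Longrightarrow> det3 w u u' \<noteq> 0"
    and \<theta>: "\<theta> \<in> logder (insert w W)"
  shows "\<exists>c e \<theta>'. \<theta>' \<in> logder W \<and>
    \<theta> = c *s pder (insert w W) P + e *s euler + lin w *s \<theta>'"
proof -
  let ?W = "insert w W"
  have fin: "finite W" using A by (simp add: arrangement_def)
  have W: "vcross u w \<noteq> 0" if "u \<in> W" for u
    using A that by (auto simp: arrangement_def pairwise_def)
  then have W': "vcross w u \<noteq> 0" if "u \<in> W" for u
    using that vcross_commute by (metis neg_equal_0_iff_equal)
  have "w \<noteq> 0" using A by (auto simp: arrangement_def)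
  then obtain n where n: "dot w n = 1" using exists_dot_1 by blast
  \<comment> \<open>an equation of the point \<open>P\<close> on the line\<close>
  define m where "m = vcross n P"
  note me = point_equation[OF n P, folded m_def]
  let ?B = "{u \<in> W. dot u P \<noteq> 0}"
  have mP: "dot m P = 0" using me(2) by simp
  have mm: "det3 w m u \<noteq> 0" if u: "u \<in> ?B" for u
  proof
    assume "det3 w m u = 0"
    then have "dot m (vcross w u) = 0" using det3_perm unfolding det3_def by (metis neg_equal_0_iff_equal)
    moreover have "dot w (vcross w u) = 0" by simp
    ultimately obtain c where c: "vcross w u = c *s P" using me(3) by blast
    then have "c \<noteq> 0" using W'[of u] u by auto
    moreover have "dot u (vcross w u) = 0" by simp
    ultimately show False using c u by simp
  qed
  show "\<exists>c e \<theta>'. \<theta>' \<in> logder W \<and> \<theta> = c *s pder ?W P + e *s euler + lin w *s \<theta>'"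
  proof (rule add_line[OF W n, where M = "insert m ?B" and \<gamma> = 1])
    show "pder ?W P \<in> logder ?W" using fin by (simp add: pder_logder)
    show "det3 w x x' \<noteq> 0" if "x \<in> insert m ?B" "x' \<in> insert m ?B" "x \<noteq> x'" for x x'
    proof -
      have "det3 w x m = - det3 w m x" by (simp add: det3_def dot_def algebra_simps)
      then show ?thesis using that mm conc by auto
    qed
    show "\<exists>u\<in>W. \<forall>v. dot w v = 0 \<longrightarrow> dot x v = 0 \<longrightarrow> dot u v = 0" if "x \<in> insert m ?B" for x
    proof (cases "x = m")
      case True
      have "dot u0 v = 0" if "dot w v = 0" "dot m v = 0" for v
        using me(3)[OF that] u0(2) by auto
      then show ?thesis using True u0(1) by blast
    next
      case False
      then show ?thesis using that by blast
    qed
    show "det3 (ev (pder ?W P) v) v n = 1 * (\<Prod>x\<in>insert m ?B. dot x v)" for v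
    proof -
      have "{x \<in> ?W. dot x P \<noteq> 0} = ?B" using P(2) by auto
      moreover have "m \<notin> ?B" using mP by simp
      ultimately show ?thesis using fin me(2)[of v] by (simp add: det3_linear)
    qed
  qed (use fin W' me \<theta> in auto)
qed

lemma spanned_insert:
  assumes A: "arrangement (insert w W)" "w \<notin> W"
    and P: "P \<in> PP" "P \<noteq> 0" "dot w P = 0" and u0: "u0 \<in> W" "dot u0 P = 0"
    and conc: "\<And>u u'. u \<in> W \<Longrightarrow> u' \<in> W \<Longrightarrow> u \<noteq> u' \<Longrightarrow> dot u P \<noteq> 0 \<Longrightarrow> dot u' P \<noteq> 0 \<Longrightarrow> det3 w u u' \<noteq> 0"
    and sp: "spanned W PP"
  shows "spanned (insert w W) PP"
  unfolding spanned_def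
proof
  let ?W = "insert w W"
  let ?N = "S3.span (insert euler (pder ?W ` PP))"
  fix \<theta> assume \<theta>: "\<theta> \<in> logder ?W"
  have fin: "finite W" using A by (simp add: arrangement_def)
  obtain c e \<theta>' where 1: "\<theta>' \<in> logder W" "\<theta> = c *s pder ?W P + e *s euler + lin w *s \<theta>'"
    using add_line_point[OF A P(2,3) u0 conc \<theta>] by blast
  have eu: "euler \<in> ?N" by (simp add: S3.span_base)
  have "lin w *s pder W Q \<in> ?N" if "Q \<in> PP" for Q
  proof -
    have "pder ?W Q \<in> ?N" using that by (simp add: S3.span_base)
    then show ?thesis
      using pder_insert[OF fin A(2), of Q] S3.span_scale by (cases "dot w Q = 0") auto
  qed
  then have "lin w *s \<theta>' \<in> ?N"
    using 1(1) sp eu unfolding spanned_def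
    by (intro span_scaled[of \<theta>' "insert euler (pder W ` PP)"]) (auto intro: S3.span_scale)
  moreover have "pder ?W P \<in> ?N" using P(1) by (simp add: S3.span_base)
  ultimately show "\<theta> \<in> ?N"
    unfolding 1(2) using eu
    by (intro S3.span_add[OF S3.span_add[OF S3.span_scale S3.span_scale]])
qed

lemma cramer:
  "det3 P Q m *s x = det3 x Q m *s P + det3 P x m *s Q + det3 P Q x *s m"
  by (simp add: vec3_eq_iff det3_def dot_def algebra_simps)

lemma spanned_single:
  assumes w: "w \<noteq> 0" and PQ: "P \<in> PP" "Q \<in> PP" "dot w P = 0" "dot w Q = 0" "vcross P Q \<noteq> 0"
  shows "spanned {w} PP"
  unfolding spanned_def
proof
  let ?N = "S3.span (insert euler (pder {w} ` PP))"
  fix \<theta> assume "\<theta> \<in> logder {w}"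
  then have "lin w dvd app \<theta> w" by (simp add: logder_def lin_dvd_iff[OF w])
  then obtain k where k: "app \<theta> w = lin w * k" by blast
  obtain m where m: "dot (vcross P Q) m = 1" using exists_dot_1[OF PQ(5)] by blast
  then have m': "det3 P Q m = 1" by (simp add: det3_def dot_def algebra_simps)
  let ?\<phi> = "\<theta> - k *s euler"
  have e: "{x. x = w \<and> dot x P \<noteq> 0} = {}" "{x. x = w \<and> dot x Q \<noteq> 0} = {}"
    using PQ by auto
  obtain c where c: "w = c *s vcross P Q"
    using on_two_lines[OF PQ(5), of w] PQ(3,4) by (metis dot_commute)
  then have c0: "c \<noteq> 0" using w by auto
  have "?\<phi> = sdet ?\<phi> (cvec Q) (cvec m) *s pder {w} P + sdet (cvec P) ?\<phi> (cvec m) *s pder {w} Q"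
  proof (rule S3_eqI)
    fix v
    have "dot w (ev ?\<phi> v) = 0"
      using arg_cong[OF k, of "\<lambda>p. eval_at p v"] by (simp add: mult.commute)
    then have "det3 P Q (ev ?\<phi> v) = 0"
      using c c0 by (simp add: det3_eq_dot)
    then show "ev ?\<phi> v = ev (sdet ?\<phi> (cvec Q) (cvec m) *s pder {w} P +
        sdet (cvec P) ?\<phi> (cvec m) *s pder {w} Q) v"
      using cramer[of P Q m "ev ?\<phi> v"] m' by (simp add: e)
  qed
  moreover have "pder {w} P \<in> ?N" "pder {w} Q \<in> ?N" "euler \<in> ?N"
    using PQ by (auto intro: S3.span_base)
  ultimately have "?\<phi> \<in> ?N" by (metis S3.span_add S3.span_scale)
  then have "?\<phi> + k *s euler \<in> ?N"
    using \<open>euler \<in> ?N\<close> by (intro S3.span_add S3.span_scale)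
  then show "\<theta> \<in> ?N" by simp
qed

section \<open>Irredundancy of generators\<close>

text \<open>The fields that are multiples of the Euler field along the line \<open>w\<close>.  They contain every field that
  vanishes on the line, in particular \<open>pder W Q\<close> for \<open>Q\<close> off the line.\<close>

definition radial :: "complex ^ 3 \<Rightarrow> (S ^ 3) set" where
  "radial w = {\<theta>. \<forall>v. dot w v = 0 \<longrightarrow> vcross (ev \<theta> v) v = 0}"

lemma radial_subspace: "S3.subspace (radial w)"
proof -
  have "vcross (a + b) v = vcross a v + vcross b v" for a b v
    by (simp add: vec3_eq_iff algebra_simps)
  then show ?thesis by (auto simp: S3.subspace_def radial_def)
qed

lemma radialI [simp]:
  "euler \<in> radial w" "lin w *s \<theta> \<in> radial w"
  "finite W \<Longrightarrow> w \<in> W \<Longrightarrow> dot w P \<noteq> 0 \<Longrightarrow> pder W P \<in> radial w"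
proof -
  show "euler \<in> radial w" "lin w *s \<theta> \<in> radial w" by (simp_all add: radial_def)
  assume "finite W" "w \<in> W" "dot w P \<noteq> 0"
  then have "(\<Prod>x\<in>{x \<in> W. dot x P \<noteq> 0}. dot x v) = 0" if "dot w v = 0" for v
    using that by (intro prod_zero) auto
  then show "pder W P \<in> radial w" by (simp add: radial_def)
qed

lemma pder_not_radial:
  assumes W: "arrangement W" and w: "w \<in> W" "dot w P = 0" and P: "P \<noteq> 0"
  shows "pder W P \<notin> radial w"
proof
  assume r: "pder W P \<in> radial w"
  have w0: "w \<noteq> 0" using W w by (auto simp: arrangement_def)
  then obtain n where n: "dot w n = 1" using exists_dot_1 by blast
  note me = point_equation[OF n P w(2)]
  let ?F = "insert (lin (vcross n P)) (lin ` {u \<in> W. dot u P \<noteq> 0})"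
  have "\<exists>v. dot w v = 0 \<and> (\<forall>p\<in>?F. eval_at p v \<noteq> 0)"
  proof (rule generic_point_on_line[OF w0])
    show "finite ?F" using W by (simp add: arrangement_def)
    have "vcross w u \<noteq> 0" if "u \<in> W" "dot u P \<noteq> 0" for u
      using W w that by (auto simp: arrangement_def pairwise_def)
    then show "\<not> lin w dvd p" if "p \<in> ?F" for p
      using that me(1) not_lin_dvd_lin by blast
  qed
  then obtain v where v: "dot w v = 0" "det3 P v n \<noteq> 0" "\<forall>u\<in>W. dot u P \<noteq> 0 \<longrightarrow> dot u v \<noteq> 0"
    using me(2) by auto
  have fin: "finite W" using W by (simp add: arrangement_def)
  have "vcross ((\<Prod>u\<in>{u \<in> W. dot u P \<noteq> 0}. dot u v) *s P) v = 0"
    using r v(1) unfolding radial_def by simp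
  then have "vcross P v = 0" using v(3) fin by simp
  moreover have "det3 P v n = dot (vcross P v) n" by (simp add: det3_def dot_def algebra_simps)
  ultimately show False using v(2) by simp
qed

lemma not_in_span_radial:
  assumes "g \<notin> radial w" "G \<subseteq> radial w"
  shows "g \<notin> S3.span (insert euler G)"
  using assms S3.span_minimal[OF _ radial_subspace, of "insert euler G" w] radialI(1) by blast

section \<open>Arrangements with double and triple points only\<close>

definition triple_config :: "(complex ^ 3) set \<Rightarrow> bool" where
  "triple_config W \<longleftrightarrow> arrangement W \<and> card W = 7 \<and>
     (\<forall>P. P \<noteq> 0 \<longrightarrow> card {w \<in> W. dot w P = 0} \<le> 3)"

text \<open>A triple point is encoded by the set of the three lines through it.\<close>

definition blocks :: "(complex ^ 3) set \<Rightarrow> (complex ^ 3) set set" where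
  "blocks W = {B. B \<subseteq> W \<and> card B = 3 \<and> (\<exists>P. P \<noteq> 0 \<and> (\<forall>w\<in>B. dot w P = 0))}"

lemma triple_configD:
  assumes "triple_config W"
  shows "arrangement W" "finite W" "W \<noteq> {}" "card W = 7" "0 \<notin> W"
    "x \<in> W \<Longrightarrow> y \<in> W \<Longrightarrow> x \<noteq> y \<Longrightarrow> vcross x y \<noteq> 0"
    "P \<noteq> 0 \<Longrightarrow> card {w \<in> W. dot w P = 0} \<le> 3"
  using assms by (auto simp: triple_config_def arrangement_def pairwise_def)

lemma block_eq_lines_through:
  assumes W: "triple_config W" and B: "B \<in> blocks W" and xy: "x \<in> B" "y \<in> B" "x \<noteq> y"
  shows "B = {w \<in> W. dot w (vcross x y) = 0}"
proof (rule card_subset_eq)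
  have sub: "B \<subseteq> W" "card B = 3" using B by (auto simp: blocks_def)
  have v: "vcross x y \<noteq> 0" using triple_configD(6)[OF W] sub xy by blast
  obtain P where P: "P \<noteq> 0" "\<forall>w\<in>B. dot w P = 0" using B by (auto simp: blocks_def)
  obtain c where c: "P = c *s vcross x y" using on_two_lines[OF v] P xy by metis
  then have "c \<noteq> 0" using P by auto
  then have "\<forall>w\<in>B. dot w (vcross x y) = 0" using P(2) c by simp
  then show s: "B \<subseteq> {w \<in> W. dot w (vcross x y) = 0}" using sub by blast
  show f: "finite {w \<in> W. dot w (vcross x y) = 0}" using triple_configD(2)[OF W] by simp
  show "card B = card {w \<in> W. dot w (vcross x y) = 0}"
    using triple_configD(7)[OF W v] sub(2) card_mono[OF f s] by simp
qed

text \<open>The pair \<open>p\<close> of labels stands for the intersection of the two lines.\<close>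

definition passes :: "nat set set \<Rightarrow> nat \<Rightarrow> nat \<times> nat \<Rightarrow> bool" where
  "passes T k p \<longleftrightarrow> k = fst p \<or> k = snd p \<or> {fst p, snd p, k} \<in> T"

text \<open>Incidences are computed on the labels \<open>0,\<dots>,6\<close> of the lines, where they are decidable; \<open>T\<close> consists of
  the labels of the triple points.\<close>

definition labelled :: "(complex ^ 3) set \<Rightarrow> (nat \<Rightarrow> complex ^ 3) \<Rightarrow> nat set set \<Rightarrow> bool" where
  "labelled W h T \<longleftrightarrow> triple_config W \<and> bij_betw h {0..<7} W \<and> T \<subseteq> Pow {0..<7} \<and>
     blocks W = (`) h ` T"

definition two_labels :: "nat \<times> nat \<Rightarrow> bool" where
  "two_labels p \<longleftrightarrow> fst p < 7 \<and> snd p < 7 \<and> fst p \<noteq> snd p"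

definition pt :: "(nat \<Rightarrow> complex ^ 3) \<Rightarrow> nat \<times> nat \<Rightarrow> complex ^ 3" where
  "pt h p = vcross (h (fst p)) (h (snd p))"

lemma labelledD:
  assumes "labelled W h T"
  shows "triple_config W" "W = h ` {0..<7}" "i < 7 \<Longrightarrow> h i \<in> W"
    "i < 7 \<Longrightarrow> j < 7 \<Longrightarrow> h i = h j \<longleftrightarrow> i = j"
    "B \<in> T \<Longrightarrow> h ` B \<in> blocks W" "B \<in> T \<Longrightarrow> B \<subseteq> {0..<7}"
  using assms by (auto simp: labelled_def bij_betw_def inj_on_eq_iff)

lemma labelled_block_iff:
  assumes L: "labelled W h T" and B: "B \<subseteq> {0..<7}"
  shows "h ` B \<in> blocks W \<longleftrightarrow> B \<in> T"
proof
  assume "h ` B \<in> blocks W"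
  then obtain B' where "B' \<in> T" "h ` B = h ` B'" using L by (auto simp: labelled_def)
  moreover have "inj_on h {0..<7}" using L by (auto simp: labelled_def bij_betw_def)
  ultimately show "B \<in> T" using labelledD(6)[OF L] B by (metis inj_on_image_eq_iff)
qed (rule labelledD(5)[OF L])

lemma pt_nonzero:
  assumes L: "labelled W h T" and p: "two_labels p"
  shows "pt h p \<noteq> 0"
  using triple_configD(6)[OF labelledD(1)[OF L]] labelledD(3,4)[OF L] p
  by (auto simp: two_labels_def pt_def)

lemma passes_iff:
  assumes L: "labelled W h T" and p: "two_labels p" and k: "k < 7"
  shows "dot (h k) (pt h p) = 0 \<longleftrightarrow> passes T k p"
proof
  let ?i = "fst p" and ?j = "snd p"
  have ij: "?i < 7" "?j < 7" "h ?i \<noteq> h ?j" using p labelledD(4)[OF L] by (auto simp: two_labels_def)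
  assume h: "dot (h k) (pt h p) = 0"
  have "{?i, ?j, k} \<in> T" if "k \<noteq> ?i" "k \<noteq> ?j"
  proof -
    have "h k \<noteq> h ?i" "h k \<noteq> h ?j" using that ij k labelledD(4)[OF L] by auto
    then have "card {h ?i, h ?j, h k} = 3" using ij by auto
    then have "{h ?i, h ?j, h k} \<in> blocks W"
      using h ij k pt_nonzero[OF L p] labelledD(3)[OF L]
      by (auto simp: blocks_def pt_def intro!: exI[of _ "pt h p"])
    then show ?thesis using labelled_block_iff[OF L, of "{?i, ?j, k}"] ij k by simp
  qed
  then show "passes T k p" unfolding passes_def by blast
next
  assume "passes T k p"
  then consider "k = fst p" | "k = snd p" | "{fst p, snd p, k} \<in> T" unfolding passes_def by blast
  then show "dot (h k) (pt h p) = 0"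
  proof cases
    case 3
    have "h (fst p) \<noteq> h (snd p)" using p labelledD(4)[OF L] by (auto simp: two_labels_def)
    then show ?thesis
      using block_eq_lines_through[OF labelledD(1)[OF L] labelledD(5)[OF L 3], of "h (fst p)" "h (snd p)"]
      by (auto simp: pt_def)
  qed (auto simp: pt_def)
qed

lemma block_of_pt:
  assumes L: "labelled W h T" and p: "two_labels p" and B: "B \<in> T" "fst p \<in> B" "snd p \<in> B"
  shows "h ` B = {w \<in> W. dot w (pt h p) = 0}"
  unfolding pt_def
  by (rule block_eq_lines_through[OF labelledD(1)[OF L] labelledD(5)[OF L B(1)]])
     (use p B labelledD(4)[OF L] in \<open>auto simp: two_labels_def\<close>)

text \<open>The side conditions of adding the lines of a list one after the other, in terms of the labels:
  when a line is added, the only triple point that it may create is the one chosen on it.\<close>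

fun peel :: "nat set set \<Rightarrow> (nat \<times> nat) set \<Rightarrow> nat set \<Rightarrow> (nat \<times> (nat \<times> nat)) list \<Rightarrow> bool" where
  "peel T PP V [] \<longleftrightarrow> True"
| "peel T PP V ((w, p) # r) \<longleftrightarrow> w < 7 \<and> w \<notin> V \<and> p \<in> PP \<and> passes T w p \<and> (\<exists>u\<in>V. passes T u p) \<and>
     (\<forall>B\<in>T. w \<in> B \<longrightarrow> B \<subseteq> insert w V \<longrightarrow> fst p \<in> B \<and> snd p \<in> B) \<and> peel T PP (insert w V) r"

lemma spanned_peel:
  assumes L: "labelled W h T" and PP: "\<And>p. p \<in> PP \<Longrightarrow> two_labels p"
    and "V \<subseteq> {0..<7}" "spanned (h ` V) (pt h ` PP)" "peel T PP V r"
  shows "spanned (h ` (V \<union> set (map fst r))) (pt h ` PP)"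
  using assms(3-5)
proof (induction r arbitrary: V)
  case Nil
  then show ?case by simp
next
  case (Cons wp r)
  obtain w p where wp: "wp = (w, p)" by (cases wp)
  have W: "triple_config W" by (rule labelledD(1)[OF L])
  from Cons.prems(3) obtain u0 where h: "w < 7" "w \<notin> V" "p \<in> PP" "passes T w p"
    "u0 \<in> V" "passes T u0 p"
    "\<And>B. B \<in> T \<Longrightarrow> w \<in> B \<Longrightarrow> B \<subseteq> insert w V \<Longrightarrow> fst p \<in> B \<and> snd p \<in> B"
    "peel T PP (insert w V) r"
    unfolding wp by auto
  have p: "two_labels p" using PP h(3) .
  have V: "insert w V \<subseteq> {0..<7}" using Cons.prems(1) h(1) by auto
  then have hV: "h ` insert w V \<subseteq> W" using labelledD(2)[OF L] by blast
  have "spanned (insert (h w) (h ` V)) (pt h ` PP)"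
  proof (rule spanned_insert[where P = "pt h p" and ?u0.0 = "h u0"])
    show "arrangement (insert (h w) (h ` V))"
      using triple_configD(1)[OF W] hV finite_subset[OF hV]
      by (auto simp: arrangement_def pairwise_def)
    show "h w \<notin> h ` V" using labelledD(4)[OF L] h(1,2) V by auto
    show "pt h p \<noteq> 0" using pt_nonzero[OF L p] .
    show "dot (h w) (pt h p) = 0" "dot (h u0) (pt h p) = 0"
      using passes_iff[OF L p] h V by auto
    show "det3 (h w) x x' \<noteq> 0"
      if x: "x \<in> h ` V" "x' \<in> h ` V" "x \<noteq> x'" "dot x (pt h p) \<noteq> 0" for x x'
    proof
      assume d: "det3 (h w) x x' = 0"
      obtain u u' where u: "u \<in> V" "u' \<in> V" "x = h u" "x' = h u'" using x by blast
      then have u7: "u < 7" "u' < 7" "u \<noteq> u'" using V x(3) by auto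
      have "passes T w (u, u')"
        using passes_iff[OF L, of "(u, u')" w] u u7 h(1) d by (simp add: det3_def two_labels_def pt_def)
      then have b: "{u, u', w} \<in> T"
        using h(2) u by (auto simp: passes_def)
      then have "fst p \<in> {u, u', w} \<and> snd p \<in> {u, u', w}"
        using h(7)[OF b] u by auto
      then have "h ` {u, u', w} = {x \<in> W. dot x (pt h p) = 0}"
        using block_of_pt[OF L p b] by blast
      then show False using x(4) u by auto
    qed
  qed (use h Cons.prems(2) in auto)
  then have "spanned (h ` (insert w V \<union> set (map fst r))) (pt h ` PP)"
    using Cons.IH[of "insert w V"] V h(8) by simp
  then show ?case by (simp add: wp)
qed

text \<open>A certificate that the derivations attached to the points \<open>ps\<close> generate: a first line
  with two of the points on it, and an order in which the other lines are added.\<close>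

definition peeling :: "nat set set \<Rightarrow> (nat \<times> nat) list \<Rightarrow> nat \<Rightarrow> nat \<times> nat \<Rightarrow> nat \<times> nat \<Rightarrow>
    (nat \<times> (nat \<times> nat)) list \<Rightarrow> bool" where
  "peeling T ps a p q r \<longleftrightarrow> (\<forall>p\<in>set ps. two_labels p) \<and> p \<in> set ps \<and> q \<in> set ps \<and> a < 7 \<and> passes T a p \<and> passes T a q \<and>
     (\<exists>u\<in>{0..<7}. passes T u p \<and> \<not> passes T u q) \<and> peel T (set ps) {a} r"

lemma spanned_by_peeling:
  assumes L: "labelled W h T" and c: "peeling T ps a p q r" and V: "set (a # map fst r) = V"
  shows "spanned (h ` V) (pt h ` set ps)"
proof -
  have ps: "\<And>p. p \<in> set ps \<Longrightarrow> two_labels p" and pq: "p \<in> set ps" "q \<in> set ps" and a: "a < 7"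
    and on: "passes T a p" "passes T a q" and r: "peel T (set ps) {a} r"
    using c by (auto simp: peeling_def)
  obtain u where u: "u < 7" "passes T u p" "\<not> passes T u q" using c by (auto simp: peeling_def)
  have lt: "two_labels p" "two_labels q" using ps pq by auto
  have "vcross (pt h p) (pt h q) \<noteq> 0"
  proof
    assume "vcross (pt h p) (pt h q) = 0"
    then obtain c where c: "pt h p = c *s pt h q"
      using vcross_eq_0_iff pt_nonzero[OF L lt(2)] by blast
    then have "c \<noteq> 0" using pt_nonzero[OF L lt(1)] by auto
    moreover have "dot (h u) (pt h p) = 0" "dot (h u) (pt h q) \<noteq> 0"
      using passes_iff[OF L] lt u by auto
    ultimately show False using c by simp
  qed
  moreover have "dot (h a) (pt h p) = 0" "dot (h a) (pt h q) = 0" using passes_iff[OF L] lt a on by auto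
  moreover have "h a \<noteq> 0" using triple_configD(5)[OF labelledD(1)[OF L]] labelledD(3)[OF L a] by auto
  ultimately have "spanned {h a} (pt h ` set ps)"
    using pq by (intro spanned_single[where P = "pt h p" and Q = "pt h q"]) auto
  then have "spanned (h ` ({a} \<union> set (map fst r))) (pt h ` set ps)"
    using r a ps by (intro spanned_peel[OF L]) auto
  moreover have "{a} \<union> set (map fst r) = V" using V by simp
  ultimately show ?thesis by (simp only:)
qed

lemma homogeneous_pder_pt:
  assumes L: "labelled W h T" and p: "two_labels p"
  shows "homogeneous_rel (pder W (pt h p)) (if \<exists>B\<in>T. fst p \<in> B \<and> snd p \<in> B then 4 else 5)"
proof -
  have W: "triple_config W" by (rule labelledD(1)[OF L])
  have fin: "finite W" and c7: "card W = 7" using triple_configD[OF W] by auto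
  have "{w \<in> W. dot w (pt h p) \<noteq> 0} = W - {w \<in> W. dot w (pt h p) = 0}" by auto
  then have c: "card {w \<in> W. dot w (pt h p) \<noteq> 0} = 7 - card {w \<in> W. dot w (pt h p) = 0}"
    using fin c7 by (simp add: card_Diff_subset)
  have "card {w \<in> W. dot w (pt h p) = 0} = (if \<exists>B\<in>T. fst p \<in> B \<and> snd p \<in> B then 3 else 2)"
  proof (cases "\<exists>B\<in>T. fst p \<in> B \<and> snd p \<in> B")
    case True
    then obtain B where B: "B \<in> T" "fst p \<in> B" "snd p \<in> B" by blast
    then have "card (h ` B) = 3" using labelledD(5)[OF L] by (auto simp: blocks_def)
    then show ?thesis using block_of_pt[OF L p B] True by simp
  next
    case False
    have "passes T k p \<longleftrightarrow> k \<in> {fst p, snd p}" for k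
      using False unfolding passes_def by blast
    then have "dot (h k) (pt h p) = 0 \<longleftrightarrow> k \<in> {fst p, snd p}" if "k < 7" for k
      using passes_iff[OF L p that] by blast
    then have "{w \<in> W. dot w (pt h p) = 0} = h ` {fst p, snd p}"
      using labelledD(2)[OF L] p by (auto simp: two_labels_def)
    moreover have "card (h ` {fst p, snd p}) = 2"
      using p labelledD(4)[OF L] by (auto simp: two_labels_def)
    ultimately show ?thesis using False by simp
  qed
  then show ?thesis
    using homogeneous_pder[of W "pt h p"] c by (auto split: if_splits)
qed

text \<open>A submodule as in this definition shows that \<open>g\<close> is not a combination of the other elements
  of \<open>G\<close> and the Euler derivation.\<close>

definition separable :: "(S ^ 3) set \<Rightarrow> S ^ 3 \<Rightarrow> bool" where
  "separable G g \<longleftrightarrow> (\<exists>U. S3.subspace U \<and> euler \<in> U \<and> g \<notin> U \<and> (\<forall>k\<in>G. k \<noteq> g \<longrightarrow> k \<in> U))"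

lemma has_exponents_sep:
  assumes W: "arrangement W" "W \<noteq> {}" and A: "AR (defining_poly A) = AR (form W)"
    and G: "set gs \<subseteq> logder W" "distinct gs"
    and gen: "logder W \<subseteq> S3.span (insert euler (set gs))"
    and hom: "list_all2 homogeneous_rel gs es" "\<forall>e\<in>set es. e > 0" "sorted es"
    and sep: "\<And>g. g \<in> set gs \<Longrightarrow> separable (set gs) g"
  shows "has_exponents A es"
proof (rule has_exponents_from_logder[OF W A G gen hom])
  fix g assume "g \<in> set gs"
  then obtain U where U: "S3.subspace U" "euler \<in> U" "g \<notin> U" "\<forall>h\<in>set gs. h \<noteq> g \<longrightarrow> h \<in> U"
    using sep unfolding separable_def by blast
  then have "S3.span (insert euler (set gs - {g})) \<subseteq> U"
    by (intro S3.span_minimal) auto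
  then show "g \<notin> S3.span (insert euler (set gs - {g}))" using U(3) by blast
qed

definition point_degrees :: "nat set set \<Rightarrow> (nat \<times> nat) list \<Rightarrow> nat list" where
  "point_degrees T ps = map (\<lambda>p. if \<exists>B\<in>T. fst p \<in> B \<and> snd p \<in> B then 4 else 5) ps"

lemma point_degrees_pos: "\<forall>e\<in>set (point_degrees T ps). 0 < e"
  unfolding point_degrees_def by (induction ps) simp_all

lemma has_exponents_points_sep:
  assumes L: "labelled W h T" and A: "AR (defining_poly A) = AR (form W)"
    and pe: "peeling T ps a p q r" and V: "set (a # map fst r) = {0..<7}" and d: "distinct ps"
    and s: "\<And>p. p \<in> set ps \<Longrightarrow> \<exists>U. S3.subspace U \<and> euler \<in> U \<and> pder W (pt h p) \<notin> U \<and>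
      (\<forall>q\<in>set ps. q \<noteq> p \<longrightarrow> pder W (pt h q) \<in> U)"
    and es: "point_degrees T ps = es" "sorted es"
  shows "has_exponents A es"
proof -
  let ?g = "\<lambda>p. pder W (pt h p)"
  have W: "triple_config W" by (rule labelledD(1)[OF L])
  have fin: "finite W" using triple_configD[OF W] by auto
  have ps: "two_labels p" if "p \<in> set ps" for p using pe that by (simp add: peeling_def)
  have inj: "inj_on ?g (set ps)"
  proof (rule inj_onI, rule ccontr)
    fix p q assume pq: "p \<in> set ps" "q \<in> set ps" "?g p = ?g q" "p \<noteq> q"
    from s[OF pq(1)] obtain U where U: "?g p \<notin> U" "\<forall>q\<in>set ps. q \<noteq> p \<longrightarrow> ?g q \<in> U" by blast
    have "?g q \<in> U" using bspec[OF U(2) pq(2)] pq(4) by (metis (no_types))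
    then show False using U(1) pq(3) by (metis (no_types))
  qed
  show ?thesis
  proof (rule has_exponents_sep[OF triple_configD(1,3)[OF W] A, where gs = "map ?g ps"])
    show "distinct (map ?g ps)" using d inj by (simp add: distinct_map)
    show "set (map ?g ps) \<subseteq> logder W" using fin by (auto intro: pder_logder)
    show "logder W \<subseteq> S3.span (insert euler (set (map ?g ps)))"
      using spanned_by_peeling[OF L pe V] labelledD(2)[OF L] by (simp add: spanned_def image_image)
    show "list_all2 homogeneous_rel (map ?g ps) es"
      using homogeneous_pder_pt[OF L] ps
      by (auto simp: es(1)[symmetric] point_degrees_def list_all2_conv_all_nth)
    show "\<forall>e\<in>set es. 0 < e" unfolding es(1)[symmetric] by (rule point_degrees_pos)
    show "sorted es" by (rule es(2))
    show "separable (set (map ?g ps)) g"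
      if "g \<in> set (map ?g ps)" for g
    proof -
      have "\<exists>p\<in>set ps. g = ?g p" using that by auto
      then obtain p where p: "p \<in> set ps" "g = ?g p" by blast
      from s[OF p(1)] obtain U where U: "S3.subspace U" "euler \<in> U" "?g p \<notin> U"
        "\<forall>q\<in>set ps. q \<noteq> p \<longrightarrow> ?g q \<in> U" by blast
      then have "\<forall>h\<in>set (map ?g ps). h \<noteq> g \<longrightarrow> h \<in> U" using p(2) by auto
      then show ?thesis using p(2) U(1-3) unfolding separable_def by blast
    qed
  qed
qed

text \<open>A point that lies on a line missing all other chosen points cannot be dispensed with.\<close>

definition separating_line :: "nat set set \<Rightarrow> (nat \<times> nat) list \<Rightarrow> nat \<times> nat \<Rightarrow> bool" where
  "separating_line T ps p \<longleftrightarrow>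
     (\<exists>w\<in>{0..<7}. passes T w p \<and> (\<forall>q\<in>set ps. q \<noteq> p \<longrightarrow> \<not> passes T w q))"

lemma separating_line_imp:
  assumes L: "labelled W h T" and ps: "\<And>p. p \<in> set ps \<Longrightarrow> two_labels p" and p: "p \<in> set ps"
    and sep: "separating_line T ps p"
  shows "\<exists>U. S3.subspace U \<and> euler \<in> U \<and> pder W (pt h p) \<notin> U \<and>
      (\<forall>q\<in>set ps. q \<noteq> p \<longrightarrow> pder W (pt h q) \<in> U)"
proof -
  have W: "triple_config W" by (rule labelledD(1)[OF L])
  have fin: "finite W" using triple_configD[OF W] by auto
  obtain w where w: "w < 7" "passes T w p" "\<forall>q\<in>set ps. q \<noteq> p \<longrightarrow> \<not> passes T w q"
    using sep unfolding separating_line_def by (meson atLeastLessThan_iff)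
  have "dot (h w) (pt h p) = 0" using passes_iff[OF L] ps[OF p] w by auto
  then have "pder W (pt h p) \<notin> radial (h w)"
    using pder_not_radial[OF triple_configD(1)[OF W] labelledD(3)[OF L w(1)]]
      pt_nonzero[OF L ps[OF p]] by blast
  moreover have "pder W (pt h q) \<in> radial (h w)" if "q \<in> set ps" "q \<noteq> p" for q
    using passes_iff[OF L] ps that w fin labelledD(3)[OF L w(1)] by simp
  ultimately show ?thesis using radial_subspace[of "h w"] radialI(1)[of "h w"] by blast
qed

lemma has_exponents_points:
  assumes L: "labelled W h T" and A: "AR (defining_poly A) = AR (form W)"
    and pe: "peeling T ps a p q r" and V: "set (a # map fst r) = {0..<7}" and sep: "distinct ps \<and> list_all (separating_line T ps) ps"
    and es: "point_degrees T ps = es" "sorted es"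
  shows "has_exponents A es"
proof (rule has_exponents_points_sep[OF L A pe V _ _ es])
  have ps: "two_labels p" if "p \<in> set ps" for p using pe that by (simp add: peeling_def)
  show "\<exists>U. S3.subspace U \<and> euler \<in> U \<and> pder W (pt h p) \<notin> U \<and>
      (\<forall>q\<in>set ps. q \<noteq> p \<longrightarrow> pder W (pt h q) \<in> U)" if "p \<in> set ps" for p
    using separating_line_imp[OF L ps that] that sep by (auto simp: list_all_iff)
qed (use sep in simp)

text \<open>Determinants with two fixed fields are linear in the third.  Requiring a quotient of such a
  determinant to vanish at a point \<open>v0\<close> therefore defines a submodule.\<close>

lemma subspace_det:
  assumes "\<And>\<theta> \<phi>. F (\<theta> + \<phi>) = F \<theta> + F \<phi>" "\<And>p \<theta>. F (p *s \<theta>) = p * F \<theta>" "F 0 = 0"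
  shows "S3.subspace {\<theta>. \<exists>g. F \<theta> = m * g \<and> eval_at g v0 = 0}"
  unfolding S3.subspace_def
proof (intro conjI ballI allI)
  show "0 \<in> {\<theta>. \<exists>g. F \<theta> = m * g \<and> eval_at g v0 = 0}"
    using assms(3) by (intro CollectI exI[of _ 0]) simp
next
  fix a b assume "a \<in> {\<theta>. \<exists>g. F \<theta> = m * g \<and> eval_at g v0 = 0}" "b \<in> {\<theta>. \<exists>g. F \<theta> = m * g \<and> eval_at g v0 = 0}"
  then obtain g g' where "F a = m * g" "eval_at g v0 = 0" "F b = m * g'" "eval_at g' v0 = 0" by blast
  then show "a + b \<in> {\<theta>. \<exists>g. F \<theta> = m * g \<and> eval_at g v0 = 0}"
    by (intro CollectI exI[of _ "g + g'"]) (simp add: assms(1) distrib_left)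
next
  fix p a assume "a \<in> {\<theta>. \<exists>g. F \<theta> = m * g \<and> eval_at g v0 = 0}"
  then obtain g where "F a = m * g" "eval_at g v0 = 0" by blast
  then show "p *s a \<in> {\<theta>. \<exists>g. F \<theta> = m * g \<and> eval_at g v0 = 0}"
    by (intro CollectI exI[of _ "p * g"]) (simp add: assms(2) ac_simps)
qed

lemma sdet_linear:
  "sdet (\<theta> + \<theta>') \<phi> \<eta> = sdet \<theta> \<phi> \<eta> + sdet \<theta>' \<phi> \<eta>"
  "sdet (p *s \<theta>) \<phi> \<eta> = p * sdet \<theta> \<phi> \<eta>" "sdet 0 \<phi> \<eta> = 0"
  by (rule S_eqI; simp add: det3_linear)+

lemma pder_labelled:
  assumes L: "labelled W h T" and p: "two_labels p" and V: "V \<subseteq> {0..<7}" and K: "{k \<in> V. \<not> passes T k p} = K"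
  shows "pder (h ` V) (pt h p) = (\<Prod>k\<in>K. lin (h k)) *s cvec (pt h p)"
proof -
  have "{w \<in> h ` V. dot w (pt h p) \<noteq> 0} = h ` K"
    using passes_iff[OF L p] V K by auto
  moreover have "inj_on h K"
  proof (rule inj_on_subset)
    show "inj_on h {0..<7}" using L by (auto simp: labelled_def bij_betw_def)
    show "K \<subseteq> {0..<7}" using K V by blast
  qed
  ultimately show ?thesis by (simp add: pder_def prod.reindex)
qed

text \<open>With two triple points on no common line of the arrangement, every line through the point
  \<open>(0,3)\<close> passes through another chosen point.  That point is needed because of the local
  structure at the triple point \<open>Q = (3,4)\<close>: among the chosen generators, its derivation is the
  only one whose determinant with \<open>Q\<close> and the Euler derivation, divided by the equations of
  the lines through \<open>Q\<close>, does not vanish at \<open>Q\<close>.\<close>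

lemma two_triple_points_disjoint:
  assumes L: "labelled W h {{0,1,2},{3,4,5}}" and A: "AR (defining_poly A) = AR (form W)"
  shows "has_exponents A [4,4,5,5]"
proof -
  let ?T = "{{0,1,2},{3,4,5}} :: nat set set"
  let ?ps = "[(0,1),(3,4),(0,3),(0,6)] :: (nat \<times> nat) list"
  define Q where "Q = pt h (3,4)"
  define l where "l k = lin (h k)" for k
  define U where "U = {\<theta>. \<exists>g. sdet \<theta> (cvec Q) euler = l 3 * l 4 * l 5 * g \<and> eval_at g Q = 0}"
  have pe: "peeling ?T ?ps 0 (0,1) (0,3)
      [(1,(0,1)),(2,(0,1)),(3,(0,3)),(4,(3,4)),(5,(3,4)),(6,(0,6))]"
    by code_simp
  have "\<forall>p\<in>set ?ps. two_labels p" by code_simp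
  then have ps: "two_labels p" if "p \<in> set ?ps" for p using that by blast
  have pd: "pder W (pt h p) = (\<Prod>k\<in>K. l k) *s cvec (pt h p)"
    if "{k \<in> {0..<7}. \<not> passes ?T k p} = K" "p \<in> set ?ps" for p K
    unfolding l_def using pder_labelled[OF L ps[OF that(2)] _ that(1)] labelledD(2)[OF L] by simp
  have "{k \<in> {0..<7}. \<not> passes ?T k (0,1)} = {3,4,5,6}" by code_simp
  from pd[OF this] have P1: "pder W (pt h (0,1)) = (l 3 * l 4 * l 5 * l 6) *s cvec (pt h (0,1))"
    by (simp add: mult.assoc)
  have "{k \<in> {0..<7}. \<not> passes ?T k (3,4)} = {0,1,2,6}" by code_simp
  from pd[OF this] have P2: "pder W (pt h (3,4)) = (l 0 * l 1 * l 2 * l 6) *s cvec (pt h (3,4))"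
    by (simp add: mult.assoc)
  have "{k \<in> {0..<7}. \<not> passes ?T k (0,3)} = {1,2,4,5,6}" by code_simp
  from pd[OF this] have P3: "pder W (pt h (0,3)) = (l 1 * l 2 * l 4 * l 5 * l 6) *s cvec (pt h (0,3))"
    by (simp add: mult.assoc)
  have "{k \<in> {0..<7}. \<not> passes ?T k (0,6)} = {1,2,3,4,5}" by code_simp
  from pd[OF this] have P4: "pder W (pt h (0,6)) = (l 1 * l 2 * l 3 * l 4 * l 5) *s cvec (pt h (0,6))"
    by (simp add: mult.assoc)
  have sd: "sdet (p *s cvec X) (cvec Q) euler = p * lin (vcross X Q)" for p X
    by (rule S_eqI) (simp add: det3_linear, simp add: det3_eq_dot)
  have U: "S3.subspace U"
    unfolding U_def by (rule subspace_det) (simp_all add: sdet_linear)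
  have UI: "x \<in> U" if "sdet x (cvec Q) euler = l 3 * l 4 * l 5 * g" "eval_at g Q = 0" for x g
    using that unfolding U_def by blast
  have vQ: "dot (vcross X Q) Q = 0" for X by (simp add: dot_def algebra_simps)
  have "pder W (pt h (0,1)) \<in> U"
  proof (rule UI)
    show "sdet (pder W (pt h (0,1))) (cvec Q) euler
        = l 3 * l 4 * l 5 * (l 6 * lin (vcross (pt h (0,1)) Q))"
      unfolding P1 sd by (simp only: ac_simps)
  qed (simp add: vQ)
  moreover have "pder W (pt h (0,6)) \<in> U"
  proof (rule UI)
    show "sdet (pder W (pt h (0,6))) (cvec Q) euler
        = l 3 * l 4 * l 5 * (l 1 * l 2 * lin (vcross (pt h (0,6)) Q))"
      unfolding P4 sd by (simp only: ac_simps)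
  qed (simp add: vQ)
  moreover have "pder W (pt h (3,4)) \<in> U"
  proof (rule UI)
    show "sdet (pder W (pt h (3,4))) (cvec Q) euler = l 3 * l 4 * l 5 * 0"
      unfolding P2 sd by (simp add: Q_def)
  qed simp
  moreover have "euler \<in> U"
  proof -
    have "sdet euler (cvec Q) euler = 0" by (rule S_eqI) simp
    then show ?thesis by (auto simp: U_def intro!: exI[of _ 0])
  qed
  moreover have "pder W (pt h (0,3)) \<notin> U"
  proof
    let ?X = "pt h (0,3)"
    assume "pder W ?X \<in> U"
    then obtain g where g: "l 1 * l 2 * l 4 * l 5 * l 6 * lin (vcross ?X Q) = l 3 * l 4 * l 5 * g"
      "eval_at g Q = 0"
      unfolding U_def P3 mem_Collect_eq sd by blast
    have hk: "h k \<noteq> 0" if "k < 7" for k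
      using triple_configD(5)[OF labelledD(1)[OF L]] labelledD(3)[OF L that] by auto
    have q: "dot (h k) Q = 0 \<longleftrightarrow> k \<in> {3,4,5}" if "k < 7" for k
      using passes_iff[OF L ps that, of "(3,4)"] by (auto simp: Q_def passes_def set_eq_subset)
    have X: "?X \<noteq> 0" "Q \<noteq> 0" using pt_nonzero[OF L] ps by (auto simp: Q_def)
    have "dot (h 4) ?X \<noteq> 0"
      using passes_iff[OF L ps, of "(0,3)" 4] by (auto simp: passes_def set_eq_subset)
    then have nz: "vcross ?X Q \<noteq> 0"
    proof (rule contrapos_nn)
      assume "vcross ?X Q = 0"
      then obtain c where "?X = c *s Q" using vcross_eq_0_iff[OF X(2), of ?X] by blast
      then show "dot (h 4) ?X = 0" using q[of 4] by simp
    qed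
    have "dot (h 3) ?X = 0" by (simp add: pt_def)
    moreover have "dot (h 3) Q = 0" using q[of 3] by simp
    ultimately have "dot ?X (h 3) = 0" "dot Q (h 3) = 0" by (simp_all only: dot_commute[of "h 3"])
    then obtain c where "h 3 = c *s vcross ?X Q" using on_two_lines[OF nz] by blast
    then have l3: "l 3 = cst c * lin (vcross ?X Q)" unfolding l_def by (simp add: lin_scale)
    have "l 4 * l 5 * lin (vcross ?X Q) * (l 1 * l 2 * l 6) = l 4 * l 5 * lin (vcross ?X Q) * (cst c * g)"
      using g(1) by (simp add: l3 algebra_simps)
    moreover have "l 4 * l 5 * lin (vcross ?X Q) \<noteq> 0"
      using hk nz by (simp add: l_def)
    ultimately have "l 1 * l 2 * l 6 = cst c * g" by (metis mult_cancel_left)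
    then have "eval_at (l 1 * l 2 * l 6) Q = 0" using g(2) by simp
    then show False using q[of 1] q[of 2] q[of 6] by (simp add: l_def)
  qed
  ultimately have sepT: "\<exists>U. S3.subspace U \<and> euler \<in> U \<and> pder W (pt h (0,3)) \<notin> U \<and>
      (\<forall>q\<in>set ?ps. q \<noteq> (0,3) \<longrightarrow> pder W (pt h q) \<in> U)"
    using U by (intro exI[of _ U]) auto
  have "list_all (separating_line ?T ?ps) [(0,1),(3,4),(0,6)]" by code_simp
  then have sep: "separating_line ?T ?ps p" if "p \<in> set ?ps" "p \<noteq> (0,3)" for p
    using that by (auto simp: list_all_iff)
  show ?thesis
  proof (rule has_exponents_points_sep[OF L A pe])
    show "\<exists>U. S3.subspace U \<and> euler \<in> U \<and> pder W (pt h p) \<notin> U \<and>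
      (\<forall>q\<in>set ?ps. q \<noteq> p \<longrightarrow> pder W (pt h q) \<in> U)" if "p \<in> set ?ps" for p
      using sepT separating_line_imp[OF L ps that] sep[OF that] by (cases "p = (0,3)") simp_all
  qed (code_simp | simp)+
qed

lemma mdr_points:
  assumes L: "labelled W h T" and A: "AR f = AR (form W)"
    and pe: "peeling T ps a p q r" and V: "set (a # map fst r) = {0..<7}" and deg: "\<And>p. p \<in> set ps \<Longrightarrow> \<exists>B\<in>T. fst p \<in> B \<and> snd p \<in> B"
  shows "mdr f = 4"
proof -
  have W: "triple_config W" by (rule labelledD(1)[OF L])
  have ps: "two_labels p" if "p \<in> set ps" for p using pe that by (simp add: peeling_def)
  have p: "p \<in> set ps" "passes T a p" "a < 7" using pe by (simp_all add: peeling_def)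
  show ?thesis
  proof (rule mdr_eqI[OF triple_configD(1,3)[OF W], where G = "pder W ` pt h ` set ps" and g = "pder W (pt h p)"])
    show "pder W ` pt h ` set ps \<subseteq> logder W"
      using triple_configD(2)[OF W] by (auto intro: pder_logder)
    show "logder W \<subseteq> S3.span (insert euler (pder W ` pt h ` set ps))"
      using spanned_by_peeling[OF L pe V] labelledD(2)[OF L] by (simp add: spanned_def)
    show "homogeneous_rel g 4" if "g \<in> pder W ` pt h ` set ps" for g
      using that homogeneous_pder_pt[OF L ps] deg by auto
    have "dot (h a) (pt h p) = 0" using passes_iff[OF L] ps p by auto
    then have "pder W (pt h p) \<notin> radial (h a)"
      using pder_not_radial[OF triple_configD(1)[OF W] labelledD(3)[OF L p(3)]]
        pt_nonzero[OF L ps[OF p(1)]] by blast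
    then show "pder W (pt h p) \<notin> S3.span {euler}"
      using not_in_span_radial[of _ "h a" "{}"] by simp
  qed (use p A in auto)
qed

text \<open>In the following cases the witnesses are the chosen points, the first line with two of these points, and
  the other lines in the order of addition, each with the point that carries its new generator.\<close>

lemma one_triple_point:
  assumes "labelled W h {{0,1,2}}" "AR (defining_poly A) = AR (form W)"
  shows "has_exponents A [4,5,5,5,5]"
  by (rule has_exponents_points[OF assms, of "[(0,1),(0,3),(0,4),(0,5),(0,6)]" 0 "(0,1)" "(0,3)"
        "[(1,(0,1)),(2,(0,1)),(3,(0,3)),(4,(0,4)),(5,(0,5)),(6,(0,6))]"]; code_simp)

lemma two_triple_points_joined:
  assumes "labelled W h {{0,1,2},{0,3,4}}" "AR (defining_poly A) = AR (form W)"
  shows "has_exponents A [4,4,5,5]"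
  by (rule has_exponents_points[OF assms, of "[(0,1),(0,3),(0,5),(0,6)]" 0 "(0,1)" "(0,3)"
        "[(1,(0,1)),(2,(0,1)),(3,(0,3)),(4,(0,3)),(5,(0,5)),(6,(0,6))]"]; code_simp)

lemma three_triple_points_triangle:
  assumes "labelled W h {{0,1,2},{0,3,4},{1,3,5}}" "AR (defining_poly A) = AR (form W)"
  shows "has_exponents A [4,4,4,5]"
  by (rule has_exponents_points[OF assms, of "[(0,1),(0,3),(1,3),(0,6)]" 0 "(0,1)" "(0,3)"
        "[(1,(0,1)),(3,(0,3)),(2,(0,1)),(4,(0,3)),(5,(1,3)),(6,(0,6))]"]; code_simp)

lemma three_triple_points_collinear:
  assumes "labelled W h {{0,1,2},{0,3,4},{0,5,6}}" "AR (defining_poly A) = AR (form W)"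
  shows "has_exponents A [4,4,4]"
  by (rule has_exponents_points[OF assms, of "[(0,1),(0,3),(0,5)]" 0 "(0,1)" "(0,3)"
        "[(1,(0,1)),(2,(0,1)),(3,(0,3)),(4,(0,3)),(5,(0,5)),(6,(0,5))]"]; code_simp)

lemma three_triple_points_path:
  assumes "labelled W h {{0,1,2},{0,3,4},{1,5,6}}" "AR (defining_poly A) = AR (form W)"
  shows "has_exponents A [4,4,4]"
  by (rule has_exponents_points[OF assms, of "[(0,1),(0,3),(1,5)]" 0 "(0,1)" "(0,3)"
        "[(1,(0,1)),(2,(0,1)),(3,(0,3)),(4,(0,3)),(5,(1,5)),(6,(1,5))]"]; code_simp)

text \<open>The first three triple points form a triangle; \<open>(i,j)\<close> runs through the pairs of its six lines that
  meet in a double point.  The seventh line is added last, with the fourth triple point.  All generators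
  have degree \<open>4\<close>.\<close>

lemma four_triple_points_mdr:
  assumes L: "labelled W h {{0,1,2},{0,3,4},{1,3,5},{6,i,j}}" and A: "AR f = AR (form W)"
    and ij: "(i, j) \<in> {(0,5),(1,4),(2,3),(2,4),(2,5),(4,5)}"
  shows "mdr f = 4"
proof (rule mdr_points[OF L A])
  show "peeling {{0,1,2},{0,3,4},{1,3,5},{6,i,j}} [(0,1),(0,3),(1,3),(i,j)] 0 (0,1) (0,3)
    [(1,(0,1)),(3,(0,3)),(2,(0,1)),(4,(0,3)),(5,(1,3)),(6,(i,j))]"
    using ij by (elim insertE emptyE; simp only: prod.inject; elim conjE; hypsubst; code_simp)
qed auto

section \<open>Rescaling and coordinates\<close>

text \<open>In this form the notion visibly depends only on the vanishing of the equations of the lines.\<close>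

lemma labelled_iff:
  "labelled W h T \<longleftrightarrow> W = h ` {0..<7} \<and> T \<subseteq> Pow {0..<7} \<and> (\<forall>i<7. h i \<noteq> 0) \<and>
     (\<forall>i<7. \<forall>j<7. i \<noteq> j \<longrightarrow> vcross (h i) (h j) \<noteq> 0) \<and>
     (\<forall>P. P \<noteq> 0 \<longrightarrow> card {i \<in> {0..<7}. dot (h i) P = 0} \<le> 3) \<and>
     (\<forall>B \<subseteq> {0..<7}. B \<in> T \<longleftrightarrow> card B = 3 \<and> (\<exists>P. P \<noteq> 0 \<and> (\<forall>i\<in>B. dot (h i) P = 0)))"
  (is "?L \<longleftrightarrow> ?R")
proof
  assume L: ?L
  have W: "triple_config W" by (rule labelledD(1)[OF L])
  have inj: "inj_on h {0..<7}" using L by (auto simp: labelled_def bij_betw_def)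
  have "card {i \<in> {0..<7}. dot (h i) P = 0} \<le> 3" if "P \<noteq> 0" for P
  proof -
    have "{w \<in> W. dot w P = 0} = h ` {i \<in> {0..<7}. dot (h i) P = 0}"
      using labelledD(2)[OF L] by auto
    moreover have "inj_on h {i \<in> {0..<7}. dot (h i) P = 0}" using inj by (auto simp: inj_on_def)
    ultimately show ?thesis using triple_configD(7)[OF W that] by (simp add: card_image)
  qed
  moreover have "B \<in> T \<longleftrightarrow> card B = 3 \<and> (\<exists>P. P \<noteq> 0 \<and> (\<forall>i\<in>B. dot (h i) P = 0))"
    if B: "B \<subseteq> {0..<7}" for B
  proof -
    have "inj_on h B" using inj B by (rule inj_on_subset)
    then have "card (h ` B) = card B" by (rule card_image)
    moreover have "h ` B \<subseteq> W" using labelledD(2)[OF L] B by blast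
    ultimately show ?thesis
      using labelled_block_iff[OF L B] by (simp add: blocks_def)
  qed
  ultimately show ?R
    using labelledD[OF L] triple_configD(5,6)[OF W] L
    by (auto simp: labelled_def)
next
  assume R: ?R
  then have W: "W = h ` {0..<7}" and nz: "\<forall>i<7. h i \<noteq> 0"
    and v: "\<And>i j. i < 7 \<Longrightarrow> j < 7 \<Longrightarrow> i \<noteq> j \<Longrightarrow> vcross (h i) (h j) \<noteq> 0"
    and m: "\<And>P. P \<noteq> 0 \<Longrightarrow> card {i \<in> {0..<7}. dot (h i) P = 0} \<le> 3"
    and T: "T \<subseteq> Pow {0..<7}"
      "\<And>B. B \<subseteq> {0..<7} \<Longrightarrow> B \<in> T \<longleftrightarrow> card B = 3 \<and> (\<exists>P. P \<noteq> 0 \<and> (\<forall>i\<in>B. dot (h i) P = 0))"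
    by simp_all
  have inj: "inj_on h {0..<7}"
    using v by (intro inj_onI) (metis atLeastLessThan_iff vcross_self(1))
  have "arrangement W"
  proof -
    have "vcross (h i) (h j) \<noteq> 0" if "i < 7" "j < 7" "h i \<noteq> h j" for i j
      using v[of i j] that by metis
    then show ?thesis using nz by (auto simp: arrangement_def pairwise_def W)
  qed
  moreover have "card W = 7" using inj by (simp add: W card_image)
  moreover have "card {w \<in> W. dot w P = 0} \<le> 3" if "P \<noteq> 0" for P
  proof -
    have "{w \<in> W. dot w P = 0} = h ` {i \<in> {0..<7}. dot (h i) P = 0}"
      using W by auto
    moreover have "inj_on h {i \<in> {0..<7}. dot (h i) P = 0}" using inj by (auto simp: inj_on_def)
    ultimately show ?thesis using m[OF that] by (simp add: card_image)
  qed
  moreover have "blocks W = (`) h ` T"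
  proof (intro equalityI subsetI)
    fix C assume C: "C \<in> blocks W"
    then obtain B where B: "B \<subseteq> {0..<7}" "C = h ` B"
      unfolding blocks_def W by (auto simp: subset_image_iff)
    then have "card B = card C" using inj by (metis card_image inj_on_subset)
    then have "B \<in> T" using T(2)[OF B(1)] C B(2) by (auto simp: blocks_def)
    then show "C \<in> (`) h ` T" using B(2) by blast
  next
    fix C assume "C \<in> (`) h ` T"
    then obtain B where B: "B \<in> T" "C = h ` B" by blast
    then have s: "B \<subseteq> {0..<7}" using T(1) by blast
    then have "card C = card B" using inj B(2) by (metis card_image inj_on_subset)
    then show "C \<in> blocks W" using T(2)[OF s] B s W by (auto simp: blocks_def)
  qed
  ultimately show ?L
    using inj T(1) W by (simp add: labelled_def triple_config_def bij_betw_def)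
qed

text \<open>Multiplying the equations of the lines by nonzero constants changes neither the incidences
  nor the Jacobian relations, so equations can be normalised.\<close>

lemma labelled_scale:
  assumes L: "labelled W h T" and c: "\<And>k. k < 7 \<Longrightarrow> c k \<noteq> 0 \<and> h' k = c k *s h k"
  shows "labelled (h' ` {0..<7}) h' T" "AR (form (h' ` {0..<7})) = AR (form W)"
proof -
  have d: "dot (h' k) P = 0 \<longleftrightarrow> dot (h k) P = 0" if "k < 7" for k P
    using c[OF that] by simp
  have s: "{i \<in> {0..<7}. dot (h' i) P = 0} = {i \<in> {0..<7}. dot (h i) P = 0}" for P
    using d by auto
  have "(\<forall>i\<in>B. dot (h' i) P = 0) \<longleftrightarrow> (\<forall>i\<in>B. dot (h i) P = 0)" if "B \<subseteq> {0..<7}" for B P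
    using d that by (meson atLeastLessThan_iff subsetD)
  moreover have "vcross (h' i) (h' j) = 0 \<longleftrightarrow> vcross (h i) (h j) = 0" if "i < 7" "j < 7" for i j
    using c[OF that(1)] c[OF that(2)] by simp
  moreover have "h' i = 0 \<longleftrightarrow> h i = 0" if "i < 7" for i using c[OF that] by simp
  ultimately show L': "labelled (h' ` {0..<7}) h' T"
    using L unfolding labelled_iff s by simp
  have inj: "inj_on h {0..<7}" "inj_on h' {0..<7}"
    using L L' by (auto simp: labelled_def bij_betw_def)
  have "form (h' ` {0..<7}) = (\<Prod>k\<in>{0..<7}. lin (h' k))"
    by (simp add: form_def prod.reindex[OF inj(2)])
  also have "\<dots> = (\<Prod>k\<in>{0..<7}. cst (c k) * lin (h k))"
    using c by (intro prod.cong) (simp_all add: lin_scale)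
  also have "\<dots> = (\<Prod>k\<in>{0..<7}. cst (c k)) * form W"
    using inj(1) labelledD(2)[OF L] by (simp add: form_def prod.reindex prod.distrib)
  also have "(\<Prod>k\<in>{0..<7}. cst (c k)) = cst (\<Prod>k\<in>{0..<7}. c k)"
    by (rule S_eqI) simp
  finally have f: "form (h' ` {0..<7}) = cst (\<Prod>k\<in>{0..<7}. c k) * form W" .
  have "(\<Prod>k\<in>{0..<7}. c k) \<noteq> 0" using c by simp
  then show "AR (form (h' ` {0..<7})) = AR (form W)"
    unfolding f by (rule AR_cst_mult)
qed

lemma labelled_det3:
  assumes L: "labelled W h T" and ijk: "i < 7" "j < 7" "k < 7" "i \<noteq> j" "i \<noteq> k" "j \<noteq> k"
  shows "det3 (h i) (h j) (h k) = 0 \<longleftrightarrow> {i, j, k} \<in> T"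
proof -
  have "det3 (h i) (h j) (h k) = dot (h k) (pt h (i, j))"
    by (simp add: pt_def det3_def dot_def algebra_simps)
  then show ?thesis
    using passes_iff[OF L, of "(i, j)" k] ijk by (auto simp: two_labels_def passes_def)
qed

lemma labelled_vcross:
  assumes "labelled W h T" "i < 7" "j < 7" "i \<noteq> j"
  shows "vcross (h i) (h j) \<noteq> 0"
  using assms unfolding labelled_iff by blast

lemma add_line_labelled:
  assumes L: "labelled W h T" and V: "w < 7" "V \<subseteq> {0..<7}" "w \<notin> V" "K \<subseteq> V"
    and K: "\<And>k k'. k \<in> K \<Longrightarrow> k' \<in> K \<Longrightarrow> k \<noteq> k' \<Longrightarrow> {w, k, k'} \<notin> T"
    and n: "dot (h w) n = 1" and \<psi>: "\<psi> \<in> logder (h ` insert w V)"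
    and \<gamma>: "\<gamma> \<noteq> 0" "\<And>v. dot (h w) v = 0 \<Longrightarrow> det3 (ev \<psi> v) v n = \<gamma> * (\<Prod>k\<in>K. dot (h k) v)"
    and \<theta>: "\<theta> \<in> logder (h ` insert w V)"
  shows "\<exists>c e \<theta>'. \<theta>' \<in> logder (h ` V) \<and> \<theta> = c *s \<psi> + e *s euler + lin (h w) *s \<theta>'"
proof (rule add_line[where M = "h ` K" and n = n and \<gamma> = \<gamma>])
  have K7: "K \<subseteq> {0..<7}" using V by blast
  have "inj_on h {0..<7}" using L by (auto simp: labelled_def bij_betw_def)
  then have inj: "inj_on h K" using K7 by (rule inj_on_subset)
  show "vcross u (h w) \<noteq> 0" if "u \<in> h ` V" for u
    using that labelled_vcross[OF L] V by (metis atLeastLessThan_iff imageE subsetD)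
  show "vcross (h w) m \<noteq> 0" if "m \<in> h ` K" for m
    using that labelled_vcross[OF L] V by (metis atLeastLessThan_iff imageE subsetD)
  show "det3 (h w) m m' \<noteq> 0" if m: "m \<in> h ` K" "m' \<in> h ` K" "m \<noteq> m'" for m m'
  proof -
    obtain k k' where k: "k \<in> K" "k' \<in> K" "m = h k" "m' = h k'" "k \<noteq> k'" using m by auto
    moreover have "w \<noteq> k" "w \<noteq> k'" "k < 7" "k' < 7" using k V K7 by auto
    ultimately show ?thesis using labelled_det3[OF L V(1), of k k'] K[OF k(1,2,5)] by simp
  qed
  show "\<exists>u\<in>h ` V. \<forall>v. dot (h w) v = 0 \<longrightarrow> dot m v = 0 \<longrightarrow> dot u v = 0" if "m \<in> h ` K" for m
    using that V(4) by blast
  show "det3 (ev \<psi> v) v n = \<gamma> * (\<Prod>m\<in>h ` K. dot m v)" if "dot (h w) v = 0" for v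
    using \<gamma>(2)[OF that] inj by (simp add: prod.reindex)
  show "finite (h ` K)" using finite_subset[OF K7] by simp
qed (use n \<psi> \<gamma> \<theta> in \<open>simp_all add: image_insert\<close>)

locale frame =
  fixes x y z :: "complex ^ 3"
  assumes independent: "det3 x y z \<noteq> 0"
begin

definition "px = (1 / det3 x y z) *s vcross y z"
definition "py = (1 / det3 x y z) *s vcross z x"
definition "pz = (1 / det3 x y z) *s vcross x y"

lemma dual [simp]:
  "dot x px = 1" "dot x py = 0" "dot x pz = 0"
  "dot y px = 0" "dot y py = 1" "dot y pz = 0"
  "dot z px = 0" "dot z py = 0" "dot z pz = 1"
proof -
  have "dot y (vcross z x) = det3 x y z" "dot z (vcross x y) = det3 x y z" "dot x (vcross y z) = det3 x y z"
    by (simp_all add: det3_def dot_def algebra_simps)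
  then show "dot x px = 1" "dot x py = 0" "dot x pz = 0"
    "dot y px = 0" "dot y py = 1" "dot y pz = 0"
    "dot z px = 0" "dot z py = 0" "dot z pz = 1"
    using independent by (simp_all add: px_def py_def pz_def)
qed

lemma expand: "v = dot x v *s px + dot y v *s py + dot z v *s pz"
proof -
  have "det3 x y z *s v = dot x v *s vcross y z + dot y v *s vcross z x + dot z v *s vcross x y"
    by (simp add: vec3_eq_iff det3_def dot_def algebra_simps)
  then have "(1 / det3 x y z) *s (det3 x y z *s v) =
     (1 / det3 x y z) *s (dot x v *s vcross y z + dot y v *s vcross z x + dot z v *s vcross x y)"
    by simp
  then show ?thesis
    using independent by (simp add: px_def py_def pz_def vec_eq_iff field_simps)
qed

lemma eqI:
  assumes "dot x a = dot x b" "dot y a = dot y b" "dot z a = dot z b"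
  shows "a = b"
proof -
  have "a = dot x a *s px + dot y a *s py + dot z a *s pz" by (rule expand)
  also have "\<dots> = dot x b *s px + dot y b *s py + dot z b *s pz" by (simp only: assms)
  also have "\<dots> = b" by (rule expand[symmetric])
  finally show ?thesis .
qed

lemma S3_eq:
  assumes "\<And>v. dot x (ev \<theta> v) = dot x (ev \<phi> v)" "\<And>v. dot y (ev \<theta> v) = dot y (ev \<phi> v)"
    "\<And>v. dot z (ev \<theta> v) = dot z (ev \<phi> v)"
  shows "\<theta> = \<phi>"
  by (rule S3_eqI, rule eqI) (rule assms)+

definition "vol = det3 px py pz"

lemma det3_coords:
  "det3 a b c = vol * (dot x a * (dot y b * dot z c - dot z b * dot y c)
     + dot y a * (dot z b * dot x c - dot x b * dot z c)
     + dot z a * (dot x b * dot y c - dot y b * dot x c))"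
proof -
  have p: "det3 px pz py = - vol" "det3 py px pz = - vol" "det3 py pz px = vol"
    "det3 pz px py = vol" "det3 pz py px = - vol" "det3 px py pz = vol"
    by (simp_all add: vol_def det3_def dot_def algebra_simps)
  have "det3 a b c = det3 (dot x a *s px + dot y a *s py + dot z a *s pz)
      (dot x b *s px + dot y b *s py + dot z b *s pz) (dot x c *s px + dot y c *s py + dot z c *s pz)"
    by (simp only: expand[symmetric])
  also have "\<dots> = vol * (dot x a * (dot y b * dot z c - dot z b * dot y c)
     + dot y a * (dot z b * dot x c - dot x b * dot z c)
     + dot z a * (dot x b * dot y c - dot y b * dot x c))"
    by (simp add: det3_linear p algebra_simps)
  finally show ?thesis .
qed

lemma vol_nonzero: "vol \<noteq> 0"
proof
  assume "vol = 0"
  then have "det3 x y z = 0" using det3_coords[of x y z] by simp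
  then show False using independent by simp
qed

end

text \<open>A nonvanishing determinant with the Euler derivation gives independence, hence also irredundancy.\<close>

lemma free_from_det:
  assumes W: "arrangement W" "W \<noteq> {}" and A: "AR (defining_poly A) = AR (form W)"
    and G: "g1 \<in> logder W" "g2 \<in> logder W"
    and gen: "logder W \<subseteq> S3.span {euler, g1, g2}"
    and hom: "homogeneous_rel g1 n" "homogeneous_rel g2 n" "n > 0"
    and det: "sdet g1 g2 euler \<noteq> 0"
  shows "has_exponents A [n, n]" "free_arrangement A"
proof -
  have ne: "g1 \<noteq> g2"
  proof
    assume "g1 = g2"
    then have "sdet g1 g2 euler = 0" by (intro S_eqI) simp
    then show False using det by simp
  qed
  have F: "sdet g2 g2 euler = 0" "sdet euler g2 euler = 0" "sdet g1 g1 euler = 0" "sdet euler g1 euler = 0"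
    "sdet g2 g1 euler = - sdet g1 g2 euler"
    by (rule S_eqI; simp add: det3_perm(2)[of "ev g2 v" for v])+
  have sub: "S3.subspace {\<theta>. sdet \<theta> g euler = 0}" for g
    by (auto simp: S3.subspace_def sdet_linear)
  show "has_exponents A [n, n]"
  proof (rule has_exponents_sep[OF W A, where gs = "[g1, g2]"])
    show "separable (set [g1, g2]) g"
      if "g \<in> set [g1, g2]" for g
    proof (cases "g = g1")
      case True
      then show ?thesis using sub[of g2] F det unfolding separable_def by (intro exI[of _ "{\<theta>. sdet \<theta> g2 euler = 0}"]) auto
    next
      case False
      then show ?thesis using sub[of g1] F det that
        unfolding separable_def by (intro exI[of _ "{\<theta>. sdet \<theta> g1 euler = 0}"]) auto
    qed
  qed (use G gen hom ne in auto)
  obtain \<pi> where \<pi>: "\<exists>e. \<pi> g1 = g1 - e *s euler" "\<exists>e. \<pi> g2 = g2 - e *s euler"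
    "AR (form W) = S3.span (\<pi> ` {g1, g2})"
    using AR_generators[OF W, of "{g1, g2}" "\<lambda>_. n"] G gen hom by auto
  obtain e1 e2 where e: "\<pi> g1 = g1 - e1 *s euler" "\<pi> g2 = g2 - e2 *s euler" using \<pi> by blast
  define a b where "a = \<pi> g1" and "b = \<pi> g2"
  have d: "sdet a b euler = sdet g1 g2 euler"
    by (rule S_eqI) (simp add: a_def b_def e det3_linear)
  have ab: "a \<noteq> b"
  proof
    assume "a = b"
    then have "sdet a b euler = 0" by (intro S_eqI) simp
    then show False using det d by simp
  qed
  have "\<not> S3.dependent {a, b}"
  proof
    assume "S3.dependent {a, b}"
    then obtain u where u: "u a \<noteq> 0 \<or> u b \<noteq> 0" "u a *s a + u b *s b = 0"
      using ab by (auto simp: S3.dependent_finite)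
    have "sdet (u a *s a + u b *s b) b euler = u a * sdet a b euler"
      by (rule S_eqI) (simp add: det3_linear)
    then have "u a = 0" using u(2) d det by (simp add: sdet_linear)
    moreover have "sdet (u a *s a + u b *s b) a euler = - u b * sdet a b euler"
      by (rule S_eqI) (simp add: det3_linear det3_perm(2)[of "ev b v" for v])
    then have "u b = 0" using u(2) d det by (simp add: sdet_linear)
    ultimately show False using u(1) by simp
  qed
  moreover have "S3.span {a, b} = AR (defining_poly A)" using \<pi>(3) A by (simp add: a_def b_def)
  ultimately show "free_arrangement A"
    unfolding free_arrangement_def S_dependent_def S_span_def by blast
qed

section \<open>The complete quadrilateral and one further line\<close>

text \<open>Four points in general position, with the six lines joining them; the triple of a point
  consists of the lines that join it to the other three.  The lines in the pairs \<open>(0,5)\<close>, \<open>(1,4)\<close>, \<open>(2,3)\<close> are opposite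
  and meet in the diagonal points.  In the coordinates below the four points are \<open>(1,0,0)\<close>, \<open>(0,1,0)\<close>,
  \<open>(0,0,1)\<close>, \<open>(1,1,1)\<close>.\<close>

abbreviation quad :: "nat set set" where
  "quad \<equiv> {{0,1,2},{0,3,4},{1,3,5},{2,4,5}}"

locale quadrilateral = frame x y z for x y z +
  fixes h :: "nat \<Rightarrow> complex ^ 3" and l :: "complex ^ 3" and T :: "nat set set"
  assumes h: "h 0 = z" "h 1 = y" "h 2 = y - z" "h 3 = x" "h 4 = x - z" "h 5 = x - y" "h 6 = l"
    and L: "labelled (h ` {0..<7}) h T"
    and T: "T = quad \<or> T = quad \<union> {{6,0,5}} \<or> T = quad \<union> {{6,0,5},{6,1,4}}"
begin

abbreviation "six \<equiv> h ` {0..<6}"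
abbreviation "W \<equiv> h ` {0..<7}"

lemma six_explicit: "six = {z, y, y - z, x, x - z, x - y}"
proof -
  have "{0..<6} = {0,1,2,3,4,5::nat}" by auto
  then show ?thesis using h by simp
qed

lemma h_Suc_0: "h (Suc 0) = y" using h(2) by simp

text \<open>\<open>sq\<close> has the squares of the coordinates as coefficients, and \<open>x\<^sup>2 - y\<^sup>2\<close> is divisible by \<open>x - y\<close>; \<open>cu\<close> is
  \<open>pder\<close> at the point \<open>(1,0,0)\<close>.\<close>

definition "sq = (lin x)\<^sup>2 *s cvec px + (lin y)\<^sup>2 *s cvec py + (lin z)\<^sup>2 *s cvec pz"
definition "cu = (lin x * lin (x - y) * lin (x - z)) *s cvec px"

lemma ev_sq [simp]:
  "dot x (ev sq v) = (dot x v)\<^sup>2" "dot y (ev sq v) = (dot y v)\<^sup>2" "dot z (ev sq v) = (dot z v)\<^sup>2"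
  by (simp_all add: sq_def)

lemma ev_cu [simp]:
  "dot x (ev cu v) = dot x v * (dot x v - dot y v) * (dot x v - dot z v)"
  "dot y (ev cu v) = 0" "dot z (ev cu v) = 0"
  by (simp_all add: cu_def)

lemma sq_logder: "sq \<in> logder six"
  by (auto simp: logder_def six_explicit power2_eq_square)

lemma not_blocks: "\<forall>B\<in>{{5,0,1},{5,0,2},{5,1,2}}. B \<notin> T"
  using T by (elim disjE; hypsubst; code_simp)

lemma spanned_five: "spanned (h ` {0,1,2,3,4}) (pt h ` {(0,1),(0,3)})"
proof -
  have "peeling T [(0,1),(0,3)] 0 (0,1) (0,3) [(1,(0,1)),(2,(0,1)),(3,(0,3)),(4,(0,3))]"
    using T by (elim disjE; hypsubst; code_simp)
  from spanned_by_peeling[OF L this refl] show ?thesis by (simp add: insert_commute)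
qed

lemma cu_logder: "cu \<in> logder six"
  by (auto simp: logder_def six_explicit)

text \<open>The line \<open>x - y\<close> is added to the other five, with \<open>\<psi> = sq\<close>.  The five lines have the two generators
  \<open>pder\<close> at \<open>(1,0,0)\<close> and \<open>(0,1,0)\<close>; after multiplication by \<open>x - y\<close> their sum is a combination of \<open>sq\<close> and the
  Euler derivation, so one of them is enough.\<close>

lemma six_generators: "logder six \<subseteq> S3.span {euler, sq, cu}"
proof
  let ?N = "S3.span {euler, sq, cu}"
  let ?V = "{0,1,2,3,4} :: nat set"
  have N: "euler \<in> ?N" "sq \<in> ?N" "cu \<in> ?N" by (simp_all add: S3.span_base)
  have V: "{0..<6} = insert 5 ?V" by auto
  fix \<theta> assume \<theta>: "\<theta> \<in> logder six"
  have "\<exists>c e \<theta>'. \<theta>' \<in> logder (h ` ?V) \<and> \<theta> = c *s sq + e *s euler + lin (h 5) *s \<theta>'"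
  proof (rule add_line_labelled[OF L, where K = "{0,1,2}" and n = px and \<gamma> = vol])
    show "{5, k, k'} \<notin> T" if "k \<in> {0,1,2}" "k' \<in> {0,1,2}" "k \<noteq> k'" for k k'
      using that not_blocks by (auto simp: insert_commute)
    show "dot (h 5) px = 1" using h by simp
    show "sq \<in> logder (h ` insert 5 ?V)" using sq_logder V by simp
    show "\<theta> \<in> logder (h ` insert 5 ?V)" using \<theta> V by simp
    show "det3 (ev sq v) v px = vol * (\<Prod>k\<in>{0,1,2}. dot (h k) v)" if "dot (h 5) v = 0" for v
      using that by (simp add: h h_Suc_0 det3_coords power2_eq_square algebra_simps)
  qed (use vol_nonzero in auto)
  then obtain c e \<theta>' where 1: "\<theta>' \<in> logder (h ` ?V)" "\<theta> = c *s sq + e *s euler + lin (h 5) *s \<theta>'"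
    by blast
  have V5: "h ` ?V = {z, y, y - z, x, x - z}" using h by (auto simp: h_Suc_0)
  have yz: "y \<noteq> 0" "z \<noteq> 0" using independent by (auto simp: det3_linear)
  have p1: "pt h (0,1) = (- det3 x y z) *s px" and p2: "pt h (0,3) = det3 x y z *s py"
    using independent by (simp_all add: pt_def px_def py_def h h_Suc_0 vec3_eq_iff)
  have "{w \<in> h ` ?V. dot w (pt h (0,1)) \<noteq> 0} = {x, x - z}"
    "{w \<in> h ` ?V. dot w (pt h (0,3)) \<noteq> 0} = {y, y - z}"
    unfolding V5 p1 p2 using independent by auto
  then have q: "pder (h ` ?V) (pt h (0,1)) = (lin x * lin (x - z)) *s cvec (pt h (0,1))"
    "pder (h ` ?V) (pt h (0,3)) = (lin y * lin (y - z)) *s cvec (pt h (0,3))"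
    using yz by (simp_all add: pder_def)
  have q1: "lin (h 5) *s pder (h ` ?V) (pt h (0,1)) = cst (- det3 x y z) *s cu"
    unfolding q unfolding p1 by (rule S3_eq) (simp_all add: h algebra_simps)
  have q2: "lin (h 5) *s pder (h ` ?V) (pt h (0,3)) =
      cst (det3 x y z) *s (lin (x - y) *s sq - (lin z * lin (x - y)) *s euler - cu)"
    unfolding q unfolding p2 by (rule S3_eq) (simp_all add: h algebra_simps power2_eq_square)
  have "lin (h 5) *s \<theta>' \<in> ?N"
  proof (rule span_scaled)
    show "\<theta>' \<in> S3.span (insert euler (pder (h ` ?V) ` pt h ` {(0,1),(0,3)}))"
      using 1(1) spanned_five unfolding spanned_def by blast
    have "lin (h 5) *s euler \<in> ?N" using N(1) by (rule S3.span_scale)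
    moreover have "lin (h 5) *s pder (h ` ?V) (pt h (0,1)) \<in> ?N"
      unfolding q1 using N(3) by (rule S3.span_scale)
    moreover have "lin (h 5) *s pder (h ` ?V) (pt h (0,3)) \<in> ?N"
      unfolding q2 by (intro S3.span_scale[OF S3.span_diff[OF S3.span_diff[OF S3.span_scale S3.span_scale]]] N)
    ultimately show "lin (h 5) *s g \<in> ?N"
      if "g \<in> insert euler (pder (h ` ?V) ` pt h ` {(0,1),(0,3)})" for g
      using that by auto
  qed
  then show "\<theta> \<in> ?N"
    unfolding 1(2) by (intro S3.span_add[OF S3.span_add[OF S3.span_scale S3.span_scale]] N)
qed

definition "six_form = lin x * lin y * lin z * lin (y - z) * lin (x - z) * lin (x - y)"

lemma six_form_nonzero: "six_form \<noteq> 0"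
proof -
  have "h k \<noteq> 0" if "k < 7" for k
    using triple_configD(5)[OF labelledD(1)[OF L]] that by auto
  from this[of 0] this[of 1] this[of 2] this[of 3] this[of 4] this[of 5] show ?thesis
    by (simp add: six_form_def h h_Suc_0)
qed

lemma sdet_cu_sq: "sdet cu sq euler = cst vol * six_form"
  by (rule S_eqI) (simp add: six_form_def det3_coords power2_eq_square algebra_simps)

lemma W_explicit: "W = insert l six"
proof -
  have "{0..<7} = insert 6 {0..<6::nat}" by auto
  then show ?thesis using h by simp
qed

lemma l_facts: "l \<notin> six" "l \<noteq> 0" "l \<in> W"
proof -
  show "l \<in> W" by (simp add: W_explicit)
  then show "l \<noteq> 0" using triple_configD(5)[OF labelledD(1)[OF L]] by auto
  show "l \<notin> six"
  proof
    assume "l \<in> six"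
    then obtain k where "k < 6" "h k = h 6" using h by auto
    then show False using labelledD(4)[OF L, of k 6] by simp
  qed
qed

lemma homogeneous_lsq: "homogeneous_rel (lin l *s sq) 3"
  by (simp add: homogeneous_rel_iff sq_def vec_eq_iff power2_eq_square algebra_simps)

lemma homogeneous_lcu: "homogeneous_rel (lin l *s cu) 4"
  by (simp add: homogeneous_rel_iff cu_def vec_eq_iff algebra_simps)

lemma lsq_not_radial: "lin l *s sq \<notin> radial x"
proof
  assume r: "lin l *s sq \<in> radial x"
  have x0: "x \<noteq> 0" using independent by (auto simp: det3_linear)
  have "\<exists>v. dot x v = 0 \<and> (\<forall>p\<in>{lin l, lin y, lin z, lin (y - z)}. eval_at p v \<noteq> 0)"
  proof (rule generic_point_on_line[OF x0])
    have "\<not> lin (h 3) dvd lin (h k)" if "k \<in> {6,1,0,2}" for k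
      using that by (intro not_lin_dvd_lin labelled_vcross[OF L]) auto
    from this[of 6] this[of 1] this[of 0] this[of 2]
    show "\<not> lin x dvd p" if "p \<in> {lin l, lin y, lin z, lin (y - z)}" for p
      using that by (auto simp: h h_Suc_0)
  qed simp
  then obtain v where v: "dot x v = 0" "dot l v \<noteq> 0" "dot y v \<noteq> 0" "dot z v \<noteq> 0" "dot y v - dot z v \<noteq> 0"
    by auto
  have "vcross (ev (lin l *s sq) v) v = 0" using r v(1) unfolding radial_def by blast
  then have c: "vcross (ev sq v) v = 0" using v(2) by simp
  have "dot y a * dot z b - dot z a * dot y b = dot (vcross y z) (vcross a b)" for a b
    by (simp add: dot_def algebra_simps)
  from this[of "ev sq v" v] have "dot y v * dot z v * (dot y v - dot z v) = 0"
    by (simp add: c power2_eq_square algebra_simps)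
  then show False using v by simp
qed

lemma det3_zero_imp: "det3 a b c \<noteq> 0 \<Longrightarrow> dot a v = 0 \<Longrightarrow> dot b v = 0 \<Longrightarrow> dot c v = 0 \<Longrightarrow> v = 0"
  using frame.eqI[of a b c v 0] by (simp add: frame_def)

text \<open>At most one double point of the quadrilateral lies on the further line.  The point \<open>v0\<close>
  witnesses that \<open>cu\<close> is needed: the determinant with \<open>sq\<close> and the Euler derivation, divided by
  the equation of the quadrilateral, vanishes at \<open>v0\<close> for all generators but this one.\<close>

lemma quadrilateral_and_line:
  assumes T2: "T = quad \<or> T = quad \<union> {{6,0,5}}"
    and A: "AR (defining_poly A) = AR (form W)"
  shows "has_exponents A [3, 4, if T = quad then 5 else 4]"
proof -
  define X where "X = pt h (0,6)"
  have W: "triple_config W" by (rule labelledD(1)[OF L])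
  have lt: "two_labels (0,6)" by (simp add: two_labels_def)
  have X0: "X \<noteq> 0" unfolding X_def by (rule pt_nonzero[OF L lt])
  have zX: "dot z X = 0" "dot l X = 0" by (simp_all add: X_def pt_def h)
  let ?gs = "[lin l *s sq, lin l *s cu, pder W X]"
  let ?N = "S3.span (insert euler (set ?gs))"
  have N: "euler \<in> ?N" "lin l *s sq \<in> ?N" "lin l *s cu \<in> ?N" "pder W X \<in> ?N"
    by (simp_all add: S3.span_base)
  have xX: "dot x X \<noteq> 0"
  proof -
    have "\<not> passes T 3 (0,6)" using T2 by (elim disjE; hypsubst; code_simp)
    then show ?thesis using passes_iff[OF L lt, of 3] by (simp add: X_def h)
  qed
  have gen: "logder W \<subseteq> ?N"
  proof
    fix \<theta> assume \<theta>: "\<theta> \<in> logder W"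
    have "\<exists>c e \<theta>'. \<theta>' \<in> logder six \<and> \<theta> = c *s pder (insert l six) X + e *s euler + lin l *s \<theta>'"
    proof (rule add_line_point[where ?u0.0 = z])
      show "arrangement (insert l six)" using triple_configD(1)[OF W] W_explicit by simp
      show "z \<in> six" by (simp add: six_explicit)
      show "det3 l u u' \<noteq> 0"
        if u: "u \<in> six" "u' \<in> six" "u \<noteq> u'" "dot u X \<noteq> 0" "dot u' X \<noteq> 0" for u u'
      proof
        assume d: "det3 l u u' = 0"
        obtain k k' where k: "u = h k" "u' = h k'" "k < 6" "k' < 6" using u by auto
        then have "k \<noteq> k'" using u by auto
        then have bl: "{6, k, k'} \<in> T" using labelled_det3[OF L, of 6 k k'] d k h by simp
        have all: "\<forall>B\<in>T. 6 \<in> B \<longrightarrow> 0 \<in> B" using T2 by (elim disjE) simp_all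
        have "0 \<in> {6,k,k'}" using bspec[OF all bl] by simp
        then have "k = 0 \<or> k' = 0" by auto
        then show False using u(4,5) zX(1) k(1,2) h(1) by metis
      qed
      show "\<theta> \<in> logder (insert l six)" using \<theta> by (simp only: W_explicit)
    qed (fact l_facts X0 zX)+
    then obtain c e \<theta>' where 1: "\<theta>' \<in> logder six" "\<theta> = c *s pder W X + e *s euler + lin l *s \<theta>'"
      unfolding W_explicit by blast
    have "lin l *s \<theta>' \<in> ?N"
      by (rule span_scaled[of _ "{euler, sq, cu}"]) (use 1(1) six_generators N in \<open>auto intro: S3.span_scale\<close>)
    then show "\<theta> \<in> ?N"
      unfolding 1(2) by (intro S3.span_add[OF S3.span_add[OF S3.span_scale S3.span_scale]] N)
  qed
  have fin: "finite W" by simp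
  have "lin l *s sq \<in> logder W" "lin l *s cu \<in> logder W"
    using sq_logder cu_logder unfolding W_explicit logder_def by auto
  then have log: "set ?gs \<subseteq> logder W" using pder_logder[OF fin] by simp
  \<comment> \<open>a triple point, respectively a diagonal point, of the quadrilateral that is off the line \<open>l\<close>\<close>
  define v0 where "v0 = (if T = quad then pz else px + pz)"
  let ?F = "\<lambda>\<theta>. sdet \<theta> sq euler"
  define U where "U = {\<theta>. \<exists>g. ?F \<theta> = six_form * g \<and> eval_at g v0 = 0}"
  have U: "S3.subspace U"
    unfolding U_def by (rule subspace_det) (simp_all add: sdet_linear)
  have UI: "\<theta> \<in> U" if "?F \<theta> = six_form * g" "eval_at g v0 = 0" for \<theta> g
    using that unfolding U_def by blast
  have zero: "?F (p *s sq) = six_form * 0" "?F euler = six_form * 0" for p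
    by (rule S_eqI; simp add: det3_linear)+
  have U1: "lin l *s sq \<in> U" "euler \<in> U"
    by (rule UI[OF zero(1)], simp) (rule UI[OF zero(2)], simp)
  have lv: "dot l v0 \<noteq> 0"
  proof (cases "T = quad")
    case True
    have "{6,1,3} \<notin> T" unfolding True by code_simp
    then have "det3 l y x \<noteq> 0" using labelled_det3[OF L, of 6 1 3] by (simp add: h h_Suc_0)
    moreover have "dot z v0 = 1" using True by (simp add: v0_def)
    then have "v0 \<noteq> 0" by auto
    ultimately show ?thesis using det3_zero_imp[of l y x v0] True by (auto simp: v0_def)
  next
    case False
    have Tq: "T = quad \<union> {{6,0,5}}" using T2 False unfolding disj_imp by (rule mp)
    have "{6,1,4} \<notin> T" unfolding Tq by code_simp
    then have "det3 l y (x - z) \<noteq> 0" using labelled_det3[OF L, of 6 1 4] by (simp add: h h_Suc_0)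
    moreover have "dot z v0 = 1" using False by (simp add: v0_def)
    then have "v0 \<noteq> 0" by auto
    ultimately show ?thesis using det3_zero_imp[of l y "x - z" v0] False by (auto simp: v0_def)
  qed
  have U2: "lin l *s cu \<notin> U"
  proof
    assume "lin l *s cu \<in> U"
    then obtain g where g: "?F (lin l *s cu) = six_form * g" "eval_at g v0 = 0" unfolding U_def by blast
    then have "six_form * (lin l * cst vol) = six_form * g" by (simp add: sdet_linear sdet_cu_sq ac_simps)
    then have "g = lin l * cst vol" using six_form_nonzero by simp
    then show False using g(2) lv vol_nonzero by simp
  qed
  have pX: "?F (p *s cvec X) = p * (cst vol * lin z * (cst (dot x X) * lin y * lin (y - z)
      - cst (dot y X) * lin x * lin (x - z)))" for p
    by (rule S_eqI) (simp add: det3_linear, simp add: det3_coords zX power2_eq_square algebra_simps)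
  have U3: "pder W X \<in> U"
  proof (cases "T = quad")
    case True
    have "{k \<in> {0..<7}. \<not> passes T k (0,6)} = {1,2,3,4,5}" unfolding True by code_simp
    from pder_labelled[OF L lt order_refl this]
    have "pder W X = (lin y * lin (y - z) * lin x * lin (x - z) * lin (x - y)) *s cvec X"
      by (simp add: X_def h h_Suc_0 mult.assoc)
    then have "?F (pder W X) = six_form * (cst vol * (cst (dot x X) * lin y * lin (y - z)
        - cst (dot y X) * lin x * lin (x - z)))"
      unfolding six_form_def by (simp only: pX ac_simps)
    then show ?thesis by (rule UI) (use True in \<open>simp add: v0_def\<close>)
  next
    case False
    have T: "T = quad \<union> {{6,0,5}}" using T2 False unfolding disj_imp by (rule mp)
    have "{k \<in> {0..<7}. \<not> passes T k (0,6)} = {1,2,3,4}" unfolding T by code_simp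
    from pder_labelled[OF L lt order_refl this]
    have p: "pder W X = (lin y * lin (y - z) * lin x * lin (x - z)) *s cvec X"
      by (simp add: X_def h h_Suc_0 mult.assoc)
    have "passes T 5 (0,6)" unfolding T by code_simp
    then have "dot x X = dot y X" using passes_iff[OF L lt, of 5] by (simp add: X_def h)
    then have "?F (pder W X) = six_form * (cst (vol * dot x X) * (lin z - lin x - lin y))"
      unfolding p pX six_form_def by (intro S_eqI) (simp add: algebra_simps)
    then show ?thesis by (rule UI) (use False in \<open>simp add: v0_def\<close>)
  qed
  \<comment> \<open>the line \<open>x\<close> passes neither through \<open>(1,0,0)\<close> nor through \<open>X\<close>\<close>
  have R: "lin l *s cu \<in> radial x" "pder W X \<in> radial x"
  proof -
    have "lin l *s cu = lin x *s ((lin l * lin (x - y) * lin (x - z)) *s cvec px)"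
      by (rule S3_eqI) (simp add: cu_def ac_simps)
    then show "lin l *s cu \<in> radial x" by (simp only: radialI(2))
    have "x \<in> W" by (simp add: W_explicit six_explicit)
    then show "pder W X \<in> radial x" using xX fin by simp
  qed
  have Rl: "pder W X \<notin> radial l" using pder_not_radial[OF triple_configD(1)[OF W] l_facts(3) zX(2) X0] .
  show ?thesis
  proof (rule has_exponents_sep[OF triple_configD(1,3)[OF W] A log _ gen])
    have "lin l *s sq \<noteq> lin l *s cu" using U1(1) U2 by metis
    moreover have "lin l *s sq \<noteq> pder W X" "lin l *s cu \<noteq> pder W X" using Rl radialI(2) by metis+
    ultimately show "distinct ?gs" by simp
    show "list_all2 homogeneous_rel ?gs [3, 4, if T = quad then 5 else 4]"
    proof -
      have "(\<exists>B\<in>T. 0 \<in> B \<and> 6 \<in> B) \<longleftrightarrow> T \<noteq> quad"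
        using T2 by (elim disjE; hypsubst; code_simp)
      then have "(if \<exists>B\<in>T. fst (0::nat,6::nat) \<in> B \<and> snd (0::nat,6::nat) \<in> B then 4 else 5) = (if T = quad then 5 else 4 :: nat)"
        by simp
      with homogeneous_pder_pt[OF L lt] have "homogeneous_rel (pder W X) (if T = quad then 5 else 4)"
        unfolding X_def by (simp only:)
      then show ?thesis by (intro list.rel_intros homogeneous_lsq homogeneous_lcu)
    qed
    show "separable (set ?gs) g"
      if g: "g \<in> set ?gs" for g
    proof -
      consider "g = lin l *s sq" | "g = lin l *s cu" | "g = pder W X" using g by auto
      then show ?thesis
      proof cases
        case 1
        then show ?thesis using radial_subspace lsq_not_radial R unfolding separable_def by (intro exI[of _ "radial x"]) simp
      next
        case 2
        then show ?thesis using U U1 U2 U3 unfolding separable_def by (intro exI[of _ U]) simp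
      next
        case 3
        then show ?thesis using radial_subspace Rl unfolding separable_def by (intro exI[of _ "radial l"]) simp
      qed
    qed
  qed auto
qed


text \<open>Among the derivations of degree three of the quadrilateral, this one is also tangent to the line
  \<open>x = y + z\<close> through two diagonal points.  Modulo the Euler derivation it has the coefficients
  \<open>2x\<^sup>3 - 3x\<cdot>x\<^sup>2\<close>, \<open>2y\<^sup>3 - 3x\<cdot>y\<^sup>2\<close>, \<open>2z\<^sup>3 - 3x\<cdot>z\<^sup>2\<close>.\<close>

definition "psi = cst 2 *s cu + (cst 2 * lin y + cst 2 * lin z - cst 3 * lin x) *s sq"

text \<open>The seventh line meets the quadrilateral in four points only, and \<open>psi\<close> restricts to the field with
  these zeros.  The generator \<open>lin l *s cu\<close> is redundant by the definition of \<open>psi\<close>.\<close>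

lemma quadrilateral_and_two_points:
  assumes T2: "T = quad \<union> {{6,0,5},{6,1,4}}" and A: "AR (defining_poly A) = AR (form W)"
  shows "has_exponents A [3, 3]" "free_arrangement A"
proof -
  have W: "triple_config W" by (rule labelledD(1)[OF L])
  have "passes T 6 (0,5)" "passes T 6 (1,4)" unfolding T2 by code_simp+
  then have "dot l (pt h (0,5)) = 0" "dot l (pt h (1,4)) = 0"
    using passes_iff[OF L, of "(0,5)" 6] passes_iff[OF L, of "(1,4)" 6] by (simp_all add: two_labels_def h)
  moreover have "pt h (0,5) = det3 x y z *s (px + py)" "pt h (1,4) = (- det3 x y z) *s (px + pz)"
    using independent by (simp_all add: pt_def px_def py_def pz_def h h_Suc_0 vec3_eq_iff algebra_simps)
  ultimately have "det3 x y z * (dot l px + dot l py) = 0" "- det3 x y z * (dot l px + dot l pz) = 0"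
    by (metis dot_linear(6,8))+
  then have "dot l px + dot l py = 0" "dot l px + dot l pz = 0"
    using independent by simp_all
  then have lp: "dot l py = - dot l px" "dot l pz = - dot l px"
    by (simp_all add: add_eq_0_iff)
  define c0 where "c0 = dot l px"
  have dl: "dot l v = c0 * (dot x v - dot y v - dot z v)" for v
  proof -
    have "dot l v = dot l (dot x v *s px + dot y v *s py + dot z v *s pz)"
      by (simp only: expand[symmetric])
    then show ?thesis by (simp add: lp c0_def algebra_simps)
  qed
  have c0_nz: "c0 \<noteq> 0"
  proof
    assume "c0 = 0"
    then have "lin l = 0" by (intro S_eqI) (simp add: dl)
    then show False using l_facts(2) by simp
  qed
  have "psi \<in> logder six"
    unfolding psi_def
    by (intro S3.subspace_add[OF logder_subspace] S3.subspace_scale[OF logder_subspace] cu_logder sq_logder)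
  moreover have "dot l (ev psi v) = 0" if "dot l v = 0" for v
  proof -
    have xv: "dot x v = dot y v + dot z v" using that c0_nz by (simp add: dl diff_eq_eq add.commute)
    show ?thesis unfolding dl psi_def by (simp add: xv power2_eq_square algebra_simps)
  qed
  ultimately have psi: "psi \<in> logder W"
    unfolding W_explicit by (simp add: logder_def)
  have V: "{0..<7} = insert 6 {0..<6::nat}" by auto
  let ?N = "S3.span {euler, lin l *s sq, psi}"
  have N: "euler \<in> ?N" "lin l *s sq \<in> ?N" "psi \<in> ?N" by (simp_all add: S3.span_base)
  have gen: "logder W \<subseteq> ?N"
  proof
    fix \<theta> assume \<theta>: "\<theta> \<in> logder W"
    have "\<exists>c e \<theta>'. \<theta>' \<in> logder six \<and> \<theta> = c *s psi + e *s euler + lin (h 6) *s \<theta>'"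
    proof (rule add_line_labelled[OF L, where K = "{0,1,2,3}" and n = "(1 / c0) *s px" and \<gamma> = "- vol / c0"])
      show "dot (h 6) ((1 / c0) *s px) = 1" using c0_nz by (simp add: h c0_def)
      have "\<forall>k\<in>{0,1,2,3}. \<forall>k'\<in>{0,1,2,3}. k \<noteq> k' \<longrightarrow> {6, k, k'} \<notin> T" unfolding T2 by code_simp
      then show "{6, k, k'} \<notin> T" if "k \<in> {0,1,2,3}" "k' \<in> {0,1,2,3}" "k \<noteq> k'" for k k'
        using that by blast
      show "psi \<in> logder (h ` insert 6 {0..<6})" "\<theta> \<in> logder (h ` insert 6 {0..<6})"
        using psi \<theta> unfolding V by simp_all
      show "- vol / c0 \<noteq> 0" using vol_nonzero c0_nz by simp
      show "det3 (ev psi v) v ((1 / c0) *s px) = - vol / c0 * (\<Prod>k\<in>{0,1,2,3}. dot (h k) v)"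
        if "dot (h 6) v = 0" for v
      proof -
        have "dot x v = dot y v + dot z v" using that c0_nz by (simp add: h dl diff_eq_eq add.commute)
        then show ?thesis
          by (simp add: det3_coords psi_def h h_Suc_0 power2_eq_square algebra_simps)
      qed
    qed auto
    then obtain c e \<theta>' where 1: "\<theta>' \<in> logder six" "\<theta> = c *s psi + e *s euler + lin l *s \<theta>'"
      by (auto simp: h)
    have "lin l *s cu = (cst (1/2) * lin l) *s psi
        - (cst (1/2) * (cst 2 * lin y + cst 2 * lin z - cst 3 * lin x)) *s (lin l *s sq)"
      by (rule S3_eq) (simp_all add: psi_def algebra_simps)
    then have "lin l *s cu \<in> ?N"
      by (simp only: S3.span_diff[OF S3.span_scale[OF N(3)] S3.span_scale[OF N(2)]])
    then have "lin l *s \<theta>' \<in> ?N"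
      using 1(1) six_generators N
      by (intro span_scaled[of \<theta>' "{euler, sq, cu}"]) (auto intro: S3.span_scale)
    then show "\<theta> \<in> ?N"
      unfolding 1(2) by (intro S3.span_add[OF S3.span_add[OF S3.span_scale S3.span_scale]] N)
  qed
  have lsq: "lin l *s sq \<in> logder W"
    using sq_logder unfolding W_explicit logder_def by auto
  have hom: "homogeneous_rel psi 3"
    by (simp add: homogeneous_rel_iff psi_def sq_def cu_def vec_eq_iff power2_eq_square algebra_simps)
  have "sdet (lin l *s sq) psi euler = - (cst 2 * lin l * sdet cu sq euler)"
    by (rule S_eqI) (simp add: psi_def det3_linear det3_perm(2)[of "ev sq v" for v])
  also have "\<dots> \<noteq> 0" using six_form_nonzero vol_nonzero l_facts by (simp add: sdet_cu_sq)
  finally have det: "sdet (lin l *s sq) psi euler \<noteq> 0" .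
  show "has_exponents A [3, 3]" "free_arrangement A"
    by (rule free_from_det[OF triple_configD(1,3)[OF W] A lsq psi gen homogeneous_lsq hom _ det], simp)+
qed

end

section \<open>Two disjoint triples of lines meeting on a seventh line\<close>

text \<open>Line \<open>6\<close> is the line at infinity; the pairs \<open>01\<close>, \<open>23\<close>, \<open>45\<close> are parallel lines in three directions, and
  one line of each pair passes through a common point, twice.\<close>

abbreviation grid :: "nat set set" where
  "grid \<equiv> {{6,0,1},{6,2,3},{6,4,5},{0,2,4},{1,3,5}}"

text \<open>With the centre of the figure as origin, the pairs are \<open>x = \<plusminus>s\<close>, \<open>y = \<plusminus>t\<close>, \<open>x + y = \<plusminus>r\<close>; the two finite
  triple points are symmetric about the centre, which forces \<open>r + s + t = 0\<close>.\<close>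

locale three_directions = frame x y z for x y z +
  fixes h :: "nat \<Rightarrow> complex ^ 3" and s t r :: complex
  assumes h: "h 0 = x + s *s z" "h 1 = x - s *s z" "h 2 = y + t *s z" "h 3 = y - t *s z"
      "h 4 = r *s z - (x + y)" "h 5 = - (r *s z) - (x + y)" "h 6 = z"
    and r: "r = - (s + t)"
    and L: "labelled (h ` {0..<7}) h grid"
begin

abbreviation "W \<equiv> h ` {0..<7}"

lemma h_Suc_0: "h (Suc 0) = x - s *s z" using h(2) by simp

lemma W_explicit: "W = {h 0, h 1, h 2, h 3, h 4, h 5, h 6}"
proof -
  have "{0..<7} = {0,1,2,3,4,5,6::nat}" by auto
  then show ?thesis by simp
qed

lemma widths_nonzero: "s \<noteq> 0" "t \<noteq> 0" "r \<noteq> 0"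
proof -
  show "s \<noteq> 0" using labelled_vcross[OF L, of 0 1] by (auto simp: h h_Suc_0)
  show "t \<noteq> 0" using labelled_vcross[OF L, of 2 3] by (auto simp: h)
  show "r \<noteq> 0" using labelled_vcross[OF L, of 4 5] by (auto simp: h)
qed

text \<open>In each of the three directions the component of \<open>psi\<close> is the product of the two parallel lines
  and a linear form.  The linear forms are determined up to a common constant by the condition that the component
  in the direction of \<open>x + y\<close> is the sum of the other two.\<close>

definition "psi =
  (((lin x)\<^sup>2 - cst (s\<^sup>2) * (lin z)\<^sup>2) * (cst r * lin y - cst t * (lin x + lin y))) *s cvec px +
  (((lin y)\<^sup>2 - cst (t\<^sup>2) * (lin z)\<^sup>2) * (cst r * lin x - cst s * (lin x + lin y))) *s cvec py"

definition "g1 = (lin (h 0) * lin (h 1) * lin (h 4) * lin (h 5)) *s cvec px"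
definition "g2 = (lin (h 0) * lin (h 1) * lin (h 2) * lin (h 3)) *s cvec (px - py)"
definition "g3 = (lin (h 0) * lin (h 2) * lin (h 4) * lin z) *s cvec (s *s px + t *s py + pz)"

lemma ev_psi:
  "dot x (ev psi v) = ((dot x v)\<^sup>2 - s\<^sup>2 * (dot z v)\<^sup>2) * (r * dot y v - t * (dot x v + dot y v))"
  "dot y (ev psi v) = ((dot y v)\<^sup>2 - t\<^sup>2 * (dot z v)\<^sup>2) * (r * dot x v - s * (dot x v + dot y v))"
  "dot z (ev psi v) = 0"
  by (simp_all add: psi_def)

text \<open>The symmetric formula in the third direction shows that \<open>psi\<close> is also tangent to the last
  pair of parallel lines.\<close>

lemma ev_psi_sum:
  "dot x (ev psi v) + dot y (ev psi v) =
     - (((dot x v + dot y v)\<^sup>2 - r\<^sup>2 * (dot z v)\<^sup>2) * (t * dot x v + s * dot y v))"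
  unfolding ev_psi unfolding r by (simp add: power2_eq_square algebra_simps)

lemma psi_logder: "psi \<in> logder W"
proof -
  have "dot (h 4) (ev psi v) = 0" if "dot (h 4) v = 0" for v
  proof -
    have "dot x v + dot y v = r * dot z v" using that by (simp add: h)
    then have "dot x (ev psi v) + dot y (ev psi v) = 0"
      unfolding ev_psi_sum by (simp add: power2_eq_square)
    then show ?thesis by (simp add: h ev_psi(3))
  qed
  moreover have "dot (h 5) (ev psi v) = 0" if "dot (h 5) v = 0" for v
  proof -
    have "dot x v + dot y v = - r * dot z v" using that by (simp add: h)
    then have "dot x (ev psi v) + dot y (ev psi v) = 0"
      unfolding ev_psi_sum by (simp add: power2_eq_square)
    then have "dot y (ev psi v) = - dot x (ev psi v)" by (simp add: add_eq_0_iff)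
    then show ?thesis by (simp add: h ev_psi(3))
  qed
  moreover have "dot (h 0) (ev psi v) = 0" if "dot (h 0) v = 0" for v
  proof -
    have "dot x v = - s * dot z v" using that by (simp add: h add_eq_0_iff2)
    then show ?thesis by (simp add: h ev_psi power2_eq_square)
  qed
  moreover have "dot (h 1) (ev psi v) = 0" if "dot (h 1) v = 0" for v
    using that by (simp add: h h_Suc_0 ev_psi power2_eq_square)
  moreover have "dot (h 2) (ev psi v) = 0" if "dot (h 2) v = 0" for v
  proof -
    have "dot y v = - t * dot z v" using that by (simp add: h add_eq_0_iff2)
    then show ?thesis by (simp add: h ev_psi power2_eq_square)
  qed
  moreover have "dot (h 3) (ev psi v) = 0" if "dot (h 3) v = 0" for v
    using that by (simp add: h ev_psi power2_eq_square)
  moreover have "dot (h 6) (ev psi v) = 0" for v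
    by (simp add: h ev_psi)
  ultimately show ?thesis
    unfolding W_explicit logder_def by simp
qed

lemma g_logder: "g1 \<in> logder W" "g2 \<in> logder W"
  unfolding W_explicit logder_def g1_def g2_def by (auto simp: h h_Suc_0)

lemma det_psi:
  assumes "dot (h 0) v = 0"
  shows "det3 (ev psi v) v px = vol * s * (\<Prod>k\<in>{2,3,5,6}. dot (h k) v)"
proof -
  have "dot x v = - s * dot z v" using assms by (simp add: h add_eq_0_iff2)
  then show ?thesis
    by (simp add: h det3_coords ev_psi) (simp add: r power2_eq_square algebra_simps)
qed

text \<open>The fields \<open>g1\<close>, \<open>g2\<close>, \<open>g3\<close> are multiples of \<open>pder\<close> at three triple points.  Their combination with
  coefficients \<open>t\<close>, \<open>r\<close>, \<open>s\<close> lies in the span of \<open>psi\<close> and the Euler derivation.\<close>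

lemma g3_redundant:
  "cst s *s g3 = (cst s * lin (h 0) * lin (h 2) * lin (h 4)) *s euler - lin (h 0) *s psi
     - cst t *s g1 - cst r *s g2"
  by (rule S3_eq)
     (simp_all add: g1_def g2_def g3_def ev_psi h h_Suc_0, simp_all add: r power2_eq_square algebra_simps)

lemma generators: "logder W \<subseteq> S3.span {euler, psi, g1, g2}"
proof
  let ?N = "S3.span {euler, psi, g1, g2}"
  let ?V = "{1,2,3,4,5,6} :: nat set"
  have N: "euler \<in> ?N" "psi \<in> ?N" "g1 \<in> ?N" "g2 \<in> ?N" by (simp_all add: S3.span_base)
  have V: "{0..<7} = insert 0 ?V" "?V \<subseteq> {0..<7}" by auto
  fix \<theta> assume \<theta>: "\<theta> \<in> logder W"
  have "\<exists>c e \<theta>'. \<theta>' \<in> logder (h ` ?V) \<and> \<theta> = c *s psi + e *s euler + lin (h 0) *s \<theta>'"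
  proof (rule add_line_labelled[OF L, where K = "{2,3,5,6}" and n = px and \<gamma> = "vol * s"])
    have K: "\<forall>k\<in>{2,3,5,6}. \<forall>k'\<in>{2,3,5,6}. k \<noteq> k' \<longrightarrow> {0, k, k'} \<notin> grid" by code_simp
    show "{0, k, k'} \<notin> grid" if k: "k \<in> {2,3,5,6}" "k' \<in> {2,3,5,6}" "k \<noteq> k'" for k k'
      using bspec[OF bspec[OF K k(1)] k(2)] k(3) by (rule mp)
    show "dot (h 0) px = 1" by (simp add: h)
    show "psi \<in> logder (h ` insert 0 ?V)" "\<theta> \<in> logder (h ` insert 0 ?V)"
      using psi_logder \<theta> unfolding V(1) by simp_all
    show "vol * s \<noteq> 0" using vol_nonzero widths_nonzero by simp
    show "det3 (ev psi v) v px = vol * s * (\<Prod>k\<in>{2,3,5,6}. dot (h k) v)" if "dot (h 0) v = 0" for v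
      using that by (rule det_psi)
  qed auto
  then obtain c e \<theta>' where 1: "\<theta>' \<in> logder (h ` ?V)" "\<theta> = c *s psi + e *s euler + lin (h 0) *s \<theta>'"
    by blast
  let ?ps = "[(6,2),(6,4),(1,3)] :: (nat \<times> nat) list"
  have "peeling grid ?ps 6 (6,2) (6,4) [(3,(6,2)),(5,(6,4)),(2,(6,2)),(4,(6,4)),(1,(1,3))]"
    by code_simp
  moreover have "set (6 # map fst [(3,(6,2)),(5,(6,4)),(2,(6,2)),(4,(6,4)),(1,(1,3::nat))]) = ?V"
    by auto
  ultimately have sp: "spanned (h ` ?V) (pt h ` set ?ps)" by (rule spanned_by_peeling[OF L])
  have lt: "two_labels (6,2)" "two_labels (6,4)" "two_labels (1,3)" by (simp_all add: two_labels_def)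
  have p: "pt h (6,2) = (- det3 x y z) *s px" "pt h (6,4) = det3 x y z *s (px - py)"
    "pt h (1,3) = det3 x y z *s (s *s px + t *s py + pz)"
    using independent
    by (simp_all add: pt_def h h_Suc_0 px_def py_def pz_def vec3_eq_iff field_simps)
  have "{k \<in> ?V. \<not> passes grid k (6,2)} = {1,4,5}" by code_simp
  note q1 = pder_labelled[OF L lt(1) V(2) this]
  have "{k \<in> ?V. \<not> passes grid k (6,4)} = {1,2,3}" by code_simp
  note q2 = pder_labelled[OF L lt(2) V(2) this]
  have "{k \<in> ?V. \<not> passes grid k (1,3)} = {2,4,6}" by code_simp
  note q3 = pder_labelled[OF L lt(3) V(2) this]
  have q: "lin (h 0) *s pder (h ` ?V) (pt h (6,2)) = cst (- det3 x y z) *s g1"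
    "lin (h 0) *s pder (h ` ?V) (pt h (6,4)) = cst (det3 x y z) *s g2"
    "lin (h 0) *s pder (h ` ?V) (pt h (1,3)) = cst (det3 x y z / s) *s (cst s *s g3)"
    unfolding q1 q2 q3 unfolding p
    by (rule S3_eqI; simp add: g1_def g2_def g3_def widths_nonzero h(7) vec_eq_iff algebra_simps)+
  have g3: "cst s *s g3 \<in> ?N"
    unfolding g3_redundant
    by (intro S3.span_diff[OF S3.span_diff[OF S3.span_diff[OF S3.span_scale S3.span_scale] S3.span_scale] S3.span_scale] N)
  have "lin (h 0) *s \<theta>' \<in> ?N"
  proof (rule span_scaled)
    show "\<theta>' \<in> S3.span (insert euler (pder (h ` ?V) ` pt h ` set ?ps))"
      using 1(1) sp unfolding spanned_def by blast
    have "lin (h 0) *s pder (h ` ?V) (pt h p) \<in> ?N" if p: "p \<in> set ?ps" for p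
    proof -
      consider "p = (6,2)" | "p = (6,4)" | "p = (1,3)" using p by auto
      then show ?thesis
        by cases (simp_all only: q S3.span_scale[OF N(3)] S3.span_scale[OF N(4)] S3.span_scale[OF g3])
    qed
    then show "lin (h 0) *s g \<in> ?N" if "g \<in> insert euler (pder (h ` ?V) ` pt h ` set ?ps)" for g
      using that S3.span_scale[OF N(1)] by blast
  qed
  then show "\<theta> \<in> ?N"
    unfolding 1(2) by (intro S3.span_add[OF S3.span_add[OF S3.span_scale S3.span_scale]] N)
qed

lemma psi_not_radial: "psi \<notin> radial (h 0)"
proof
  assume rad: "psi \<in> radial (h 0)"
  have h0: "h 0 \<noteq> 0" using triple_configD(5)[OF labelledD(1)[OF L]] by auto
  have "\<exists>v. dot (h 0) v = 0 \<and> (\<forall>p\<in>(\<lambda>k. lin (h k)) ` {2,3,5,6}. eval_at p v \<noteq> 0)"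
  proof (rule generic_point_on_line[OF h0])
    have "\<not> lin (h 0) dvd lin (h k)" if "k \<in> {2,3,5,6}" for k
      by (rule not_lin_dvd_lin, rule labelled_vcross[OF L]) (use that in auto)
    then show "\<not> lin (h 0) dvd p" if "p \<in> (\<lambda>k. lin (h k)) ` {2,3,5,6}" for p
      using that by blast
  qed simp
  then obtain v where v: "dot (h 0) v = 0" "\<forall>k\<in>{2,3,5,6}. dot (h k) v \<noteq> 0" by auto
  then have "vcross (ev psi v) v = 0" using rad unfolding radial_def by blast
  then have "det3 (ev psi v) v px = 0" by (simp add: det3_eq_dot)
  then show False using det_psi[OF v(1)] v(2) vol_nonzero widths_nonzero by simp
qed

text \<open>At the centre \<open>pz\<close> of the configuration \<open>psi\<close> vanishes, while \<open>g1\<close>, \<open>g2\<close> and the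
  Euler derivation are independent there.\<close>

lemma grid_exponents:
  assumes A: "AR (defining_poly A) = AR (form W)"
  shows "has_exponents A [3, 4, 4]"
proof -
  have W: "triple_config W" by (rule labelledD(1)[OF L])
  let ?U = "\<lambda>g. {\<theta>. det3 (ev \<theta> pz) (ev g pz) pz = 0}"
  have sub: "S3.subspace (?U g)" for g
    by (auto simp: S3.subspace_def det3_linear)
  have p0: "ev psi pz = 0" by (rule eqI) (simp_all add: ev_psi)
  have e: "ev g1 pz = (s\<^sup>2 * r\<^sup>2) *s px" "ev g2 pz = (s\<^sup>2 * t\<^sup>2) *s (px - py)"
    by (simp_all add: g1_def g2_def h h_Suc_0 power2_eq_square mult.assoc)
  have d: "det3 (ev g1 pz) (ev g2 pz) pz \<noteq> 0" "det3 (ev g2 pz) (ev g1 pz) pz \<noteq> 0"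
    using widths_nonzero vol_nonzero by (simp_all add: e det3_coords)
  have U: "psi \<in> ?U g" "euler \<in> ?U g" "g \<in> ?U g" for g by (simp_all add: p0 det3_linear)
  have R: "g1 \<in> radial (h 0)" "g2 \<in> radial (h 0)"
    by (simp_all add: g1_def g2_def radial_def)
  have ne: "psi \<noteq> g1" "psi \<noteq> g2" "g1 \<noteq> g2" using psi_not_radial R U d by auto
  show ?thesis
  proof (rule has_exponents_sep[OF triple_configD(1,3)[OF W] A, where gs = "[psi, g1, g2]"])
    have "homogeneous_rel psi 3" "homogeneous_rel g1 4" "homogeneous_rel g2 4"
      by (simp_all add: homogeneous_rel_iff psi_def g1_def g2_def vec_eq_iff power2_eq_square algebra_simps)
    then show "list_all2 homogeneous_rel [psi, g1, g2] [3, 4, 4]" by (intro list.rel_intros)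
    show "separable (set [psi, g1, g2]) g"
      if g: "g \<in> set [psi, g1, g2]" for g
    proof -
      consider "g = psi" | "g = g1" | "g = g2" using g by auto
      then show ?thesis
      proof cases
        case 1
        then show ?thesis using radial_subspace psi_not_radial R
          unfolding separable_def by (intro exI[of _ "radial (h 0)"]) simp
      next
        case 2
        then show ?thesis using sub[of g2] U[of g2] d unfolding separable_def by (intro exI[of _ "?U g2"]) simp
      next
        case 3
        then show ?thesis using sub[of g1] U[of g1] d unfolding separable_def by (intro exI[of _ "?U g1"]) simp
      qed
    qed
  qed (use generators psi_logder g_logder ne in simp_all)
qed

end

section \<open>Normal forms\<close>

lemma det3_minus:
  "det3 (- a) b c = - det3 a b c" "det3 a (- b) c = - det3 a b c" "det3 a b (- c) = - det3 a b c"
  by (simp_all add: det3_def dot_def algebra_simps)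

lemma concurrent_combination:
  assumes "vcross a b \<noteq> 0" "vcross a c \<noteq> 0" "vcross b c \<noteq> 0" "det3 a b c = 0"
  obtains \<alpha> \<beta> where "c = \<alpha> *s a + \<beta> *s b" "\<alpha> \<noteq> 0" "\<beta> \<noteq> 0"
proof -
  obtain m where "dot (vcross a b) m = 1" using exists_dot_1[OF assms(1)] by blast
  then have "det3 a b m = 1" by (simp add: det3_eq_dot)
  then have c: "c = det3 c b m *s a + det3 a c m *s b"
    using cramer[of a b m c] assms(4) by simp
  have "det3 c b m \<noteq> 0"
  proof
    assume "det3 c b m = 0"
    then have "vcross b c = 0" using c by (metis add_0 vcross_scale(2) vcross_self(1) vector_smult_lzero vector_smult_rzero)
    then show False using assms(3) by simp
  qed
  moreover have "det3 a c m \<noteq> 0"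
  proof
    assume "det3 a c m = 0"
    then have "vcross a c = 0" using c by (metis add_0_right vcross_scale(2) vcross_self(1) vector_smult_lzero vector_smult_rzero)
    then show False using assms(2) by simp
  qed
  ultimately show ?thesis using that c by blast
qed

lemma block_combination:
  assumes L: "labelled W h T" and ijk: "i < 7" "j < 7" "k < 7" "i \<noteq> j" "i \<noteq> k" "j \<noteq> k" "{i,j,k} \<in> T"
  obtains \<alpha> \<beta> where "h k = \<alpha> *s h i + \<beta> *s h j" "\<alpha> \<noteq> 0" "\<beta> \<noteq> 0"
  using concurrent_combination[of "h i" "h j" "h k"] labelled_det3[OF L ijk(1-6)] ijk
    labelled_vcross[OF L] by metis

text \<open>Three concurrent lines satisfy a linear relation with nonzero coefficients.  The relations of
  two triple points with a common line fix the scaling of five equations, the third that of the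
  sixth up to a factor, and the fourth shows that the sixth is \<open>x - y\<close>.\<close>

lemma quadrilateral_normal_form:
  assumes L: "labelled W h T" and T: "{0,1,2} \<in> T" "{0,3,4} \<in> T" "{1,3,5} \<in> T" "{2,4,5} \<in> T" "{3,1,0} \<notin> T"
  shows "\<exists>(c :: nat \<Rightarrow> complex) x y z. (\<forall>k<7. c k \<noteq> 0) \<and> det3 x y z \<noteq> 0 \<and> c 0 *s h 0 = z \<and> c 1 *s h 1 = y \<and>
    c 2 *s h 2 = y - z \<and> c 3 *s h 3 = x \<and> c 4 *s h 4 = x - z \<and> c 5 *s h 5 = x - y"
proof -
  obtain \<alpha> \<beta> where ab: "h 2 = \<alpha> *s h 0 + \<beta> *s h 1" "\<alpha> \<noteq> 0" "\<beta> \<noteq> 0"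
    using block_combination[OF L, of 0 1 2] T by auto
  obtain \<gamma> \<delta> where cd: "h 4 = \<gamma> *s h 0 + \<delta> *s h 3" "\<gamma> \<noteq> 0" "\<delta> \<noteq> 0"
    using block_combination[OF L, of 0 3 4] T by auto
  obtain \<epsilon> \<zeta> where ez: "h 5 = \<epsilon> *s h 1 + \<zeta> *s h 3" "\<epsilon> \<noteq> 0" "\<zeta> \<noteq> 0"
    using block_combination[OF L, of 1 3 5] T by auto
  define x y z where "x = (- \<delta> / \<gamma>) *s h 3" and "y = (- \<beta> / \<alpha>) *s h 1" and "z = h 0"
  define e f where "e = - \<zeta> * \<gamma> / \<delta>" and "f = - \<epsilon> * \<alpha> / \<beta>"
  have h2: "(- 1 / \<alpha>) *s h 2 = y - z" and h4: "(- 1 / \<gamma>) *s h 4 = x - z"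
    using ab cd by (simp_all add: x_def y_def z_def vec_eq_iff field_simps)
  have h5: "h 5 = e *s x + f *s y"
    using ab cd ez by (simp add: x_def y_def e_def f_def vec_eq_iff)
  have D: "det3 (h 3) (h 1) (h 0) \<noteq> 0" using labelled_det3[OF L, of 3 1 0] T by simp
  then have D': "det3 x y z \<noteq> 0" using ab cd by (simp add: x_def y_def z_def det3_linear det3_minus)
  have "det3 (h 2) (h 4) (h 5) = 0" using labelled_det3[OF L, of 2 4 5] T by simp
  then have "det3 ((- 1 / \<alpha>) *s h 2) ((- 1 / \<gamma>) *s h 4) (h 5) = 0" by (simp add: det3_linear det3_minus)
  then have "det3 (y - z) (x - z) (e *s x + f *s y) = 0" unfolding h2 h4 h5 .
  moreover have "det3 (y - z) (x - z) (e *s x + f *s y) = - (e + f) * det3 x y z"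
    by (simp add: det3_def dot_def algebra_simps)
  ultimately have "f = - e" using D' by (simp add: add_eq_0_iff2 eq_neg_iff_add_eq_0)
  moreover have e: "e \<noteq> 0" using ez cd by (simp add: e_def)
  ultimately have h5': "(1 / e) *s h 5 = x - y" by (simp add: h5 vec_eq_iff field_simps)
  let ?c = "\<lambda>k::nat. [1, - \<beta> / \<alpha>, - 1 / \<alpha>, - \<delta> / \<gamma>, - 1 / \<gamma>, 1 / e, 1] ! k"
  have "?c k \<noteq> 0" if "k < 7" for k
  proof -
    have "k \<in> {0,1,2,3,4,5,6}" using that by auto
    then show ?thesis using ab cd e by auto
  qed
  moreover have "?c 0 *s h 0 = z" "?c 1 *s h 1 = y" "?c 2 *s h 2 = y - z" "?c 3 *s h 3 = x"
    "?c 4 *s h 4 = x - z" "?c 5 *s h 5 = x - y"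
    using h2 h4 h5' by (simp_all add: x_def y_def z_def)
  ultimately show ?thesis using D' by (intro exI[of _ ?c] exI[of _ x] exI[of _ y] exI[of _ z]) blast
qed

lemma quadrilateral_of_labelled:
  assumes L: "labelled W h T"
    and T: "T = quad \<or> T = quad \<union> {{6,0,5}} \<or> T = quad \<union> {{6,0,5},{6,1,4}}"
  shows "\<exists>x y z h' l. quadrilateral x y z h' l T \<and> AR (form (h' ` {0..<7})) = AR (form W)"
proof -
  have "{0,1,2} \<in> T" "{0,3,4} \<in> T" "{1,3,5} \<in> T" "{2,4,5} \<in> T" using T by blast+
  moreover have "{3,1,0} \<notin> T" using T by (elim disjE; hypsubst; code_simp)
  ultimately obtain c :: "nat \<Rightarrow> complex" and x y z where c: "\<forall>k<7. c k \<noteq> 0" "det3 x y z \<noteq> 0" "c 0 *s h 0 = z" "c 1 *s h 1 = y"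
    "c 2 *s h 2 = y - z" "c 3 *s h 3 = x" "c 4 *s h 4 = x - z" "c 5 *s h 5 = x - y"
    using quadrilateral_normal_form[OF L] by metis
  define h' where "h' k = c k *s h k" for k
  have 1: "labelled (h' ` {0..<7}) h' T" "AR (form (h' ` {0..<7})) = AR (form W)"
    using labelled_scale[OF L, of c h'] c(1) by (simp_all add: h'_def)
  have "quadrilateral x y z h' (h' 6) T"
    by unfold_locales (use c T 1 in \<open>simp_all add: h'_def\<close>)
  then show ?thesis using 1(2) by blast
qed

text \<open>The relation of the triple point \<open>024\<close> is scaled to \<open>h 0 + h 2 + h 4 = 0\<close>.  Each parallel line then differs
  from its partner by a multiple of the line at infinity, and concurrency in \<open>135\<close> makes these
  multiples add up to zero.\<close>

lemma grid_normal_form: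
  assumes L: "labelled W h grid"
  shows "\<exists>x y z h' s t r. three_directions x y z h' s t r \<and> AR (form (h' ` {0..<7})) = AR (form W)"
proof -
  have m: "{6,0,1} \<in> grid" "{6,2,3} \<in> grid" "{6,4,5} \<in> grid" "{0,2,4} \<in> grid" "{1,3,5} \<in> grid"
    "{0,2,6} \<notin> grid" "{1,3,6} \<notin> grid"
    by code_simp+
  obtain \<alpha> \<beta> where ab: "h 4 = \<alpha> *s h 0 + \<beta> *s h 2" "\<alpha> \<noteq> 0" "\<beta> \<noteq> 0"
    by (rule block_combination[OF L _ _ _ _ _ _ m(4)]) simp_all
  obtain \<gamma>1 \<delta>1 where 1: "h 1 = \<gamma>1 *s h 6 + \<delta>1 *s h 0" "\<gamma>1 \<noteq> 0" "\<delta>1 \<noteq> 0"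
    by (rule block_combination[OF L _ _ _ _ _ _ m(1)]) simp_all
  obtain \<gamma>3 \<delta>3 where 3: "h 3 = \<gamma>3 *s h 6 + \<delta>3 *s h 2" "\<gamma>3 \<noteq> 0" "\<delta>3 \<noteq> 0"
    by (rule block_combination[OF L _ _ _ _ _ _ m(2)]) simp_all
  obtain \<gamma>5 \<delta>5 where 5: "h 5 = \<gamma>5 *s h 6 + \<delta>5 *s h 4" "\<gamma>5 \<noteq> 0" "\<delta>5 \<noteq> 0"
    by (rule block_combination[OF L _ _ _ _ _ _ m(3)]) simp_all
  define z where "z = h 6"
  define s t r where "s = \<alpha> * \<gamma>1 / (2 * \<delta>1)" and "t = \<beta> * \<gamma>3 / (2 * \<delta>3)" and "r = - \<gamma>5 / (2 * \<delta>5)"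
  define x y where "x = - (\<alpha> *s h 0) - s *s z" and "y = - (\<beta> *s h 2) - t *s z"
  have h0: "(- \<alpha>) *s h 0 = x + s *s z" and h2: "(- \<beta>) *s h 2 = y + t *s z"
    by (simp_all add: x_def y_def)
  have h1: "(- \<alpha> / \<delta>1) *s h 1 = x - s *s z" and h3: "(- \<beta> / \<delta>3) *s h 3 = y - t *s z"
    and h5: "(1 / \<delta>5) *s h 5 = h 4 - (2 * r) *s z"
    using 1(2,3) 3(2,3) 5(2,3)
    by (simp_all add: 1(1)[unfolded One_nat_def] 3(1) 5(1) x_def y_def s_def t_def r_def z_def vec_eq_iff field_simps)
  have h4: "h 4 = - (x + y) - (s + t) *s z"
    by (simp add: ab(1) x_def y_def vec_eq_iff algebra_simps)
  have "det3 (h 1) (h 3) (h 5) = 0" "det3 (h 1) (h 3) (h 6) \<noteq> 0" "det3 (h 0) (h 2) (h 6) \<noteq> 0"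
    using labelled_det3[OF L, of 1 3 5] labelled_det3[OF L, of 1 3 6] labelled_det3[OF L, of 0 2 6] m
    by simp_all
  then have d: "det3 ((- \<alpha> / \<delta>1) *s h 1) ((- \<beta> / \<delta>3) *s h 3) ((1 / \<delta>5) *s h 5) = 0"
    "det3 ((- \<alpha> / \<delta>1) *s h 1) ((- \<beta> / \<delta>3) *s h 3) z \<noteq> 0"
    "det3 ((- \<alpha>) *s h 0) ((- \<beta>) *s h 2) z \<noteq> 0"
    using ab(2,3) 1(2,3) 3(2,3) 5(2,3) by (simp_all add: det3_linear det3_minus z_def)
  have "det3 (x - s *s z) (y - t *s z) (h 4 - (2 * r) *s z) =
      - 2 * (s + t + r) * det3 (x - s *s z) (y - t *s z) z"
    unfolding h4 by (simp add: det3_def dot_def algebra_simps)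
  then have "- 2 * (s + t + r) = 0"
    using d(1,2) unfolding h1 h3 h5 by (metis mult_eq_0_iff)
  then have "s + t + r = 0" by (metis mult_eq_0_iff neg_equal_0_iff_equal zero_neq_numeral)
  then have "r + (s + t) = 0" by (simp only: ac_simps)
  then have r: "r = - (s + t)" by (simp only: eq_neg_iff_add_eq_0)
  have "det3 x y z = det3 (x + s *s z) (y + t *s z) z"
    by (simp add: det3_def dot_def algebra_simps)
  then have D: "det3 x y z \<noteq> 0" using d(3) unfolding h0 h2 by simp
  let ?c = "\<lambda>k::nat. [- \<alpha>, - \<alpha> / \<delta>1, - \<beta>, - \<beta> / \<delta>3, 1, 1 / \<delta>5, 1] ! k"
  define h' where "h' k = ?c k *s h k" for k
  have "?c k \<noteq> 0" if "k < 7" for k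
  proof -
    have "k \<in> {0,1,2,3,4,5,6}" using that by auto
    then show ?thesis using ab 1 3 5 by auto
  qed
  then have L': "labelled (h' ` {0..<7}) h' grid" "AR (form (h' ` {0..<7})) = AR (form W)"
    using labelled_scale[OF L, of ?c h'] by (simp_all add: h'_def)
  have "three_directions x y z h' s t r"
  proof
    show "det3 x y z \<noteq> 0" by (rule D)
    show "r = - (s + t)" by (rule r)
    show "labelled (h' ` {0..<7}) h' grid" by (rule L'(1))
    show "h' 0 = x + s *s z" "h' 1 = x - s *s z" "h' 2 = y + t *s z" "h' 3 = y - t *s z" "h' 6 = z"
      using h0 h1 h2 h3 by (simp_all add: h'_def z_def)
    show "h' 4 = r *s z - (x + y)" by (simp add: h'_def h4 r vec_eq_iff algebra_simps)
    show "h' 5 = - (r *s z) - (x + y)"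
      using h5 by (simp add: h'_def h4 r vec_eq_iff algebra_simps)
  qed
  then show ?thesis using L'(2) by blast
qed

lemma grid_labelled_exponents:
  assumes "labelled W h grid" "AR (defining_poly A) = AR (form W)"
  shows "has_exponents A [3, 4, 4]"
proof -
  obtain x y z h' s t r where "three_directions x y z h' s t r" "AR (form (h' ` {0..<7})) = AR (form W)"
    using grid_normal_form[OF assms(1)] by blast
  then show ?thesis using three_directions.grid_exponents[of x y z h' s t r A] assms(2) by simp
qed

lemma quadrilateral_exponents:
  assumes "labelled W h quad" "AR (defining_poly A) = AR (form W)"
  shows "has_exponents A [3, 4, 5]"
proof -
  obtain x y z h' l where q: "quadrilateral x y z h' l quad" "AR (form (h' ` {0..<7})) = AR (form W)"
    using quadrilateral_of_labelled[OF assms(1) disjI1[OF refl]] by blast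
  show ?thesis using quadrilateral.quadrilateral_and_line[OF q(1), of A] assms(2) q(2) by simp
qed

lemma quadrilateral_one_point_exponents:
  assumes "labelled W h (quad \<union> {{6,0,5}})" "AR (defining_poly A) = AR (form W)"
  shows "has_exponents A [3, 4, 4]"
proof -
  obtain x y z h' l where q: "quadrilateral x y z h' l (quad \<union> {{6,0,5}})" "AR (form (h' ` {0..<7})) = AR (form W)"
    using quadrilateral_of_labelled[OF assms(1) disjI2[OF disjI1[OF refl]]] by blast
  have "quad \<union> {{6,0,5}} \<noteq> quad" by code_simp
  then show ?thesis
    using quadrilateral.quadrilateral_and_line[OF q(1), of A] assms(2) q(2) by simp
qed

lemma quadrilateral_two_points_exponents:
  assumes "labelled W h (quad \<union> {{6,0,5},{6,1,4}})" "AR (defining_poly A) = AR (form W)"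
  shows "has_exponents A [3, 3]" "free_arrangement A"
proof -
  obtain x y z h' l where q: "quadrilateral x y z h' l (quad \<union> {{6,0,5},{6,1,4}})" "AR (form (h' ` {0..<7})) = AR (form W)"
    using quadrilateral_of_labelled[OF assms(1) disjI2[OF disjI2[OF refl]]] by blast
  show "has_exponents A [3, 3]" "free_arrangement A"
    using quadrilateral.quadrilateral_and_two_points[OF q(1), of A] assms(2) q(2) by simp_all
qed

text \<open>In characteristic other than two the diagonal points of a quadrilateral are not collinear.\<close>

lemma not_fano: "\<not> labelled W h (quad \<union> {{6,0,5},{6,1,4},{6,2,3}})" (is "\<not> labelled W h ?T")
proof
  assume L: "labelled W h ?T"
  have m: "{0,1,2} \<in> ?T" "{0,3,4} \<in> ?T" "{1,3,5} \<in> ?T" "{2,4,5} \<in> ?T" "{3,1,0} \<notin> ?T"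
    by code_simp+
  obtain c :: "nat \<Rightarrow> complex" and x y z where c: "\<forall>k<7. c k \<noteq> 0" "det3 x y z \<noteq> 0" "c 0 *s h 0 = z" "c 1 *s h 1 = y"
    "c 2 *s h 2 = y - z" "c 3 *s h 3 = x" "c 4 *s h 4 = x - z" "c 5 *s h 5 = x - y"
    using quadrilateral_normal_form[OF L m] by blast
  define l where "l = h 6"
  have "{6,0,5} \<in> ?T" "{6,1,4} \<in> ?T" "{6,2,3} \<in> ?T" by code_simp+
  then have "det3 l (h 0) (h 5) = 0" "det3 l (h 1) (h 4) = 0" "det3 l (h 2) (h 3) = 0"
    using labelled_det3[OF L, of 6 0 5] labelled_det3[OF L, of 6 1 4] labelled_det3[OF L, of 6 2 3]
    by (simp_all add: l_def)
  then have "det3 l (c 0 *s h 0) (c 5 *s h 5) = 0" "det3 l (c 1 *s h 1) (c 4 *s h 4) = 0"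
    "det3 l (c 2 *s h 2) (c 3 *s h 3) = 0"
    by (simp_all only: det3_linear mult_zero_right)
  then have "det3 l z (x - y) = 0" "det3 l y (x - z) = 0" "det3 l (y - z) x = 0"
    unfolding c .
  moreover have "det3 l z (x - y) = dot l (vcross z x) + dot l (vcross y z)"
    "det3 l y (x - z) = - dot l (vcross x y) - dot l (vcross y z)"
    "det3 l (y - z) x = - dot l (vcross x y) - dot l (vcross z x)"
    by (simp_all add: det3_def dot_def algebra_simps)
  ultimately have 0: "dot l (vcross z x) = 0" "dot l (vcross y z) = 0" "dot l (vcross x y) = 0"
    by (simp_all add: add_eq_0_iff neg_eq_iff_add_eq_0)
  have "det3 x y z * dot l v =
      dot x v * dot l (vcross y z) + dot y v * dot l (vcross z x) + dot z v * dot l (vcross x y)" for v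
    by (simp add: det3_def dot_def algebra_simps)
  then have "dot l v = 0" for v using 0 c(2) by simp
  moreover have "l \<noteq> 0"
    using triple_configD(5)[OF labelledD(1)[OF L]] labelledD(3)[OF L, of 6] by (auto simp: l_def)
  ultimately show False using exists_dot_1 by force
qed

section \<open>Systems of triples on seven elements\<close>

definition triple_system :: "'a set \<Rightarrow> 'a set set \<Rightarrow> bool" where
  "triple_system V T \<longleftrightarrow> finite V \<and> (\<forall>B\<in>T. B \<subseteq> V \<and> card B = 3) \<and>
     (\<forall>B\<in>T. \<forall>C\<in>T. B \<noteq> C \<longrightarrow> card (B \<inter> C) \<le> 1)"

definition labelling :: "'a set \<Rightarrow> 'a set set \<Rightarrow> (nat \<Rightarrow> 'a) \<Rightarrow> nat set set \<Rightarrow> bool" where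
  "labelling V T h T0 \<longleftrightarrow> bij_betw h {0..<7} V \<and> T = (`) h ` T0"

lemma triple_systemD:
  assumes "triple_system V T"
  shows "finite V" "B \<in> T \<Longrightarrow> B \<subseteq> V" "B \<in> T \<Longrightarrow> card B = 3" "B \<in> T \<Longrightarrow> finite B" "finite T"
    "B \<in> T \<Longrightarrow> C \<in> T \<Longrightarrow> x \<in> B \<Longrightarrow> x \<in> C \<Longrightarrow> y \<in> B \<Longrightarrow> y \<in> C \<Longrightarrow> x \<noteq> y \<Longrightarrow> B = C"
proof -
  show f: "finite V" using assms by (simp add: triple_system_def)
  show "B \<in> T \<Longrightarrow> B \<subseteq> V" "B \<in> T \<Longrightarrow> card B = 3" using assms by (simp_all add: triple_system_def)
  then show fB: "B \<in> T \<Longrightarrow> finite B" using f finite_subset by blast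
  have "T \<subseteq> Pow V" using assms by (auto simp: triple_system_def)
  then show "finite T" using f finite_subset by blast
  show "B = C" if a: "B \<in> T" "C \<in> T" "x \<in> B" "x \<in> C" "y \<in> B" "y \<in> C" "x \<noteq> y"
  proof (rule ccontr)
    assume "B \<noteq> C"
    then have "card (B \<inter> C) \<le> 1" using assms a by (simp add: triple_system_def)
    moreover have "card {x, y} \<le> card (B \<inter> C)" using a fB by (intro card_mono) auto
    ultimately show False using a by simp
  qed
qed

lemma labelling_nth:
  assumes "distinct xs" "length xs = 7" "set xs = V" "T = (`) ((!) xs) ` T0"
  shows "\<exists>h. labelling V T h T0"
  unfolding labelling_def
proof (intro exI conjI)
  show "bij_betw ((!) xs) {0..<7} V"
    using assms by (intro bij_betw_nth) auto
qed (rule assms)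

lemma complete_list:
  assumes "finite V" "distinct xs" "set xs \<subseteq> V"
  obtains ys where "distinct (xs @ ys)" "set (xs @ ys) = V" "length (xs @ ys) = card V"
proof -
  obtain ys where ys: "set ys = V - set xs" "distinct ys"
    using finite_distinct_list[of "V - set xs"] assms(1) by auto
  then have "distinct (xs @ ys)" "set (xs @ ys) = V" using assms by auto
  then show ?thesis using that distinct_card by metis
qed

lemma labelling_prefix:
  assumes "finite V" "card V = 7" "distinct xs" "set xs \<subseteq> V"
    and "\<And>ys. T = (`) ((!) (xs @ ys)) ` T0"
  shows "\<exists>h. labelling V T h T0"
proof -
  obtain ys where "distinct (xs @ ys)" "set (xs @ ys) = V" "length (xs @ ys) = card V"
    using complete_list[OF assms(1,3,4)] .
  then show ?thesis using assms(2) by (intro labelling_nth[of "xs @ ys"] assms(5)) simp_all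
qed

lemma triple_with:
  assumes "card B = 3" "x \<in> B"
  obtains y z where "B = {x, y, z}" "x \<noteq> y" "x \<noteq> z" "y \<noteq> z"
proof -
  have "card (B - {x}) = 2" using assms by (simp add: card_Diff_singleton_if)
  then obtain y z where "B - {x} = {y, z}" "y \<noteq> z" by (auto simp: card_2_iff)
  then show ?thesis using that[of y z] assms(2) by blast
qed

lemma triple_with2:
  assumes "card B = 3" "x \<in> B" "y \<in> B" "x \<noteq> y"
  obtains z where "B = {x, y, z}" "x \<noteq> z" "y \<noteq> z"
proof -
  obtain u v where u: "B = {x, u, v}" "x \<noteq> u" "x \<noteq> v" "u \<noteq> v" using triple_with[OF assms(1,2)] .
  then show ?thesis using that[of u] that[of v] assms(3,4) by auto
qed

lemma two_triples:
  assumes T: "triple_system V T" and BC: "B \<in> T" "C \<in> T" "B \<noteq> C"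
  obtains "B \<inter> C = {}"
  | a b c d e where "B = {a,b,c}" "C = {a,d,e}" "distinct [a,b,c,d,e]"
proof (cases "B \<inter> C = {}")
  case False
  then obtain a where a: "a \<in> B" "a \<in> C" by blast
  obtain b c where b: "B = {a,b,c}" "a \<noteq> b" "a \<noteq> c" "b \<noteq> c"
    using triple_with[OF triple_systemD(3)[OF T BC(1)] a(1)] .
  obtain d e where d: "C = {a,d,e}" "a \<noteq> d" "a \<noteq> e" "d \<noteq> e"
    using triple_with[OF triple_systemD(3)[OF T BC(2)] a(2)] .
  have "x \<notin> C" if "x \<in> {b, c}" for x
    using triple_systemD(6)[OF T BC(1,2) a, of x] that b BC(3) by auto
  then show ?thesis using that(2)[OF b(1) d(1)] b d by auto
qed (use that in blast)

text \<open>Two disjoint triples leave only one further element, so a third triple meets both of them.\<close>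

lemma disjoint_triples_joined:
  assumes T: "triple_system V T" "card V \<le> 7" and BCD: "B \<in> T" "C \<in> T" "D \<in> T" "B \<inter> C = {}" "D \<noteq> B" "D \<noteq> C"
  obtains a b c d e f g where "distinct [a,b,c,d,e,f,g]" "D = {a,b,c}" "B = {a,d,e}" "C = {b,f,g}"
proof -
  have c3: "card B = 3" "card C = 3" "card D = 3" and fin: "finite B" "finite C" "finite D"
    using triple_systemD[OF T(1)] BCD by blast+
  have "card (B \<union> C) = 6" using c3 fin BCD(4) by (simp add: card_Un_disjoint)
  moreover have "card (D - (B \<union> C)) + card (B \<union> C) \<le> card V"
  proof -
    have "card (D - (B \<union> C)) + card (B \<union> C) = card ((D - (B \<union> C)) \<union> (B \<union> C))"
      using fin by (intro card_Un_disjoint[symmetric]) auto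
    also have "\<dots> \<le> card V"
      using triple_systemD[OF T(1)] BCD by (intro card_mono) blast+
    finally show ?thesis .
  qed
  ultimately have r: "card (D - (B \<union> C)) \<le> 1" using T(2) by simp
  have i: "card (D \<inter> B) \<le> 1" "card (D \<inter> C) \<le> 1"
    using T(1) BCD by (auto simp: triple_system_def)
  have "D = (D \<inter> B) \<union> ((D \<inter> C) \<union> (D - (B \<union> C)))" by blast
  then have "card D \<le> card (D \<inter> B) + card ((D \<inter> C) \<union> (D - (B \<union> C)))" by (metis card_Un_le)
  also have "\<dots> \<le> card (D \<inter> B) + (card (D \<inter> C) + card (D - (B \<union> C)))"
    by (intro add_left_mono card_Un_le)
  finally have "card (D \<inter> B) \<noteq> 0" "card (D \<inter> C) \<noteq> 0" using c3 r i by auto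
  then have ne: "D \<inter> B \<noteq> {}" "D \<inter> C \<noteq> {}" by auto
  then obtain a b where ab: "a \<in> D" "a \<in> B" "b \<in> D" "b \<in> C" by blast
  then have "a \<noteq> b" using BCD(4) by blast
  then obtain c where c: "D = {a,b,c}" "a \<noteq> c" "b \<noteq> c" using triple_with2[OF c3(3) ab(1,3)] by blast
  obtain d e where d: "B = {a,d,e}" "a \<noteq> d" "a \<noteq> e" "d \<noteq> e" using triple_with[OF c3(1) ab(2)] .
  obtain f g where f: "C = {b,f,g}" "b \<noteq> f" "b \<noteq> g" "f \<noteq> g" using triple_with[OF c3(2) ab(4)] .
  have "c \<notin> B" using triple_systemD(6)[OF T(1) BCD(3,1) ab(1,2), of c] c BCD(5) by auto
  moreover have "c \<notin> C" using triple_systemD(6)[OF T(1) BCD(3,2) ab(3,4), of c] c BCD(6) by auto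
  ultimately have "distinct [a,b,c,d,e,f,g]" using c d f BCD(4) by auto
  then show ?thesis using that c d f by blast
qed

lemma three_triples:
  assumes T: "triple_system V T" "card V \<le> 7"
    and BCD: "B \<in> T" "C \<in> T" "D \<in> T" "B \<noteq> C" "B \<noteq> D" "C \<noteq> D"
  obtains (path) a b c d e f g where "distinct [a,b,c,d,e,f,g]" "{B,C,D} = {{a,b,c},{a,d,e},{b,f,g}}"
  | (star) a b c d e f g where "distinct [a,b,c,d,e,f,g]" "{B,C,D} = {{a,b,c},{a,d,e},{a,f,g}}"
  | (triangle) a b c d e f where "distinct [a,b,c,d,e,f]" "{B,C,D} = {{a,b,c},{a,d,e},{b,d,f}}"
proof -
  note u = triple_systemD(6)[OF T(1)]
  consider "B \<inter> C = {}" | "B \<inter> D = {}" | "C \<inter> D = {}" | "B \<inter> C \<noteq> {}" "B \<inter> D \<noteq> {}" "C \<inter> D \<noteq> {}"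
    by blast
  then show thesis
  proof cases
    case 1
    obtain a b c d e f g where 1: "distinct [a,b,c,d,e,f,g]" "D = {a,b,c}" "B = {a,d,e}" "C = {b,f,g}"
      using disjoint_triples_joined[OF T BCD(1,2,3) 1 BCD(5)[symmetric] BCD(6)[symmetric]] .
    have "{B,C,D} = {D,B,C}" by blast
    then show ?thesis using path[OF 1(1)] 1(2-4) by simp
  next
    case 2
    obtain a b c d e f g where 1: "distinct [a,b,c,d,e,f,g]" "C = {a,b,c}" "B = {a,d,e}" "D = {b,f,g}"
      using disjoint_triples_joined[OF T BCD(1,3,2) 2 BCD(4)[symmetric] BCD(6)] .
    have "{B,C,D} = {C,B,D}" by blast
    then show ?thesis using path[OF 1(1)] 1(2-4) by simp
  next
    case 3
    obtain a b c d e f g where 1: "distinct [a,b,c,d,e,f,g]" "B = {a,b,c}" "C = {a,d,e}" "D = {b,f,g}"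
      using disjoint_triples_joined[OF T BCD(2,3,1) 3 BCD(4) BCD(5)] .
    then show ?thesis using path[OF 1(1)] 1(2-4) by simp
  next
    case 4
    then obtain a where a: "a \<in> B" "a \<in> C" by blast
    show ?thesis
    proof (cases "a \<in> D")
      case True
      obtain b c where b: "B = {a,b,c}" "a \<noteq> b" "a \<noteq> c" "b \<noteq> c"
        using triple_with[OF triple_systemD(3)[OF T(1) BCD(1)] a(1)] .
      obtain d e where d: "C = {a,d,e}" "a \<noteq> d" "a \<noteq> e" "d \<noteq> e"
        using triple_with[OF triple_systemD(3)[OF T(1) BCD(2)] a(2)] .
      obtain f g where f: "D = {a,f,g}" "a \<noteq> f" "a \<noteq> g" "f \<noteq> g"
        using triple_with[OF triple_systemD(3)[OF T(1) BCD(3)] True] .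
      have "x \<notin> C \<and> x \<notin> D" if "x \<in> {b,c}" for x
        using u[OF BCD(1,2) a, of x] u[OF BCD(1,3) a(1) True, of x] that b BCD by auto
      moreover have "x \<notin> D" if "x \<in> {d,e}" for x
        using u[OF BCD(2,3) a(2) True, of x] that d BCD by auto
      ultimately have "distinct [a,b,c,d,e,f,g]" using b d f by auto
      from star[OF this] show ?thesis using b d f by simp
    next
      case False
      obtain b where b: "b \<in> B" "b \<in> D" using 4 by blast
      obtain d where d: "d \<in> C" "d \<in> D" using 4 by blast
      have ab: "a \<noteq> b" "a \<noteq> d" using False b d by auto
      have bC: "b \<notin> C" using u[OF BCD(1,2) a b(1)] ab BCD by auto
      have dB: "d \<notin> B" using u[OF BCD(1,2) a _ d(1)] ab BCD by auto
      have bd: "b \<noteq> d" using bC d by auto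
      obtain c where c: "B = {a,b,c}" "a \<noteq> c" "b \<noteq> c"
        using triple_with2[OF triple_systemD(3)[OF T(1) BCD(1)] a(1) b(1) ab(1)] .
      obtain e where e: "C = {a,d,e}" "a \<noteq> e" "d \<noteq> e"
        using triple_with2[OF triple_systemD(3)[OF T(1) BCD(2)] a(2) d(1) ab(2)] .
      obtain f where f: "D = {b,d,f}" "b \<noteq> f" "d \<noteq> f"
        using triple_with2[OF triple_systemD(3)[OF T(1) BCD(3)] b(2) d(2) bd] .
      have "c \<notin> C" using u[OF BCD(1,2) a, of c] c BCD by auto
      moreover have "f \<notin> B" using u[OF BCD(1,3) b, of f] f BCD by auto
      moreover have "f \<notin> C" using u[OF BCD(2,3) d, of f] f BCD by auto
      ultimately have "distinct [a,b,c,d,e,f]" using ab bC dB bd c e f by auto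
      from triangle[OF this] show ?thesis using c e f by simp
    qed
  qed
qed

text \<open>The other two shapes of three triples use seven elements.\<close>

lemma triangle_on_six:
  assumes T: "triple_system V T" "card V = 6"
    and BCD: "B \<in> T" "C \<in> T" "D \<in> T" "B \<noteq> C" "B \<noteq> D" "C \<noteq> D"
  obtains a b c d e f where "distinct [a,b,c,d,e,f]" "V = {a,b,c,d,e,f}" "{B,C,D} = {{a,b,c},{a,d,e},{b,d,f}}"
proof -
  have fin: "finite V" using triple_systemD(1)[OF T(1)] .
  have sub: "B \<union> C \<union> D \<subseteq> V" using triple_systemD(2)[OF T(1)] BCD by blast
  have U: "\<Union>{B,C,D} \<subseteq> V" using sub by blast
  have big: False if "distinct [a,b,c,d,e,f,g]" "{a,b,c,d,e,f,g} \<subseteq> V" for a b c d e f g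
    using card_mono[OF fin that(2)] that(1) T(2) by simp
  have le: "card V \<le> 7" using T(2) by simp
  show thesis
  proof (cases rule: three_triples[OF T(1) le BCD])
    case (1 a b c d e f g)
    then have "{a,b,c,d,e,f,g} \<subseteq> V" using U by (simp add: 1(2))
    then show ?thesis using big 1(1) by blast
  next
    case (2 a b c d e f g)
    then have "{a,b,c,d,e,f,g} \<subseteq> V" using U by (simp add: 2(2))
    then show ?thesis using big 2(1) by blast
  next
    case (3 a b c d e f)
    then have "{a,b,c,d,e,f} \<subseteq> V" using U by (simp add: 3(2))
    moreover have "card {a,b,c,d,e,f} = 6" using 3(1) by simp
    ultimately have "{a,b,c,d,e,f} = V" using fin T(2) by (intro card_subset_eq) auto
    then show ?thesis using that 3 by blast
  qed
qed

text \<open>A further triple meets each of the three in at most one element, so containing \<open>a\<close>, \<open>b\<close> or \<open>d\<close> would leave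
  it only one other element.\<close>

lemma fourth_triple:
  assumes T: "triple_system V T" and d: "distinct [a,b,c,d,e,f]" and V: "V = {a,b,c,d,e,f}"
    and B: "{a,b,c} \<in> T" "{a,d,e} \<in> T" "{b,d,f} \<in> T"
    and E: "E \<in> T" "E \<notin> {{a,b,c},{a,d,e},{b,d,f}}"
  shows "E = {c,e,f}"
proof -
  note u = triple_systemD(6)[OF T E(1)]
  have cE: "card E = 3" and sub: "E \<subseteq> {a,b,c,d,e,f}"
    using triple_systemD(2,3)[OF T E(1)] V by auto
  have pair: "E \<subseteq> {p, q} \<Longrightarrow> False" for p q
  proof -
    assume "E \<subseteq> {p, q}"
    then have "card E \<le> card {p, q}" by (intro card_mono) auto
    also have "\<dots> \<le> 2" by (simp add: card_insert_if)
    finally show False using cE by simp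
  qed
  have "a \<notin> E"
  proof
    assume "a \<in> E"
    then have "b \<notin> E \<and> c \<notin> E" "d \<notin> E \<and> e \<notin> E"
      using u[OF B(1), of a] u[OF B(2), of a] d E(2) by auto
    then have "E \<subseteq> {a, f}" using sub by blast
    then show False by (rule pair)
  qed
  moreover have "b \<notin> E"
  proof
    assume "b \<in> E"
    then have "a \<notin> E \<and> c \<notin> E" "d \<notin> E \<and> f \<notin> E"
      using u[OF B(1), of b] u[OF B(3), of b] d E(2) by auto
    then have "E \<subseteq> {b, e}" using sub by blast
    then show False by (rule pair)
  qed
  moreover have "d \<notin> E"
  proof
    assume "d \<in> E"
    then have "a \<notin> E \<and> e \<notin> E" "b \<notin> E \<and> f \<notin> E"
      using u[OF B(2), of d] u[OF B(3), of d] d E(2) by auto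
    then have "E \<subseteq> {d, c}" using sub by blast
    then show False by (rule pair)
  qed
  ultimately have "E \<subseteq> {c,e,f}" using sub by blast
  moreover have "card {c,e,f} = 3" using d by simp
  ultimately show ?thesis using cE by (intro card_subset_eq) auto
qed

lemma labelling_one:
  assumes T: "triple_system V T" "card V = 7" "card T = 1"
  shows "\<exists>h. labelling V T h {{0,1,2}}"
proof -
  obtain B where B: "T = {B}" using T(3) by (auto simp: card_1_singleton_iff)
  have c: "card B = 3" "B \<subseteq> V" using triple_systemD(2,3)[OF T(1)] B by auto
  then obtain x where "x \<in> B" by fastforce
  from triple_with[OF c(1) this] obtain b c where "B = {x,b,c}" "x \<noteq> b" "x \<noteq> c" "b \<noteq> c" .
  then show ?thesis
    using triple_systemD(1)[OF T(1)] T(2) c(2) B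
    by (intro labelling_prefix[of V "[x,b,c]"]) auto
qed

lemma labelling_two:
  assumes T: "triple_system V T" "card V = 7" "card T = 2"
  shows "(\<exists>h. labelling V T h {{0,1,2},{0,3,4}}) \<or> (\<exists>h. labelling V T h {{0,1,2},{3,4,5}})"
proof -
  obtain B C where B: "T = {B,C}" "B \<noteq> C" using T(3) by (auto simp: card_2_iff)
  have BC: "B \<in> T" "C \<in> T" using B by auto
  have sub: "B \<subseteq> V" "C \<subseteq> V" and c: "card B = 3" "card C = 3"
    using triple_systemD(2,3)[OF T(1)] BC by auto
  note fin = triple_systemD(1)[OF T(1)]
  show ?thesis
  proof (cases rule: two_triples[OF T(1) BC B(2)])
    case 1
    obtain x y where "x \<in> B" "y \<in> C" using c by fastforce
    from triple_with[OF c(1) this(1)] triple_with[OF c(2) this(2)]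
    obtain a b d e where bd: "B = {x,a,b}" "x \<noteq> a" "x \<noteq> b" "a \<noteq> b" "C = {y,d,e}" "y \<noteq> d" "y \<noteq> e" "d \<noteq> e"
      by metis
    have "\<exists>h. labelling V T h {{0,1,2},{3,4,5}}"
    proof (rule labelling_prefix[OF fin T(2), of "[x,a,b,y,d,e]"])
      show "distinct [x,a,b,y,d,e]" using 1 bd by auto
      show "set [x,a,b,y,d,e] \<subseteq> V" using sub bd by auto
    qed (simp add: B bd)
    then show ?thesis ..
  next
    case (2 a b c d e)
    have "\<exists>h. labelling V T h {{0,1,2},{0,3,4}}"
    proof (rule labelling_prefix[OF fin T(2), of "[a,b,c,d,e]"])
      show "set [a,b,c,d,e] \<subseteq> V" using sub 2 by auto
    qed (use B 2 in simp_all)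
    then show ?thesis ..
  qed
qed

lemma card_3_obtain:
  assumes "card T = 3"
  obtains B C D where "T = {B,C,D}" "B \<noteq> C" "B \<noteq> D" "C \<noteq> D"
  using assms by (auto simp: card_3_iff)

lemma labelling_three:
  assumes T: "triple_system V T" "card V = 7" "card T = 3"
  shows "(\<exists>h. labelling V T h {{0,1,2},{0,3,4},{1,3,5}}) \<or>
    (\<exists>h. labelling V T h {{0,1,2},{0,3,4},{0,5,6}}) \<or> (\<exists>h. labelling V T h {{0,1,2},{0,3,4},{1,5,6}})"
proof -
  obtain B C D where B: "T = {B,C,D}" "B \<noteq> C" "B \<noteq> D" "C \<noteq> D" using card_3_obtain[OF T(3)] .
  have BCD: "B \<in> T" "C \<in> T" "D \<in> T" using B by auto
  note fin = triple_systemD(1)[OF T(1)]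
  have sub: "\<Union>T \<subseteq> V" using triple_systemD(2)[OF T(1)] by blast
  have le: "card V \<le> 7" using T(2) by simp
  show ?thesis
  proof (cases rule: three_triples[OF T(1) le BCD B(2-4)])
    case (1 a b c d e f g)
    then have "\<Union>{{a,b,c},{a,d,e},{b,f,g}} \<subseteq> V" using sub B(1) by metis
    then have "\<exists>h. labelling V T h {{0,1,2},{0,3,4},{1,5,6}}"
      using 1 B(1) by (intro labelling_prefix[OF fin T(2), of "[a,b,c,d,e,f,g]"]) simp_all
    then show ?thesis by blast
  next
    case (2 a b c d e f g)
    then have "\<Union>{{a,b,c},{a,d,e},{a,f,g}} \<subseteq> V" using sub B(1) by metis
    then have "\<exists>h. labelling V T h {{0,1,2},{0,3,4},{0,5,6}}"
      using 2 B(1) by (intro labelling_prefix[OF fin T(2), of "[a,b,c,d,e,f,g]"]) simp_all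
    then show ?thesis by blast
  next
    case (3 a b c d e f)
    then have "\<Union>{{a,b,c},{a,d,e},{b,d,f}} \<subseteq> V" using sub B(1) by metis
    then have "\<exists>h. labelling V T h {{0,1,2},{0,3,4},{1,3,5}}"
      using 3 B(1) by (intro labelling_prefix[OF fin T(2), of "[a,b,c,d,e,f]"]) simp_all
    then show ?thesis by blast
  qed
qed

lemma delete_element:
  assumes T: "triple_system V T" "card V = 7" "g \<in> V"
  shows "triple_system (V - {g}) {B \<in> T. g \<notin> B}" "card (V - {g}) = 6"
    "card {B \<in> T. g \<notin> B} + card {B \<in> T. g \<in> B} = card T"
proof -
  show "triple_system (V - {g}) {B \<in> T. g \<notin> B}"
    using T(1) by (auto simp: triple_system_def)
  show "card (V - {g}) = 6" using T triple_systemD(1)[OF T(1)] by simp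
  have "card ({B \<in> T. g \<notin> B} \<union> {B \<in> T. g \<in> B}) = card {B \<in> T. g \<notin> B} + card {B \<in> T. g \<in> B}"
    using triple_systemD(5)[OF T(1)] by (intro card_Un_disjoint) auto
  moreover have "{B \<in> T. g \<notin> B} \<union> {B \<in> T. g \<in> B} = T" by auto
  ultimately show "card {B \<in> T. g \<notin> B} + card {B \<in> T. g \<in> B} = card T" by simp
qed

lemma three_of_many:
  assumes "finite T" "3 \<le> card T"
  obtains B C D where "B \<in> T" "C \<in> T" "D \<in> T" "B \<noteq> C" "B \<noteq> D" "C \<noteq> D"
proof -
  obtain T' where "T' \<subseteq> T" "card T' = 3" using obtain_subset_with_card_n[OF assms(2)] by metis
  then show ?thesis using that card_3_obtain[of T'] by (metis insertCI subsetD)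
qed

lemma triples_on_six:
  assumes T: "triple_system V T" "card V = 6" "3 \<le> card T"
  obtains a b c d e f where "distinct [a,b,c,d,e,f]" "V = {a,b,c,d,e,f}"
    "{{a,b,c},{a,d,e},{b,d,f}} \<subseteq> T" "T \<subseteq> {{a,b,c},{a,d,e},{b,d,f},{c,e,f}}"
proof -
  obtain B C D where B: "B \<in> T" "C \<in> T" "D \<in> T" "B \<noteq> C" "B \<noteq> D" "C \<noteq> D"
    using three_of_many[OF triple_systemD(5)[OF T(1)] T(3)] .
  obtain a b c d e f where n: "distinct [a,b,c,d,e,f]" "V = {a,b,c,d,e,f}" "{B,C,D} = {{a,b,c},{a,d,e},{b,d,f}}"
    using triangle_on_six[OF T(1,2) B] .
  have s: "{{a,b,c},{a,d,e},{b,d,f}} \<subseteq> T" using B(1-3) by (simp only: n(3)[symmetric]) simp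
  then have m: "{a,b,c} \<in> T" "{a,d,e} \<in> T" "{b,d,f} \<in> T" by simp_all
  have "T \<subseteq> {{a,b,c},{a,d,e},{b,d,f},{c,e,f}}"
  proof
    fix E assume E: "E \<in> T"
    show "E \<in> {{a,b,c},{a,d,e},{b,d,f},{c,e,f}}"
    proof (cases "E \<in> {{a,b,c},{a,d,e},{b,d,f}}")
      case False
      then have "E = {c,e,f}" by (rule fourth_triple[OF T(1) n(1,2) m E])
      then show ?thesis by simp
    qed auto
  qed
  from that[OF n(1,2) s this] show ?thesis .
qed

lemma degree_sum:
  assumes "triple_system V T"
  shows "(\<Sum>v\<in>V. card {B \<in> T. v \<in> B}) = 3 * card T"
proof -
  note D = triple_systemD[OF assms]
  have "(\<Sum>v\<in>V. card {B \<in> T. v \<in> B}) = (\<Sum>v\<in>V. \<Sum>B\<in>T. if v \<in> B then 1 else 0)"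
    using D(5) by (simp add: sum.If_cases Int_def)
  also have "\<dots> = (\<Sum>B\<in>T. \<Sum>v\<in>V. if v \<in> B then 1 else 0)" by (rule sum.swap)
  also have "\<dots> = (\<Sum>B\<in>T. 3)"
  proof (rule sum.cong[OF refl])
    fix B assume B: "B \<in> T"
    then have "V \<inter> B = B" using D(2) by blast
    then show "(\<Sum>v\<in>V. if v \<in> B then 1 else 0) = (3::nat)"
      using D(1) D(3)[OF B] by (simp add: sum.If_cases)
  qed
  finally show ?thesis by simp
qed

lemma exists_small_degree:
  assumes T: "triple_system V T" "card V = 7" and "3 * card T < 7 * k"
  shows "\<exists>g\<in>V. card {B \<in> T. g \<in> B} < k"
proof (rule ccontr)
  assume "\<not> ?thesis"
  then have "(\<Sum>v\<in>V. k) \<le> (\<Sum>v\<in>V. card {B \<in> T. v \<in> B})" by (intro sum_mono) (simp add: not_less)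
  then show False using degree_sum[OF T(1)] T(2) assms(3) by simp
qed

text \<open>Four triples avoiding \<open>g\<close> form a quadrilateral on the other six elements; a triple through \<open>g\<close> adds
  to \<open>g\<close> a pair that is not covered, that is, a pair of opposite lines.\<close>

lemma quadrilateral_in:
  assumes T: "triple_system V T" "card V = 7" and g: "g \<in> V" "4 \<le> card {B \<in> T. g \<notin> B}"
  obtains a b c d e f where "distinct [a,b,c,d,e,f,g]" "V = {a,b,c,d,e,f,g}"
    "{B \<in> T. g \<notin> B} = {{a,b,c},{a,d,e},{b,d,f},{c,e,f}}"
    "{B \<in> T. g \<in> B} \<subseteq> {{g,a,f},{g,b,e},{g,c,d}}"
proof -
  let ?T = "{B \<in> T. g \<notin> B}"
  note del = delete_element[OF T g(1)]
  have "3 \<le> card ?T" using g(2) by simp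
  from triples_on_six[OF del(1,2) this]
  obtain a b c d e f where n: "distinct [a,b,c,d,e,f]" "V - {g} = {a,b,c,d,e,f}"
    "{{a,b,c},{a,d,e},{b,d,f}} \<subseteq> ?T" "?T \<subseteq> {{a,b,c},{a,d,e},{b,d,f},{c,e,f}}" .
  have "card {{a,b,c},{a,d,e},{b,d,f},{c,e,f}} \<le> 4" by (simp add: card_insert_if)
  then have Q: "?T = {{a,b,c},{a,d,e},{b,d,f},{c,e,f}}"
    using g(2) by (intro card_seteq[OF _ n(4)]) (auto intro: order_trans)
  have V: "V = {a,b,c,d,e,f,g}" using n(2) g(1) by auto
  have d: "distinct [a,b,c,d,e,f,g]" using n(1,2) by auto
  have "F \<in> {{g,a,f},{g,b,e},{g,c,d}}" if F: "F \<in> T" "g \<in> F" for F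
  proof -
    obtain y z where yz: "F = {g,y,z}" "g \<noteq> y" "g \<noteq> z" "y \<noteq> z"
      using triple_with[OF triple_systemD(3)[OF T(1) F(1)] F(2)] .
    have "\<not> (y \<in> B \<and> z \<in> B)" if "B \<in> ?T" for B
      using triple_systemD(6)[OF T(1) F(1), of B y z] that yz by auto
    then have "\<not> (y \<in> {a,b,c} \<and> z \<in> {a,b,c})" "\<not> (y \<in> {a,d,e} \<and> z \<in> {a,d,e})"
      "\<not> (y \<in> {b,d,f} \<and> z \<in> {b,d,f})" "\<not> (y \<in> {c,e,f} \<and> z \<in> {c,e,f})"
      unfolding Q by blast+
    moreover have "y \<in> {a,b,c,d,e,f}" "z \<in> {a,b,c,d,e,f}"
      using triple_systemD(2)[OF T(1) F(1)] yz n(2) by blast+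
    ultimately have "(y, z) \<in> {(a,f),(f,a),(b,e),(e,b),(c,d),(d,c)}" by auto
    then show ?thesis using yz(1) by (auto simp: insert_commute)
  qed
  then show ?thesis using that[OF d V Q] by blast
qed

lemma subset_of_three:
  "K \<subseteq> {p, q, r} \<Longrightarrow> K = {} \<or> K = {p} \<or> K = {q} \<or> K = {r} \<or> K = {p, q} \<or> K = {p, r} \<or> K = {q, r} \<or> K = {p, q, r}"
  by (cases "p \<in> K"; cases "q \<in> K"; cases "r \<in> K") blast+

text \<open>The symmetries of the quadrilateral permute the three pairs of opposite lines arbitrarily.  The lists
  below realise the permutations that bring the occurring pairs to the front.\<close>

lemma labelling_quadrilateral:
  assumes T: "triple_system V T" "card V = 7" and g: "g \<in> V" "4 \<le> card {B \<in> T. g \<notin> B}"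
  shows "(card T = 4 \<and> (\<exists>h. labelling V T h quad)) \<or>
    (card T = 5 \<and> (\<exists>h. labelling V T h (quad \<union> {{6,0,5}}))) \<or>
    (card T = 6 \<and> (\<exists>h. labelling V T h (quad \<union> {{6,0,5},{6,1,4}}))) \<or>
    (card T = 7 \<and> (\<exists>h. labelling V T h (quad \<union> {{6,0,5},{6,1,4},{6,2,3}})))"
proof -
  obtain a b c d e f where n: "distinct [a,b,c,d,e,f,g]" "V = {a,b,c,d,e,f,g}"
    "{B \<in> T. g \<notin> B} = {{a,b,c},{a,d,e},{b,d,f},{c,e,f}}"
    "{B \<in> T. g \<in> B} \<subseteq> {{g,a,f},{g,b,e},{g,c,d}}"
    using quadrilateral_in[OF T g] .
  define K where "K = {B \<in> T. g \<in> B}"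
  have TK: "T = {{a,b,c},{a,d,e},{b,d,f},{c,e,f}} \<union> K"
    unfolding K_def n(3)[symmetric] by auto
  have "card {{a,b,c},{a,d,e},{b,d,f},{c,e,f}} = 4"
  proof -
    have "{a,b,c} \<noteq> {a,d,e}" "{a,b,c} \<noteq> {b,d,f}" "{a,b,c} \<noteq> {c,e,f}" "{a,d,e} \<noteq> {b,d,f}"
      "{a,d,e} \<noteq> {c,e,f}" "{b,d,f} \<noteq> {c,e,f}"
      using n(1) by auto
    then show ?thesis by simp
  qed
  then have cT: "card T = 4 + card K"
    using delete_element(3)[OF T g(1)] n(3) unfolding K_def by simp
  have lab: "\<exists>h. labelling V T h T0" if "distinct xs" "length xs = 7" "set xs = V" "T = (`) ((!) xs) ` T0" for xs T0
    using labelling_nth[OF that] .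
  have ne: "{g,a,f} \<noteq> {g,b,e}" "{g,a,f} \<noteq> {g,c,d}" "{g,b,e} \<noteq> {g,c,d}"
    using n(1) by auto
  consider "K = {}" | "K = {{g,a,f}}" | "K = {{g,b,e}}" | "K = {{g,c,d}}"
    | "K = {{g,a,f},{g,b,e}}" | "K = {{g,a,f},{g,c,d}}" | "K = {{g,b,e},{g,c,d}}"
    | "K = {{g,a,f},{g,b,e},{g,c,d}}"
    using subset_of_three[OF n(4)[folded K_def]] by metis
  then show ?thesis
  proof cases
    case 1
    have "\<exists>h. labelling V T h quad"
    proof (rule lab[of "[a,b,c,d,e,f,g]"])
      show "distinct [a,b,c,d,e,f,g]" using n(1) by auto
      show "set [a,b,c,d,e,f,g] = V" unfolding n(2) by auto
      show "T = (`) ((!) [a,b,c,d,e,f,g]) ` quad" unfolding TK 1 by (simp add: insert_commute)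
    qed simp
    then show ?thesis using cT 1 by simp
  next
    case 2
    have "\<exists>h. labelling V T h (quad \<union> {{6,0,5}})"
    proof (rule lab[of "[a,b,c,d,e,f,g]"])
      show "distinct [a,b,c,d,e,f,g]" using n(1) by auto
      show "set [a,b,c,d,e,f,g] = V" unfolding n(2) by auto
      show "T = (`) ((!) [a,b,c,d,e,f,g]) ` (quad \<union> {{6,0,5}})" unfolding TK 2 by (simp add: insert_commute)
    qed simp
    then show ?thesis using cT 2 by simp
  next
    case 3
    have "\<exists>h. labelling V T h (quad \<union> {{6,0,5}})"
    proof (rule lab[of "[b,a,c,d,f,e,g]"])
      show "distinct [b,a,c,d,f,e,g]" using n(1) by auto
      show "set [b,a,c,d,f,e,g] = V" unfolding n(2) by auto
      show "T = (`) ((!) [b,a,c,d,f,e,g]) ` (quad \<union> {{6,0,5}})" unfolding TK 3 by (simp add: insert_commute)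
    qed simp
    then show ?thesis using cT 3 by simp
  next
    case 4
    have "\<exists>h. labelling V T h (quad \<union> {{6,0,5}})"
    proof (rule lab[of "[c,a,b,e,f,d,g]"])
      show "distinct [c,a,b,e,f,d,g]" using n(1) by auto
      show "set [c,a,b,e,f,d,g] = V" unfolding n(2) by auto
      show "T = (`) ((!) [c,a,b,e,f,d,g]) ` (quad \<union> {{6,0,5}})" unfolding TK 4 by (simp add: insert_commute)
    qed simp
    then show ?thesis using cT 4 by simp
  next
    case 5
    have "\<exists>h. labelling V T h (quad \<union> {{6,0,5},{6,1,4}})"
    proof (rule lab[of "[a,b,c,d,e,f,g]"])
      show "distinct [a,b,c,d,e,f,g]" using n(1) by auto
      show "set [a,b,c,d,e,f,g] = V" unfolding n(2) by auto
      show "T = (`) ((!) [a,b,c,d,e,f,g]) ` (quad \<union> {{6,0,5},{6,1,4}})" unfolding TK 5 by (simp add: insert_commute)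
    qed simp
    then show ?thesis using cT 5 ne by simp
  next
    case 6
    have "\<exists>h. labelling V T h (quad \<union> {{6,0,5},{6,1,4}})"
    proof (rule lab[of "[a,c,b,e,d,f,g]"])
      show "distinct [a,c,b,e,d,f,g]" using n(1) by auto
      show "set [a,c,b,e,d,f,g] = V" unfolding n(2) by auto
      show "T = (`) ((!) [a,c,b,e,d,f,g]) ` (quad \<union> {{6,0,5},{6,1,4}})" unfolding TK 6 by (simp add: insert_commute)
    qed simp
    then show ?thesis using cT 6 ne by simp
  next
    case 7
    have "\<exists>h. labelling V T h (quad \<union> {{6,0,5},{6,1,4}})"
    proof (rule lab[of "[b,c,a,f,d,e,g]"])
      show "distinct [b,c,a,f,d,e,g]" using n(1) by auto
      show "set [b,c,a,f,d,e,g] = V" unfolding n(2) by auto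
      show "T = (`) ((!) [b,c,a,f,d,e,g]) ` (quad \<union> {{6,0,5},{6,1,4}})" unfolding TK 7 by (simp add: insert_commute)
    qed simp
    then show ?thesis using cT 7 ne by simp
  next
    case 8
    have "\<exists>h. labelling V T h (quad \<union> {{6,0,5},{6,1,4},{6,2,3}})"
    proof (rule lab[of "[a,b,c,d,e,f,g]"])
      show "distinct [a,b,c,d,e,f,g]" using n(1) by auto
      show "set [a,b,c,d,e,f,g] = V" unfolding n(2) by auto
      show "T = (`) ((!) [a,b,c,d,e,f,g]) ` (quad \<union> {{6,0,5},{6,1,4},{6,2,3}})" unfolding TK 8 by (simp add: insert_commute)
    qed simp
    then show ?thesis using cT 8 ne by simp
  qed
qed


text \<open>Removing an element of degree one leaves a triangle on six elements.\<close>

lemma labelling_four_loose: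
  assumes T: "triple_system V T" "card V = 7" "card T = 4" and g: "g \<in> V" "card {B \<in> T. g \<in> B} = 1"
  shows "\<exists>h i j. (i, j) \<in> {(0,5),(1,4),(2,3),(2,4),(2,5),(4,5)} \<and>
    labelling V T h {{0,1,2},{0,3,4},{1,3,5},{6,i,j}}"
proof -
  let ?T = "{B \<in> T. g \<notin> B}"
  note del = delete_element[OF T(1,2) g(1)]
  have c3: "card ?T = 3" using del(3) g(2) T(3) by simp
  then have "3 \<le> card ?T" by simp
  from triples_on_six[OF del(1,2) this]
  obtain a b c d e f where n: "distinct [a,b,c,d,e,f]" "V - {g} = {a,b,c,d,e,f}"
    "{{a,b,c},{a,d,e},{b,d,f}} \<subseteq> ?T" "?T \<subseteq> {{a,b,c},{a,d,e},{b,d,f},{c,e,f}}" .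
  have V: "V = {a,b,c,d,e,f,g}" using n(2) g(1) by auto
  have d: "distinct [a,b,c,d,e,f,g]" using n(1,2) by auto
  have "{a,b,c} \<noteq> {a,d,e}" "{a,b,c} \<noteq> {b,d,f}" "{a,d,e} \<noteq> {b,d,f}"
    using n(1) by auto
  then have "card {{a,b,c},{a,d,e},{b,d,f}} = 3" by simp
  then have Q: "{{a,b,c},{a,d,e},{b,d,f}} = ?T"
    using c3 n(3) by (intro card_seteq) (simp_all add: triple_systemD(5)[OF del(1)])
  obtain F where F: "{B \<in> T. g \<in> B} = {F}" using g(2) by (auto simp: card_1_singleton_iff)
  then have F': "F \<in> T" "g \<in> F" by auto
  have V': "set [a,b,c,d,e,f,g] = V" unfolding V by simp
  have TF: "T = {{a,b,c},{a,d,e},{b,d,f}} \<union> {F}"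
    unfolding Q F[symmetric] by auto
  obtain y z where yz: "F = {g,y,z}" "g \<noteq> y" "g \<noteq> z" "y \<noteq> z"
    using triple_with[OF triple_systemD(3)[OF T(1) F'(1)] F'(2)] .
  have "\<not> (y \<in> B \<and> z \<in> B)" if "B \<in> ?T" for B
    using triple_systemD(6)[OF T(1) F'(1), of B y z] that yz by auto
  then have "\<not> (y \<in> {a,b,c} \<and> z \<in> {a,b,c})" "\<not> (y \<in> {a,d,e} \<and> z \<in> {a,d,e})"
    "\<not> (y \<in> {b,d,f} \<and> z \<in> {b,d,f})"
    unfolding Q[symmetric] by blast+
  moreover have "y \<in> {a,b,c,d,e,f}" "z \<in> {a,b,c,d,e,f}"
    using triple_systemD(2)[OF T(1) F'(1)] yz n(2) by blast+
  ultimately have "(y, z) \<in> {(a,f),(f,a),(b,e),(e,b),(c,d),(d,c),(c,e),(e,c),(c,f),(f,c),(e,f),(f,e)}"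
    using yz(4) by auto
  then have "F \<in> {{g,a,f},{g,b,e},{g,c,d},{g,c,e},{g,c,f},{g,e,f}}"
    unfolding yz(1) by (elim insertE emptyE Pair_inject; hypsubst; simp add: insert_commute)
  then have "\<exists>p\<in>{(0,5),(1,4),(2,3),(2,4),(2,5),(4,5)}.
      \<exists>h. labelling V T h {{0,1,2},{0,3,4},{1,3,5},{6,fst p,snd p}}"
  proof (elim insertE emptyE)
    assume F: "F = {g,a,f}"
    have "T = (`) ((!) [a,b,c,d,e,f,g]) ` {{0,1,2},{0,3,4},{1,3,5},{6,0,5}}"
      unfolding TF F by (simp add: insert_commute)
    from labelling_nth[OF d _ V' this] show ?thesis by (intro bexI[of _ "(0,5)"]) simp_all
  next
    assume F: "F = {g,b,e}"
    have "T = (`) ((!) [a,b,c,d,e,f,g]) ` {{0,1,2},{0,3,4},{1,3,5},{6,1,4}}"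
      unfolding TF F by (simp add: insert_commute)
    from labelling_nth[OF d _ V' this] show ?thesis by (intro bexI[of _ "(1,4)"]) simp_all
  next
    assume F: "F = {g,c,d}"
    have "T = (`) ((!) [a,b,c,d,e,f,g]) ` {{0,1,2},{0,3,4},{1,3,5},{6,2,3}}"
      unfolding TF F by (simp add: insert_commute)
    from labelling_nth[OF d _ V' this] show ?thesis by (intro bexI[of _ "(2,3)"]) simp_all
  next
    assume F: "F = {g,c,e}"
    have "T = (`) ((!) [a,b,c,d,e,f,g]) ` {{0,1,2},{0,3,4},{1,3,5},{6,2,4}}"
      unfolding TF F by (simp add: insert_commute)
    from labelling_nth[OF d _ V' this] show ?thesis by (intro bexI[of _ "(2,4)"]) simp_all
  next
    assume F: "F = {g,c,f}"
    have "T = (`) ((!) [a,b,c,d,e,f,g]) ` {{0,1,2},{0,3,4},{1,3,5},{6,2,5}}"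
      unfolding TF F by (simp add: insert_commute)
    from labelling_nth[OF d _ V' this] show ?thesis by (intro bexI[of _ "(2,5)"]) simp_all
  next
    assume F: "F = {g,e,f}"
    have "T = (`) ((!) [a,b,c,d,e,f,g]) ` {{0,1,2},{0,3,4},{1,3,5},{6,4,5}}"
      unfolding TF F by (simp add: insert_commute)
    from labelling_nth[OF d _ V' this] show ?thesis by (intro bexI[of _ "(4,5)"]) simp_all
  qed
  then obtain p h where "p \<in> {(0,5),(1,4),(2,3),(2,4),(2,5),(4,5)}"
    "labelling V T h {{0,1,2},{0,3,4},{1,3,5},{6,fst p,snd p}}" by blast
  then show ?thesis by (intro exI[of _ h] exI[of _ "fst p"] exI[of _ "snd p"]) simp
qed

text \<open>If no element lies in fewer than two of the five triples, then some element lies in three of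
  them, and the other two are disjoint.\<close>

lemma labelling_five_dense:
  assumes T: "triple_system V T" "card V = 7" "card T = 5"
    and dense: "\<And>v. v \<in> V \<Longrightarrow> 2 \<le> card {B \<in> T. v \<in> B}"
  shows "\<exists>h. labelling V T h grid"
proof -
  note D = triple_systemD[OF T(1)]
  have "\<exists>h\<in>V. 3 \<le> card {B \<in> T. h \<in> B}"
  proof (rule ccontr)
    assume "\<not> ?thesis"
    then have "(\<Sum>v\<in>V. card {B \<in> T. v \<in> B}) \<le> (\<Sum>v\<in>V. 2)" by (intro sum_mono) (simp add: not_le, fastforce)
    then show False using degree_sum[OF T(1)] T by simp
  qed
  then obtain k where k: "k \<in> V" "3 \<le> card {B \<in> T. k \<in> B}" by blast
  have "finite {B \<in> T. k \<in> B}" using D(5) by simp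
  from three_of_many[OF this k(2)]
  obtain A B C where ABC: "A \<in> {B \<in> T. k \<in> B}" "B \<in> {B \<in> T. k \<in> B}" "C \<in> {B \<in> T. k \<in> B}"
    "A \<noteq> B" "A \<noteq> C" "B \<noteq> C" .
  have kT: "A \<in> T" "B \<in> T" "C \<in> T" "k \<in> A" "k \<in> B" "k \<in> C" using ABC by auto
  have inter: "A \<inter> B = {k}" "A \<inter> C = {k}" "B \<inter> C = {k}"
    using D(6)[OF kT(1,2,4,5)] D(6)[OF kT(1,3,4,6)] D(6)[OF kT(2,3,5,6)] ABC kT by blast+
  have cu: "card (A \<union> B \<union> C) = 7"
  proof -
    have "card (A \<union> B) = 5" using card_Un_Int[of A B] D kT inter by simp
    moreover have "(A \<union> B) \<inter> C = {k}" using inter by blast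
    ultimately show ?thesis using card_Un_Int[of "A \<union> B" C] D kT by simp
  qed
  have AV: "A \<union> B \<union> C = V"
    using D kT cu T(2) by (intro card_subset_eq) auto
  have "card (T - {A,B,C}) = 2"
    using T(3) D(5) kT ABC by (simp add: card_Diff_subset)
  then obtain X Y where XY: "T - {A,B,C} = {X,Y}" "X \<noteq> Y" by (auto simp: card_2_iff)
  have TT: "T = {A,B,C,X,Y}" using XY kT by blast
  have XYT: "X \<in> T" "Y \<in> T" "X \<notin> {A,B,C}" "Y \<notin> {A,B,C}" using XY(1) by blast+
  have kXY: "k \<notin> X \<and> k \<notin> Y"
  proof -
    have "k \<notin> Z" if Z: "Z \<in> T" "Z \<notin> {A,B,C}" for Z
    proof
      assume kZ: "k \<in> Z"
      have "v \<notin> Z" if "v \<noteq> k" for v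
        using D(6)[OF Z(1) kT(1) kZ kT(4), of v] D(6)[OF Z(1) kT(2) kZ kT(5), of v]
          D(6)[OF Z(1) kT(3) kZ kT(6), of v] Z D(2)[OF Z(1)] AV that by blast
      then have "Z \<subseteq> {k}" by blast
      then have "card Z \<le> 1" using card_mono[of "{k}" Z] by simp
      then show False using D(3)[OF Z(1)] by simp
    qed
    then show ?thesis using XYT by blast
  qed
  have cover: "V - {k} \<subseteq> X \<union> Y"
  proof
    fix v assume v: "v \<in> V - {k}"
    have "\<exists>Z. {Q \<in> {A,B,C}. v \<in> Q} \<subseteq> {Z}"
    proof -
      consider "v \<in> A" | "v \<notin> A" "v \<in> B" | "v \<notin> A" "v \<notin> B" by blast
      then show ?thesis
      proof cases
        case 1
        then have "v \<notin> B" "v \<notin> C" using inter(1,2) v by blast+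
        then have "{Q \<in> {A,B,C}. v \<in> Q} \<subseteq> {A}" by auto
        then show ?thesis ..
      next
        case 2
        then have "v \<notin> C" using inter(3) v by blast
        then have "{Q \<in> {A,B,C}. v \<in> Q} \<subseteq> {B}" using 2 by auto
        then show ?thesis ..
      next
        case 3
        then have "{Q \<in> {A,B,C}. v \<in> Q} \<subseteq> {C}" by auto
        then show ?thesis ..
      qed
    qed
    then obtain Z where Z: "{Q \<in> {A,B,C}. v \<in> Q} \<subseteq> {Z}" by blast
    show "v \<in> X \<union> Y"
    proof (rule ccontr)
      assume "v \<notin> X \<union> Y"
      then have "{B \<in> T. v \<in> B} \<subseteq> {Z}" using Z TT by blast
      then have "card {B \<in> T. v \<in> B} \<le> card {Z}" by (intro card_mono) auto
      then show False using dense[of v] v by simp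
    qed
  qed
  have cXY: "card X = 3" "card Y = 3" "finite X" "finite Y" using D XYT by blast+
  have "card (V - {k}) \<le> card (X \<union> Y)" using cover cXY by (intro card_mono) auto
  moreover have "card (V - {k}) = 6" using T(2) k(1) D(1) by simp
  moreover have "card (X \<union> Y) + card (X \<inter> Y) = 6" using card_Un_Int[of X Y] cXY by simp
  ultimately have "card (X \<inter> Y) = 0" by linarith
  then have disj: "X \<inter> Y = {}" using cXY by simp
  have part: "\<exists>x y. Z = {k,x,y} \<and> x \<in> X \<and> y \<in> Y" if Z: "Z \<in> {A,B,C}" for Z
  proof -
    have ZT: "Z \<in> T" "k \<in> Z" using Z kT by auto
    obtain x y where xy: "Z = {k,x,y}" "k \<noteq> x" "k \<noteq> y" "x \<noteq> y" using triple_with[OF D(3)[OF ZT(1)] ZT(2)] .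
    then have "x \<in> X \<union> Y" "y \<in> X \<union> Y" using cover D(2)[OF ZT(1)] by blast+
    moreover have "\<not> (x \<in> X \<and> y \<in> X)" "\<not> (x \<in> Y \<and> y \<in> Y)"
      using D(6)[OF ZT(1) XYT(1), of x y] D(6)[OF ZT(1) XYT(2), of x y] xy kXY by blast+
    ultimately consider "x \<in> X" "y \<in> Y" | "y \<in> X" "x \<in> Y" by blast
    then show ?thesis using xy(1) by cases (blast, metis insert_commute)
  qed
  obtain x1 y1 where 1: "A = {k,x1,y1}" "x1 \<in> X" "y1 \<in> Y" using part[of A] by blast
  obtain x2 y2 where 2: "B = {k,x2,y2}" "x2 \<in> X" "y2 \<in> Y" using part[of B] by blast
  obtain x3 y3 where 3: "C = {k,x3,y3}" "x3 \<in> X" "y3 \<in> Y" using part[of C] by blast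
  have ne: "x1 \<noteq> x2" "x1 \<noteq> x3" "x2 \<noteq> x3" "y1 \<noteq> y2" "y1 \<noteq> y3" "y2 \<noteq> y3"
    using inter 1 2 3 kXY by auto
  have X: "{x1,x2,x3} = X" "{y1,y2,y3} = Y"
    using 1 2 3 ne cXY by (simp_all add: card_subset_eq)
  have d: "distinct [x1,y1,x2,y2,x3,y3,k]" using ne 1 2 3 disj kXY by auto
  show ?thesis
  proof (rule labelling_nth[OF d])
    show "set [x1,y1,x2,y2,x3,y3,k] = V" unfolding AV[symmetric] 1(1) 2(1) 3(1) by auto
    show "T = (`) ((!) [x1,y1,x2,y2,x3,y3,k]) ` grid"
      unfolding TT 1(1) 2(1) 3(1) X[symmetric] by simp
  qed simp
qed

section \<open>From the arrangement to its triple system\<close>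

lemma blocks_triple_system:
  assumes W: "triple_config W"
  shows "triple_system W (blocks W)"
  unfolding triple_system_def
proof (intro conjI ballI impI)
  show "finite W" by (rule triple_configD(2)[OF W])
  fix B assume B: "B \<in> blocks W"
  then show "B \<subseteq> W" "card B = 3" by (auto simp: blocks_def)
  fix C assume C: "C \<in> blocks W" "B \<noteq> C"
  show "card (B \<inter> C) \<le> 1"
  proof (rule ccontr)
    assume "\<not> card (B \<inter> C) \<le> 1"
    then have "2 \<le> card (B \<inter> C)" by simp
    then obtain X where "X \<subseteq> B \<inter> C" "card X = 2" using obtain_subset_with_card_n by metis
    then obtain x y where "x \<noteq> y" "x \<in> B" "y \<in> B" "x \<in> C" "y \<in> C" by (auto simp: card_2_iff)
    then have "B = {w \<in> W. dot w (vcross x y) = 0}" "C = {w \<in> W. dot w (vcross x y) = 0}"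
      using block_eq_lines_through[OF W B, of x y] block_eq_lines_through[OF W C(1), of x y] by blast+
    then show False using C(2) by (simp only:)
  qed
qed

lemma labelled_if_labelling:
  assumes "triple_config W" "labelling W (blocks W) h T" "T \<subseteq> Pow {0..<7}"
  shows "labelled W h T"
  using assms by (simp add: labelled_def labelling_def)

lemma span_single: "vec.span {v} = {c *s v | c. True}" for v :: "complex ^ 3"
  by (auto simp: vec.span_singleton)

lemma proj_plane_eq: "proj_plane = {vec.span {v} | v. v \<noteq> 0}"
proof (intro equalityI subsetI)
  fix P assume P: "P \<in> proj_plane"
  then have s: "vec.subspace P" "vec.dim P = 1" by (auto simp: proj_plane_def)
  obtain B where B: "B \<subseteq> P" "vec.independent B" "P \<subseteq> vec.span B" "card B = vec.dim P"
    using vec.basis_exists by blast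
  then obtain v where v: "B = {v}" using s(2) by (auto simp: card_1_singleton_iff)
  then have "v \<noteq> 0" using B(2) vec.dependent_zero by auto
  moreover have "P = vec.span {v}"
    using B v s(1) vec.span_minimal by blast
  ultimately show "P \<in> {vec.span {v} | v. v \<noteq> 0}" by blast
next
  fix P assume "P \<in> {vec.span {v} | v :: complex ^ 3. v \<noteq> 0}"
  then obtain v where v: "P = vec.span {v}" "v \<noteq> (0 :: complex ^ 3)" by blast
  then have "vec.independent {v}" by simp
  then have "vec.dim {v} = card {v}" by (rule vec.dim_eq_card_independent)
  then show "P \<in> proj_plane"
    using v by (simp add: proj_plane_def vec.dim_span)
qed

lemma on_line_span: "on_line (vec.span {v}) (lin w) \<longleftrightarrow> dot w v = 0"
proof
  assume "on_line (vec.span {v}) (lin w)"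
  then show "dot w v = 0" using vec.span_base[of v "{v}"] by (auto simp: on_line_def)
qed (auto simp: on_line_def span_single)

lemma line_arrangement_lin:
  assumes A: "line_arrangement A"
  obtains W where "A = lin ` W" "arrangement W" "card W = card A"
proof -
  define W where "W = {w. lin w \<in> A}"
  have AW: "A = lin ` W"
  proof (intro equalityI subsetI)
    fix l assume l: "l \<in> A"
    then obtain w where "l = lin w"
      using A homogeneous_1_imp_lin by (auto simp: line_arrangement_def simp del: One_nat_def)
    then show "l \<in> lin ` W" using l by (simp add: W_def)
  qed (auto simp: W_def)
  have inj: "inj_on lin W" by (simp add: inj_on_def lin_inj)
  have "finite W" using A AW inj finite_image_iff by (auto simp: line_arrangement_def)
  moreover have "0 \<notin> W" using A by (auto simp: W_def line_arrangement_def)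
  moreover have "vcross u w \<noteq> 0" if u: "u \<in> W" "w \<in> W" "u \<noteq> w" for u w
  proof
    assume "vcross u w = 0"
    moreover have "w \<noteq> 0" using u \<open>0 \<notin> W\<close> by auto
    ultimately obtain c where "u = c *s w" using vcross_eq_0_iff by blast
    then have "lin u = smult [:[:c:]:] (lin w)" by (simp add: lin_scale cst_def)
    moreover have "lin u \<noteq> lin w" using u by (simp add: lin_inj)
    ultimately show False using A u by (auto simp: line_arrangement_def pairwise_def W_def)
  qed
  ultimately have "arrangement W" by (auto simp: arrangement_def pairwise_def)
  then show ?thesis using that AW inj by (simp add: card_image)
qed

lemma pt_mult_span:
  assumes AW: "A = lin ` W"
  shows "pt_mult A (vec.span {v}) = card {w \<in> W. dot w v = 0}"
proof -
  have "{l \<in> A. on_line (vec.span {v}) l} = lin ` {w \<in> W. dot w v = 0}"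
    by (auto simp: AW on_line_span)
  then show ?thesis by (simp add: pt_mult_def card_image inj_on_def lin_inj)
qed

context
  fixes A :: "S set" and W :: "(complex ^ 3) set"
  assumes AW: "A = lin ` W" and W: "triple_config W"
begin

lemma defining_poly_form: "defining_poly A = form W"
  by (simp add: defining_poly_def form_def AW prod.reindex inj_on_def lin_inj)

text \<open>Two of the lines through a point already determine it.\<close>

lemma points_bij:
  assumes k: "2 \<le> k"
  shows "bij_betw (\<lambda>P. {w \<in> W. on_line P (lin w)}) (points_of_mult A k)
    {B. card B = k \<and> (\<exists>v. v \<noteq> 0 \<and> B = {w \<in> W. dot w v = 0})}"
  unfolding bij_betw_def
proof
  have repr: "\<exists>v. v \<noteq> 0 \<and> P = vec.span {v} \<and> card {w \<in> W. dot w v = 0} = k" if "P \<in> points_of_mult A k" for P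
    using that by (auto simp: points_of_mult_def proj_plane_eq pt_mult_span[OF AW])
  show "inj_on (\<lambda>P. {w \<in> W. on_line P (lin w)}) (points_of_mult A k)"
  proof (rule inj_onI)
    fix P Q assume PQ: "P \<in> points_of_mult A k" "Q \<in> points_of_mult A k"
      "{w \<in> W. on_line P (lin w)} = {w \<in> W. on_line Q (lin w)}"
    obtain v where v: "v \<noteq> 0" "P = vec.span {v}" "card {w \<in> W. dot w v = 0} = k" using repr[OF PQ(1)] by blast
    obtain u where u: "u \<noteq> 0" "Q = vec.span {u}" using repr[OF PQ(2)] by blast
    have eq: "{w \<in> W. dot w v = 0} = {w \<in> W. dot w u = 0}"
      using PQ(3) by (simp add: v(2) u(2) on_line_span)
    obtain X where X: "X \<subseteq> {w \<in> W. dot w v = 0}" "card X = 2"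
      using obtain_subset_with_card_n[of 2 "{w \<in> W. dot w v = 0}"] v(3) k by metis
    then obtain a b where ab: "a \<noteq> b" "a \<in> W" "b \<in> W" "dot a v = 0" "dot b v = 0" by (auto simp: card_2_iff)
    then have "dot a u = 0" "dot b u = 0" using eq by blast+
    moreover have nz: "vcross a b \<noteq> 0" using triple_configD(6)[OF W] ab by blast
    ultimately obtain c d where cd: "v = c *s vcross a b" "u = d *s vcross a b"
      using on_two_lines[OF nz] ab by metis
    then have "c \<noteq> 0" "d \<noteq> 0" using v(1) u(1) by auto
    then have e: "v = (c / d) *s u" "u = (d / c) *s v" using cd by simp_all
    have "(c / d) *s u \<in> vec.span {u}" "(d / c) *s v \<in> vec.span {v}"
      by (intro vec.span_scale vec.span_base, simp)+
    then have "v \<in> vec.span {u}" "u \<in> vec.span {v}" by (simp_all only: e[symmetric])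
    then show "P = Q" unfolding v(2) u(2) by (intro subset_antisym vec.span_minimal) auto
  qed
  show "(\<lambda>P. {w \<in> W. on_line P (lin w)}) ` points_of_mult A k =
      {B. card B = k \<and> (\<exists>v. v \<noteq> 0 \<and> B = {w \<in> W. dot w v = 0})}"
  proof (intro equalityI subsetI)
    fix B assume "B \<in> (\<lambda>P. {w \<in> W. on_line P (lin w)}) ` points_of_mult A k"
    then obtain P where P: "P \<in> points_of_mult A k" "B = {w \<in> W. on_line P (lin w)}" by blast
    obtain v where "v \<noteq> 0" "P = vec.span {v}" "card {w \<in> W. dot w v = 0} = k" using repr[OF P(1)] by blast
    then show "B \<in> {B. card B = k \<and> (\<exists>v. v \<noteq> 0 \<and> B = {w \<in> W. dot w v = 0})}"
      using P(2) by (auto simp: on_line_span)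
  next
    fix B assume "B \<in> {B. card B = k \<and> (\<exists>v. v \<noteq> 0 \<and> B = {w \<in> W. dot w v = 0})}"
    then obtain v where v: "card B = k" "v \<noteq> 0" "B = {w \<in> W. dot w v = 0}" by blast
    then have "vec.span {v} \<in> points_of_mult A k"
      by (auto simp: points_of_mult_def proj_plane_eq pt_mult_span[OF AW])
    moreover have "B = {w \<in> W. on_line (vec.span {v}) (lin w)}" by (simp add: v(3) on_line_span)
    ultimately show "B \<in> (\<lambda>P. {w \<in> W. on_line P (lin w)}) ` points_of_mult A k" by blast
  qed
qed

lemma blocks_eq: "{B. card B = 3 \<and> (\<exists>v. v \<noteq> 0 \<and> B = {w \<in> W. dot w v = 0})} = blocks W"
proof (intro equalityI subsetI)
  fix B assume B: "B \<in> blocks W"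
  then obtain v where v: "v \<noteq> 0" "B \<subseteq> {w \<in> W. dot w v = 0}" "card B = 3" by (auto simp: blocks_def)
  have "B = {w \<in> W. dot w v = 0}"
    using triple_configD(2,7)[OF W] v by (intro card_seteq) auto
  then show "B \<in> {B. card B = 3 \<and> (\<exists>v. v \<noteq> 0 \<and> B = {w \<in> W. dot w v = 0})}" using v by blast
qed (auto simp: blocks_def)

lemma n_pts_3: "n_pts A 3 = card (blocks W)"
  unfolding n_pts_def using bij_betw_same_card[OF points_bij[of 3]] by (simp add: blocks_eq)

lemma triple_points_on_card: "card (triple_points_on A (lin w)) = card {B \<in> blocks W. w \<in> B}"
  if w: "w \<in> W"
proof -
  let ?f = "\<lambda>P. {w \<in> W. on_line P (lin w)}"
  have b: "bij_betw ?f (points_of_mult A 3) (blocks W)"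
    using points_bij[of 3] by (simp add: blocks_eq)
  have "bij_betw ?f (triple_points_on A (lin w)) {B \<in> blocks W. w \<in> B}"
    unfolding bij_betw_def
  proof
    show "inj_on ?f (triple_points_on A (lin w))"
      using b by (auto simp: bij_betw_def triple_points_on_def intro: inj_on_subset)
    have "?f ` triple_points_on A (lin w) = {B \<in> ?f ` points_of_mult A 3. w \<in> B}"
      using w by (auto simp: triple_points_on_def)
    then show "?f ` triple_points_on A (lin w) = {B \<in> blocks W. w \<in> B}"
      using b by (simp add: bij_betw_def)
  qed
  then show ?thesis by (rule bij_betw_same_card)
qed

lemma triple_points_on_empty: "triple_points_on A (lin w) = {} \<longleftrightarrow> (\<forall>B\<in>blocks W. w \<notin> B)" if w: "w \<in> W"
proof -
  have "bij_betw (\<lambda>P. {w \<in> W. on_line P (lin w)}) (points_of_mult A 3) (blocks W)"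
    using points_bij[of 3] by (simp add: blocks_eq)
  then have "blocks W = (\<lambda>P. {w \<in> W. on_line P (lin w)}) ` points_of_mult A 3"
    by (simp add: bij_betw_def)
  then show ?thesis using w by (auto simp: triple_points_on_def)
qed

text \<open>Every pair of lines meets in one point, so the \<open>21\<close> pairs are distributed over the double points,
  one each, and the triple points, three each.\<close>

lemma n_pts_2: "n_pts A 2 + 3 * card (blocks W) = 21"
proof -
  note D = triple_systemD[OF blocks_triple_system[OF W]]
  let ?L = "{B. card B = 2 \<and> (\<exists>v. v \<noteq> 0 \<and> B = {w \<in> W. dot w v = 0})}"
  let ?P = "\<lambda>C. {B. B \<subseteq> C \<and> card B = 2}"
  have fin: "finite W" by (rule D(1))
  have sub: "?L \<subseteq> ?P W" by auto
  then have finL: "finite ?L" using fin finite_subset[of ?L "Pow W"] by auto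
  have split: "?P W = ?L \<union> (\<Union>C\<in>blocks W. ?P C)"
  proof (intro equalityI subsetI)
    fix B assume B: "B \<in> ?P W"
    then obtain x y where xy: "B = {x,y}" "x \<noteq> y" "x \<in> W" "y \<in> W" by (auto simp: card_2_iff)
    have nz: "vcross x y \<noteq> 0" using triple_configD(6)[OF W] xy by blast
    let ?C = "{w \<in> W. dot w (vcross x y) = 0}"
    have BC: "B \<subseteq> ?C" using xy by auto
    have "card B \<le> card ?C" using fin BC by (intro card_mono) auto
    moreover have "card ?C \<le> 3" by (rule triple_configD(7)[OF W nz])
    ultimately consider "card ?C = 2" | "card ?C = 3" using B by fastforce
    then show "B \<in> ?L \<union> (\<Union>C\<in>blocks W. ?P C)"
    proof cases
      case 1
      then have "B = ?C" using fin BC B by (intro card_subset_eq) auto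
      then show ?thesis using B nz by blast
    next
      case 2
      then have "?C \<in> blocks W" using nz by (auto simp: blocks_def)
      then show ?thesis using BC B by blast
    qed
  next
    fix B assume "B \<in> ?L \<union> (\<Union>C\<in>blocks W. ?P C)"
    then show "B \<in> ?P W" using D(2) by blast
  qed
  have "card (?P C) = 3" if "C \<in> blocks W" for C
    using n_subsets[OF D(4)[OF that], of 2] D(3)[OF that] by (simp add: choose_two)
  then have "card (\<Union>C\<in>blocks W. ?P C) = 3 * card (blocks W)"
  proof (subst card_UN_disjoint)
    show "\<forall>C\<in>blocks W. \<forall>C'\<in>blocks W. C \<noteq> C' \<longrightarrow> ?P C \<inter> ?P C' = {}"
    proof (intro ballI impI)
      fix C C' assume C: "C \<in> blocks W" "C' \<in> blocks W" "C \<noteq> C'"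
      have False if B: "B \<in> ?P C \<inter> ?P C'" for B
      proof -
        have "card B = 2" using B by simp
        then obtain x y where "B = {x,y}" "x \<noteq> y" by (auto simp: card_2_iff)
        then show False using D(6)[OF C(1,2), of x y] B C(3) by auto
      qed
      then show "?P C \<inter> ?P C' = {}" by blast
    qed
  qed (use D(4,5) in auto)
  moreover have "?L \<inter> (\<Union>C\<in>blocks W. ?P C) = {}"
  proof -
    have False if B: "B \<in> ?L" "C \<in> blocks W" "B \<subseteq> C" for B C
    proof -
      obtain v where v: "card B = 2" "v \<noteq> 0" "B = {w \<in> W. dot w v = 0}" using B(1) by blast
      obtain x y where xy: "B = {x,y}" "x \<noteq> y" using v(1) by (auto simp: card_2_iff)
      then have e: "C = {w \<in> W. dot w (vcross x y) = 0}"
        using block_eq_lines_through[OF W B(2)] B(3) by blast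
      have "vcross x y \<noteq> 0" using triple_configD(6)[OF W, of x y] xy v(3) by blast
      moreover have "dot x v = 0" "dot y v = 0" using xy v(3) by blast+
      ultimately obtain c where "v = c *s vcross x y" using on_two_lines by metis
      then have "C \<subseteq> B" unfolding e v(3) by auto
      then have "card C \<le> card B" using xy by (intro card_mono) auto
      then show False using D(3)[OF B(2)] v(1) by simp
    qed
    then show ?thesis by blast
  qed
  moreover have "finite (\<Union>C\<in>blocks W. ?P C)" using D(4,5) by simp
  ultimately have "card (?P W) = card ?L + 3 * card (blocks W)"
    unfolding split using finL by (simp add: card_Un_disjoint)
  moreover have "card (?P W) = 21"
    using n_subsets[OF fin, of 2] triple_configD(4)[OF W] by (simp add: choose_two)
  moreover have "n_pts A 2 = card ?L"
    unfolding n_pts_def using bij_betw_same_card[OF points_bij[of 2]] by simp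
  ultimately show ?thesis by simp
qed

lemma total_tjurina_eq: "total_tjurina A = 21 + card (blocks W)"
proof -
  have c7: "card A = 7" using triple_configD(4)[OF W] by (simp add: AW card_image inj_on_def lin_inj)
  have "n_pts A k = 0" if "k > 3" for k
  proof -
    have "points_of_mult A k = {}"
      using triple_configD(7)[OF W] that
      by (fastforce simp: points_of_mult_def proj_plane_eq pt_mult_span[OF AW])
    then show ?thesis by (simp add: n_pts_def)
  qed
  moreover have "{2..7} = {2,3,4,5,6,7::nat}" by auto
  ultimately have "total_tjurina A = n_pts A 2 + n_pts A 3 * 4"
    unfolding total_tjurina_def c7 by simp
  then show ?thesis using n_pts_2 n_pts_3 by simp
qed

end

lemma triple_config_of_max:
  assumes A: "A = lin ` W" "arrangement W" "card W = 7" and m: "max_pt_mult A = 3"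
  shows "triple_config W" "blocks W \<noteq> {}"
proof -
  have fin: "finite W" using A(2) by (simp add: arrangement_def)
  note mult = pt_mult_span[OF A(1)]
  have "pt_mult A ` proj_plane \<subseteq> {..7}"
    using A(3) card_mono[OF fin] by (fastforce simp: proj_plane_eq mult)
  then have f: "finite (pt_mult A ` proj_plane)" using finite_subset by blast
  have "(axis 1 1 :: complex ^ 3) \<noteq> 0" by (simp add: axis_eq_0_iff)
  then have ne: "proj_plane \<noteq> {}" unfolding proj_plane_eq by blast
  have "card {w \<in> W. dot w v = 0} \<le> 3" if "v \<noteq> 0" for v
  proof -
    have "pt_mult A (vec.span {v}) \<in> pt_mult A ` proj_plane" using that unfolding proj_plane_eq by blast
    then show ?thesis using Max_ge[OF f] m unfolding max_pt_mult_def mult by metis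
  qed
  then show "triple_config W" using A by (simp add: triple_config_def)
  have "3 \<in> pt_mult A ` proj_plane" using Max_in[OF f] ne m by (simp add: max_pt_mult_def)
  then obtain v where "v \<noteq> 0" "card {w \<in> W. dot w v = 0} = 3"
    by (auto simp: proj_plane_eq mult)
  then have "{w \<in> W. dot w v = 0} \<in> blocks W" by (auto simp: blocks_def)
  then show "blocks W \<noteq> {}" by blast
qed

lemma labels_explicit: "{0..<7} = {0,1,2,3,4,5,6::nat}"
  by auto

lemma lines_without_triple_points:
  assumes L: "labelled W h T" and A: "A = lin ` W"
  shows "(\<exists>l\<in>A. triple_points_on A l = {}) \<longleftrightarrow> (\<exists>k\<in>{0..<7}. \<forall>B\<in>T. k \<notin> B)"
    "(\<exists>l\<in>A. card (triple_points_on A l) = 1) \<longleftrightarrow> 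
      (\<exists>k\<in>{0..<7}. \<exists>B\<in>T. k \<in> B \<and> (\<forall>C\<in>T. k \<in> C \<longrightarrow> C = B))"
proof -
  have W: "triple_config W" by (rule labelledD(1)[OF L])
  have inj: "inj_on h {0..<7}" using L by (simp add: labelled_def bij_betw_def)
  have T: "T \<subseteq> Pow {0..<7}" and b: "blocks W = (`) h ` T" using L by (simp_all add: labelled_def)
  have mem: "h k \<in> h ` B \<longleftrightarrow> k \<in> B" if "k \<in> {0..<7}" "B \<in> T" for k B
    using inj_on_image_mem_iff[OF inj that(1)] T that(2) by blast
  have e: "(\<exists>l\<in>A. P l) \<longleftrightarrow> (\<exists>k\<in>{0..<7}. P (lin (h k)))" for P
    unfolding A labelledD(2)[OF L] by blast
  have hW: "h k \<in> W" if "k \<in> {0..<7}" for k using labelledD(3)[OF L] that by simp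
  have "triple_points_on A (lin (h k)) = {} \<longleftrightarrow> (\<forall>B\<in>T. k \<notin> B)" if k: "k \<in> {0..<7}" for k
    using triple_points_on_empty[OF A W hW[OF k]] mem[OF k] by (simp add: b)
  then show "(\<exists>l\<in>A. triple_points_on A l = {}) \<longleftrightarrow> (\<exists>k\<in>{0..<7}. \<forall>B\<in>T. k \<notin> B)"
    unfolding e by simp
  have "card (triple_points_on A (lin (h k))) = card {B \<in> T. k \<in> B}" if k: "k \<in> {0..<7}" for k
  proof -
    have "{B \<in> blocks W. h k \<in> B} = (`) h ` {B \<in> T. k \<in> B}" using mem[OF k] by (auto simp: b)
    moreover have "inj_on ((`) h) {B \<in> T. k \<in> B}"
      by (rule inj_on_subset[OF inj_on_image_Pow[OF inj]]) (use T in blast)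
    ultimately show ?thesis using triple_points_on_card[OF A W hW[OF k]] by (simp add: card_image)
  qed
  moreover have "card {B \<in> T. k \<in> B} = 1 \<longleftrightarrow> (\<exists>B\<in>T. k \<in> B \<and> (\<forall>C\<in>T. k \<in> C \<longrightarrow> C = B))" for k
    unfolding One_nat_def card_1_singleton_iff by blast
  ultimately show "(\<exists>l\<in>A. card (triple_points_on A l) = 1) \<longleftrightarrow>
      (\<exists>k\<in>{0..<7}. \<exists>B\<in>T. k \<in> B \<and> (\<forall>C\<in>T. k \<in> C \<longrightarrow> C = B))"
    unfolding e by simp
qed

lemma has_type_of_exponents:
  assumes "has_exponents A (e1 # e2 # es)" "card A = 7"
  shows "has_type A (int e1 + int e2 - 6)"
  using assms unfolding has_type_def by (intro exI[of _ "e1 # e2 # es"]) simp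

theorem theorem3p3:
  fixes A :: "S set" and r :: nat
  assumes "line_arrangement A"
    and "card A = 7"
    and "max_pt_mult A = 3"
    and "r = mdr (defining_poly A)"
  shows
    "(total_tjurina A = 27 \<and> n_pts A 3 = 6 \<and>
        free_arrangement A \<and> has_exponents A [3, 3])
     \<or>
     (total_tjurina A = 26 \<and> n_pts A 3 = 5 \<and>
        nearly_free A \<and> has_exponents A [3, 4, 4])
     \<or>
     (total_tjurina A = 25 \<and> n_pts A 3 = 4 \<and>
        ((\<exists>L0\<in>A. triple_points_on A L0 = {}) \<or>
         (\<exists>L1\<in>A. card (triple_points_on A L1) = 1)) \<and>
        ((\<exists>L0\<in>A. triple_points_on A L0 = {}) \<longrightarrow>
           plus_one_generated A \<and> has_exponents A [3, 4, 5]) \<and>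
        ((\<exists>L1\<in>A. card (triple_points_on A L1) = 1) \<longrightarrow>
           r = 4 \<and> maximal_tjurina A 7 4))
     \<or>
     (total_tjurina A = 24 \<and> n_pts A 3 = 3 \<and>
        (\<exists>es. has_exponents A es \<and> 3 \<le> length es \<and>
              es ! 0 = 4 \<and> es ! 1 = 4 \<and> es ! 2 = 4) \<and>
        ((\<exists>L0\<in>A. triple_points_on A L0 = {}) \<longrightarrow>
           has_type A 2 \<and> has_exponents A [4, 4, 4, 5]) \<and>
        (\<not> (\<exists>L0\<in>A. triple_points_on A L0 = {}) \<longrightarrow>
           has_type A 2 \<and> has_exponents A [4, 4, 4]))
     \<or>
     (total_tjurina A = 23 \<and> n_pts A 3 = 2 \<and>
        has_type A 2 \<and> has_exponents A [4, 4, 5, 5])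
     \<or>
     (total_tjurina A = 22 \<and> n_pts A 3 = 1 \<and>
        has_type A 3 \<and> has_exponents A [4, 5, 5, 5, 5])"
proof -
  obtain W where AW: "A = lin ` W" and arr: "arrangement W" and "card W = card A"
    using line_arrangement_lin[OF assms(1)] .
  then have W7: "card W = 7" using assms(2) by simp
  have W: "triple_config W" and ne: "blocks W \<noteq> {}"
    using triple_config_of_max[OF AW arr W7 assms(3)] .
  have T: "triple_system W (blocks W)" by (rule blocks_triple_system[OF W])
  let ?b = "card (blocks W)"
  have tau: "total_tjurina A = 21 + ?b" by (rule total_tjurina_eq[OF AW W])
  have n3: "n_pts A 3 = ?b" by (rule n_pts_3[OF AW W])
  have AR: "AR (defining_poly A) = AR (form W)" by (simp only: defining_poly_form[OF AW W])
  have lab: "labelled W h T0" if "labelling W (blocks W) h T0" "T0 \<subseteq> Pow {0..<7}" for h T0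
    using labelled_if_labelling[OF W that] .
  have "?b \<noteq> 0" using ne triple_systemD(5)[OF T] by simp
  moreover have "?b \<le> 7" using n_pts_2[OF AW W] by simp
  moreover have b7: "?b \<noteq> 7"
  proof
    assume b: "?b = 7"
    then obtain g where g: "g \<in> W" "card {B \<in> blocks W. g \<in> B} < 4"
      using exists_small_degree[OF T W7, of 4] by auto
    then have "4 \<le> card {B \<in> blocks W. g \<notin> B}" using delete_element(3)[OF T W7 g(1)] b by simp
    from labelling_quadrilateral[OF T W7 g(1) this] b
    obtain h where "labelling W (blocks W) h (quad \<union> {{6,0,5},{6,1,4},{6,2,3}})" by auto
    then have "labelled W h (quad \<union> {{6,0,5},{6,1,4},{6,2,3}})" by (rule lab) auto
    then show False using not_fano by blast
  qed
  ultimately consider "?b = 1" | "?b = 2" | "?b = 3" | "?b = 4" | "?b = 5" | "?b = 6" by linarith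
  then show ?thesis
  proof cases
    case 1
    obtain h where "labelling W (blocks W) h {{0,1,2}}" using labelling_one[OF T W7 1] by blast
    then have "labelled W h {{0,1,2}}" by (rule lab) auto
    from one_triple_point[OF this AR] have e: "has_exponents A [4,5,5,5,5]" .
    have "has_type A 3" using has_type_of_exponents[OF e assms(2)] by simp
    then show ?thesis using e tau n3 1 by simp
  next
    case 2
    have e: "has_exponents A [4,4,5,5]"
      using labelling_two[OF T W7 2]
    proof (elim disjE exE)
      fix h assume "labelling W (blocks W) h {{0,1,2},{0,3,4}}"
      then have "labelled W h {{0,1,2},{0,3,4}}" by (rule lab) auto
      then show ?thesis by (rule two_triple_points_joined[OF _ AR])
    next
      fix h assume "labelling W (blocks W) h {{0,1,2},{3,4,5}}"
      then have "labelled W h {{0,1,2},{3,4,5}}" by (rule lab) auto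
      then show ?thesis by (rule two_triple_points_disjoint[OF _ AR])
    qed
    have "has_type A 2" using has_type_of_exponents[OF e assms(2)] by simp
    then show ?thesis using e tau n3 2 by simp
  next
    case 3
    have "((\<exists>L0\<in>A. triple_points_on A L0 = {}) \<and> has_exponents A [4,4,4,5]) \<or>
      (\<not> (\<exists>L0\<in>A. triple_points_on A L0 = {}) \<and> has_exponents A [4,4,4])"
      using labelling_three[OF T W7 3]
    proof (elim disjE exE)
      fix h assume "labelling W (blocks W) h {{0,1,2},{0,3,4},{1,3,5}}"
      then have L: "labelled W h {{0,1,2},{0,3,4},{1,3,5}}" by (rule lab) auto
      have "\<exists>k\<in>{0..<7}. \<forall>B\<in>{{0,1,2},{0,3,4},{1,3,5}}. k \<notin> (B :: nat set)" by code_simp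
      then show ?thesis
        using three_triple_points_triangle[OF L AR] lines_without_triple_points(1)[OF L AW] by blast
    next
      fix h assume "labelling W (blocks W) h {{0,1,2},{0,3,4},{0,5,6}}"
      then have L: "labelled W h {{0,1,2},{0,3,4},{0,5,6}}" by (rule lab) auto
      have "\<not> (\<exists>k\<in>{0..<7}. \<forall>B\<in>{{0,1,2},{0,3,4},{0,5,6}}. k \<notin> (B :: nat set))" by code_simp
      then show ?thesis
        using three_triple_points_collinear[OF L AR] lines_without_triple_points(1)[OF L AW] by blast
    next
      fix h assume "labelling W (blocks W) h {{0,1,2},{0,3,4},{1,5,6}}"
      then have L: "labelled W h {{0,1,2},{0,3,4},{1,5,6}}" by (rule lab) auto
      have "\<not> (\<exists>k\<in>{0..<7}. \<forall>B\<in>{{0,1,2},{0,3,4},{1,5,6}}. k \<notin> (B :: nat set))" by code_simp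
      then show ?thesis
        using three_triple_points_path[OF L AR] lines_without_triple_points(1)[OF L AW] by blast
    qed
    then show ?thesis
    proof (elim disjE conjE)
      assume f: "\<exists>L0\<in>A. triple_points_on A L0 = {}" and e: "has_exponents A [4,4,4,5]"
      have "has_type A 2" using has_type_of_exponents[OF e assms(2)] by simp
      moreover have "\<exists>es. has_exponents A es \<and> 3 \<le> length es \<and> es ! 0 = 4 \<and> es ! 1 = 4 \<and> es ! 2 = 4"
        using e by (intro exI[of _ "[4,4,4,5]"]) simp
      ultimately show ?thesis using e f tau n3 3 by simp
    next
      assume f: "\<not> (\<exists>L0\<in>A. triple_points_on A L0 = {})" and e: "has_exponents A [4,4,4]"
      have "has_type A 2" using has_type_of_exponents[OF e assms(2)] by simp
      moreover have "\<exists>es. has_exponents A es \<and> 3 \<le> length es \<and> es ! 0 = 4 \<and> es ! 1 = 4 \<and> es ! 2 = 4"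
        using e by (intro exI[of _ "[4,4,4]"]) simp
      ultimately show ?thesis using e f tau n3 3 by simp
    qed
  next
    case 4
    obtain g where g: "g \<in> W" "card {B \<in> blocks W. g \<in> B} < 2"
      using exists_small_degree[OF T W7, of 2] 4 by auto
    show ?thesis
    proof (cases "card {B \<in> blocks W. g \<in> B} = 0")
      case True
      then have "4 \<le> card {B \<in> blocks W. g \<notin> B}" using delete_element(3)[OF T W7 g(1)] 4 by simp
      from labelling_quadrilateral[OF T W7 g(1) this] 4
      obtain h where "labelling W (blocks W) h quad" by auto
      then have L: "labelled W h quad" by (rule lab) auto
      have e: "has_exponents A [3,4,5]" by (rule quadrilateral_exponents[OF L AR])
      have "\<exists>k\<in>{0..<7}. \<forall>B\<in>quad. k \<notin> B" by code_simp
      then have f: "\<exists>L0\<in>A. triple_points_on A L0 = {}"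
        unfolding lines_without_triple_points(1)[OF L AW] .
      have "\<not> (\<exists>k\<in>{0..<7}. \<exists>B\<in>quad. k \<in> B \<and> (\<forall>C\<in>quad. k \<in> C \<longrightarrow> C = B))"
        unfolding labels_explicit by (simp add: set_eq_subset)
      then have o: "\<not> (\<exists>L1\<in>A. card (triple_points_on A L1) = 1)"
        unfolding lines_without_triple_points(2)[OF L AW] .
      have "plus_one_generated A"
        using e assms(2) unfolding plus_one_generated_def
        by (intro exI[of _ 3] exI[of _ 4] exI[of _ 5]) simp
      then show ?thesis using e f o tau n3 4 by simp
    next
      case False
      then have "card {B \<in> blocks W. g \<in> B} = 1" using g(2) by linarith
      from labelling_four_loose[OF T W7 4 g(1) this]
      obtain h i j where ij: "(i, j) \<in> {(0,5),(1,4),(2,3),(2,4),(2,5),(4,5)}"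
        and "labelling W (blocks W) h {{0,1,2},{0,3,4},{1,3,5},{6,i,j}}" by blast
      moreover have "{{0,1,2},{0,3,4},{1,3,5},{6,i,j}} \<subseteq> Pow {0..<7}" using ij by auto
      ultimately have L: "labelled W h {{0,1,2},{0,3,4},{1,3,5},{6,i,j}}" by (intro lab)
      have mdr: "mdr (defining_poly A) = 4" by (rule four_triple_points_mdr[OF L AR ij])
      have "\<not> (\<exists>k\<in>{0..<7}. \<forall>B\<in>{{0,1,2},{0,3,4},{1,3,5},{6,i,j}}. k \<notin> B)"
        unfolding labels_explicit using ij by auto
      then have f: "\<not> (\<exists>L0\<in>A. triple_points_on A L0 = {})"
        unfolding lines_without_triple_points(1)[OF L AW] .
      have "\<exists>k\<in>{0..<7}. \<exists>B\<in>{{0,1,2},{0,3,4},{1,3,5},{6,i,j}}. k \<in> B \<and>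
          (\<forall>C\<in>{{0,1,2},{0,3,4},{1,3,5},{6,i,j}}. k \<in> C \<longrightarrow> C = B)"
        using ij by (intro bexI[of _ 6] bexI[of _ "{6,i,j}"]) auto
      then have o: "\<exists>L1\<in>A. card (triple_points_on A L1) = 1"
        unfolding lines_without_triple_points(2)[OF L AW] .
      have "maximal_tjurina A 7 4"
        using assms(2) mdr tau 4 by (simp add: maximal_tjurina_def choose_two)
      then show ?thesis using mdr assms(4) f o tau n3 4 by simp
    qed
  next
    case 5
    have e: "has_exponents A [3,4,4]"
    proof (cases "\<exists>g\<in>W. card {B \<in> blocks W. g \<in> B} < 2")
      case True
      then obtain g where g: "g \<in> W" "card {B \<in> blocks W. g \<in> B} < 2" by blast
      then have "4 \<le> card {B \<in> blocks W. g \<notin> B}" using delete_element(3)[OF T W7 g(1)] 5 by simp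
      from labelling_quadrilateral[OF T W7 g(1) this] 5
      obtain h where "labelling W (blocks W) h (quad \<union> {{6,0,5}})" by auto
      then have L: "labelled W h (quad \<union> {{6,0,5}})" by (rule lab) auto
      show ?thesis by (rule quadrilateral_one_point_exponents[OF L AR])
    next
      case False
      then obtain h where "labelling W (blocks W) h grid"
        using labelling_five_dense[OF T W7 5] by (meson not_less)
      then have L: "labelled W h grid" by (rule lab) auto
      show ?thesis by (rule grid_labelled_exponents[OF L AR])
    qed
    have "nearly_free A"
      using e assms(2) unfolding nearly_free_def
      by (intro exI[of _ 3] exI[of _ 4]) simp
    then show ?thesis using e tau n3 5 by simp
  next
    case 6
    obtain g where g: "g \<in> W" "card {B \<in> blocks W. g \<in> B} < 3"
      using exists_small_degree[OF T W7, of 3] 6 by auto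
    then have "4 \<le> card {B \<in> blocks W. g \<notin> B}" using delete_element(3)[OF T W7 g(1)] 6 by simp
    from labelling_quadrilateral[OF T W7 g(1) this] 6
    obtain h where "labelling W (blocks W) h (quad \<union> {{6,0,5},{6,1,4}})" by auto
    then have L: "labelled W h (quad \<union> {{6,0,5},{6,1,4}})" by (rule lab) auto
    show ?thesis using quadrilateral_two_points_exponents[OF L AR] tau n3 6 by simp
  qed
qed

end
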